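(* Let $(X,\tau)$ be a Hausdorff definable topological space in $\mathcal{R}$ with $X\subseteq R$. Then $(X,\tau)$ is regular if and only if there exist a definably compact Hausdorff definable topological space $(X^c,\tau^c)$ with $\dim X^c\leq 1$ and a definable embedding $(X,\tau)\hookrightarrow(X^c,\tau^c)$.
   Context: $\mathcal{R}=(R,<,\dots)$ is an arbitrary o-minimal expansion of a dense linear order without endpoints; "definable" means definable in $\mathcal{R}$ with parameters; $\dim$ is o-minimal dimension. A definable topological space is a pair $(X,\tau)$ with $X\subseteq R^n$ definable and $\tau$ a topology on $X$ with a basis which is a definable family of sets; a definable embedding is a definable map which is a homeomorphism onto its image. A definable curve in $X$ is a definable map $\gamma:(a,b)\to X$ with $a<b$ in $R\cup\{\pm\infty\}$; it $\tau$-converges to $x$ as $t\to a$ if for every $\tau$-neighbourhood $U$ of $x$ there is $t_U\in(a,b)$ with $\gamma(t)\in U$ for all $a<t<t_U$ (similarly as $t\to b$). $(X,\tau)$ is definably compact if every definable curve in $X$ $\tau$-converges (to some point of $X$) both as $t\to a$ and as $t\to b$. *)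

theory Defs
  imports "HOL-Analysis.Analysis" "HOL-Library.Extended"
begin

text \<open>
  The type \<open>'a::unbounded_dense_linorder\<close> is the dense linear order without endpoints, and
  points of \<open>R\<^sup>n\<close> are lists of length \<open>n\<close> over \<open>'a\<close>.
\<close>

subsection \<open>First-order expansions of the order\<close>

text \<open>
  Symbols carry no fixed arity: a symbol is interpreted on argument lists of every length, so in
  effect the symbols of the language are pairs of a name and an arity.  Any ordinary signature
  embeds by interpreting a name at the arities it does not have as a constant function, or as the
  empty relation; this does not change the sets definable with parameters.
\<close>

record ('f, 'r, 'a) expansion =
  func :: "'f \<Rightarrow> 'a list \<Rightarrow> 'a"
  rel :: "'r \<Rightarrow> 'a list \<Rightarrow> bool"

datatype 'f trm = Var nat | App 'f "'f trm list"

datatype ('f, 'r) fm =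
    Equal "'f trm" "'f trm"
  | Less "'f trm" "'f trm"
  | Rel 'r "'f trm list"
  | Neg "('f, 'r) fm"
  | Conj "('f, 'r) fm" "('f, 'r) fm"
  | Exist "('f, 'r) fm"  \<comment> \<open>de Bruijn: binds variable 0\<close>

primrec eval :: "('f, 'r, 'a) expansion \<Rightarrow> (nat \<Rightarrow> 'a) \<Rightarrow> 'f trm \<Rightarrow> 'a" where
  "eval M e (Var i) = e i"
| "eval M e (App f ts) = func M f (map (eval M e) ts)"

primrec sat ::
  "('f, 'r, 'a::linorder) expansion \<Rightarrow> (nat \<Rightarrow> 'a) \<Rightarrow> ('f, 'r) fm \<Rightarrow> bool" where
  "sat M e (Equal s t) \<longleftrightarrow> eval M e s = eval M e t"
| "sat M e (Less s t) \<longleftrightarrow> eval M e s < eval M e t"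
| "sat M e (Rel r ts) \<longleftrightarrow> rel M r (map (eval M e) ts)"
| "sat M e (Neg p) \<longleftrightarrow> \<not> sat M e p"
| "sat M e (Conj p q) \<longleftrightarrow> sat M e p \<and> sat M e q"
| "sat M e (Exist p) \<longleftrightarrow> (\<exists>a. sat M (case_nat a e) p)"

text \<open>
  Definability with parameters of a subset of \<open>R\<^sup>n\<close>.  The variables from \<open>n\<close> on take their values
  in \<open>c\<close>; a formula mentions only finitely many of them, and these are the parameters.
\<close>

definition definable ::
  "('f, 'r, 'a::linorder) expansion \<Rightarrow> nat \<Rightarrow> 'a list set \<Rightarrow> bool" where
  "definable M n A \<longleftrightarrow>
     (\<exists>p c. A = {xs. length xs = n \<and> sat M (\<lambda>i. if i < n then xs ! i else c i) p})"

definition definable_map ::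
  "('f, 'r, 'a::linorder) expansion \<Rightarrow> nat \<Rightarrow> nat \<Rightarrow> 'a list set \<Rightarrow> 'a list set
     \<Rightarrow> ('a list \<Rightarrow> 'a list) \<Rightarrow> bool" where
  "definable_map M m n A B f \<longleftrightarrow>
     f ` A \<subseteq> B \<and> definable M (m + n) ((\<lambda>x. x @ f x) ` A)"

definition ointerval :: "'a::linorder extended \<Rightarrow> 'a extended \<Rightarrow> 'a set" where
  "ointerval a b = {t. a < Fin t \<and> Fin t < b}"

definition o_minimal :: "('f, 'r, 'a::linorder) expansion \<Rightarrow> bool" where
  "o_minimal M \<longleftrightarrow>
     (\<forall>A. definable M 1 A \<longrightarrow>
        (\<exists>\<I>. finite \<I> \<and> {t. [t] \<in> A} = \<Union>\<I> \<and>
             (\<forall>I\<in>\<I>. (\<exists>t. I = {t}) \<or> (\<exists>a b. I = ointerval a b))))"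

subsection \<open>Cells and o-minimal dimension\<close>

text \<open>Continuity is with respect to the order topology on \<open>R\<close> and its powers.\<close>

definition continuous_def_fun ::
  "('f, 'r, 'a::linorder) expansion \<Rightarrow> nat \<Rightarrow> 'a list set \<Rightarrow> ('a list \<Rightarrow> 'a) \<Rightarrow> bool" where
  "continuous_def_fun M n C h \<longleftrightarrow>
     definable M (Suc n) ((\<lambda>x. x @ [h x]) ` C) \<and>
     (\<forall>x\<in>C. \<forall>c d. c < h x \<and> h x < d \<longrightarrow>
        (\<exists>l u. list_all2 (<) l x \<and> list_all2 (<) x u \<and>
           (\<forall>y\<in>C. list_all2 (<) l y \<and> list_all2 (<) y u \<longrightarrow> c < h y \<and> h y < d)))"

definition cell_bound ::
  "('f, 'r, 'a::linorder) expansion \<Rightarrow> nat \<Rightarrow> 'a list set \<Rightarrow> ('a list \<Rightarrow> 'a extended) \<Rightarrow> bool"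
  where
  "cell_bound M n C f \<longleftrightarrow>
     (\<exists>h. continuous_def_fun M n C h \<and> (\<forall>x\<in>C. f x = Fin (h x))) \<or>
     (\<forall>x\<in>C. f x = Pinf) \<or> (\<forall>x\<in>C. f x = Minf)"

text \<open>\<open>cell M ds C\<close>: \<open>C\<close> is a \<open>ds\<close>-cell, for a sequence \<open>ds\<close> of zeros and ones.\<close>

inductive cell :: "('f, 'r, 'a::linorder) expansion \<Rightarrow> nat list \<Rightarrow> 'a list set \<Rightarrow> bool"
  for M where
  point: "cell M [] {[]}"
| graph: "cell M ds C \<Longrightarrow> continuous_def_fun M (length ds) C h \<Longrightarrow>
    cell M (ds @ [0]) {x @ [t] |x t. x \<in> C \<and> t = h x}"
| band: "cell M ds C \<Longrightarrow> cell_bound M (length ds) C f \<Longrightarrow> cell_bound M (length ds) C g \<Longrightarrow>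
    (\<And>x. x \<in> C \<Longrightarrow> f x < g x) \<Longrightarrow>
    cell M (ds @ [1]) {x @ [t] |x t. x \<in> C \<and> t \<in> ointerval (f x) (g x)}"

text \<open>The supremum is a maximum for nonempty definable \<open>X\<close>; the empty set has dimension minus
  infinity.\<close>

definition odim :: "('f, 'r, 'a::linorder) expansion \<Rightarrow> 'a list set \<Rightarrow> ereal" where
  "odim M X = Sup {ereal (real (sum_list ds)) |ds C. cell M ds C \<and> C \<subseteq> X}"

subsection \<open>Definable topological spaces\<close>

text \<open>A definable family \<open>{B u | u \<in> \<Omega>}\<close> is given by the definable set of all \<open>u @ x\<close> with
  \<open>u \<in> \<Omega> \<subseteq> R\<^sup>k\<close> and \<open>x \<in> B u \<subseteq> R\<^sup>n\<close>.\<close>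

definition definable_family ::
  "('f, 'r, 'a::linorder) expansion \<Rightarrow> nat \<Rightarrow> 'a list set set \<Rightarrow> bool" where
  "definable_family M n \<B> \<longleftrightarrow>
     (\<exists>k \<Omega> B. definable M k \<Omega> \<and> \<B> = B ` \<Omega> \<and> (\<forall>u\<in>\<Omega>. \<forall>x\<in>B u. length x = n) \<and>
        definable M (k + n) {u @ x |u x. u \<in> \<Omega> \<and> x \<in> B u})"

text \<open>The set \<open>X \<subseteq> R\<^sup>n\<close> underlying the space is \<open>topspace T\<close>.\<close>

definition definable_top_space ::
  "('f, 'r, 'a::linorder) expansion \<Rightarrow> nat \<Rightarrow> 'a list topology \<Rightarrow> bool" where
  "definable_top_space M n T \<longleftrightarrow>
     definable M n (topspace T) \<and>
     (\<exists>\<B>. definable_family M n \<B> \<and> (\<forall>V\<in>\<B>. openin T V) \<and>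
        (\<forall>U x. openin T U \<and> x \<in> U \<longrightarrow> (\<exists>V\<in>\<B>. x \<in> V \<and> V \<subseteq> U)))"

definition definable_curve ::
  "('f, 'r, 'a::linorder) expansion \<Rightarrow> nat \<Rightarrow> 'a list set
     \<Rightarrow> 'a extended \<Rightarrow> 'a extended \<Rightarrow> ('a \<Rightarrow> 'a list) \<Rightarrow> bool" where
  "definable_curve M n X a b \<gamma> \<longleftrightarrow>
     a < b \<and> \<gamma> ` ointerval a b \<subseteq> X \<and>
     definable M (Suc n) ((\<lambda>t. t # \<gamma> t) ` ointerval a b)"

definition converges_left ::
  "'a list topology \<Rightarrow> 'a::linorder extended \<Rightarrow> 'a extended \<Rightarrow> ('a \<Rightarrow> 'a list) \<Rightarrow> 'a list \<Rightarrow> bool"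
  where
  "converges_left T a b \<gamma> x \<longleftrightarrow>
     (\<forall>U. openin T U \<and> x \<in> U \<longrightarrow>
        (\<exists>s\<in>ointerval a b. \<forall>t\<in>ointerval a (Fin s). \<gamma> t \<in> U))"

definition converges_right ::
  "'a list topology \<Rightarrow> 'a::linorder extended \<Rightarrow> 'a extended \<Rightarrow> ('a \<Rightarrow> 'a list) \<Rightarrow> 'a list \<Rightarrow> bool"
  where
  "converges_right T a b \<gamma> x \<longleftrightarrow>
     (\<forall>U. openin T U \<and> x \<in> U \<longrightarrow>
        (\<exists>s\<in>ointerval a b. \<forall>t\<in>ointerval (Fin s) b. \<gamma> t \<in> U))"

definition definably_compact ::
  "('f, 'r, 'a::linorder) expansion \<Rightarrow> nat \<Rightarrow> 'a list topology \<Rightarrow> bool" where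
  "definably_compact M n T \<longleftrightarrow>
     (\<forall>a b \<gamma>. definable_curve M n (topspace T) a b \<gamma> \<longrightarrow>
        (\<exists>x\<in>topspace T. converges_left T a b \<gamma> x) \<and>
        (\<exists>y\<in>topspace T. converges_right T a b \<gamma> y))"

definition definable_embedding ::
  "('f, 'r, 'a::linorder) expansion \<Rightarrow> nat \<Rightarrow> nat \<Rightarrow> 'a list topology \<Rightarrow> 'a list topology
     \<Rightarrow> ('a list \<Rightarrow> 'a list) \<Rightarrow> bool" where
  "definable_embedding M m n S T f \<longleftrightarrow>
     definable_map M m n (topspace S) (topspace T) f \<and> embedding_map S T f"

end

theory Submission
  imports Defs
begin

text \<open>
  By o-minimality a directed definable family of nonempty subsets of the line is contained in a
  germ: a point, a side of a point, or an end of the line.  Hence the topology of \<open>X\<close> is governed by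
  the partial map sending a germ to its limit, and \<open>x\<close> lies in the closure of a definable set iff a
  germ of that set converges to \<open>x\<close>.

  If \<open>X\<close> embeds in a definably compact Hausdorff space but is not regular at \<open>x\<close>, the closures of the
  neighbourhoods of \<open>x\<close> minus a fixed neighbourhood lie in a common germ.  The curve along this germ
  converges in the compact space, and its limit can neither equal the image of \<open>x\<close> nor differ from it.

  Conversely, let \<open>X\<close> be regular.  Up to finitely many points, the points that are limits of sides
  of the same points form a definable equivalence relation with finite classes, and
  saturated open intervals are \<open>\<tau>\<close>-open; this uses regularity, the monotonicity theorem, and the
  fact that only finitely many germs converge to a given point.  One new point is added for each
  class of inseparable non-convergent germs.  An open set \<open>V\<close> is extended by the classes all of whose
  germs lie in \<open>V\<close>; saturations of small intervals then form definable neighbourhood bases at the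
  new points, and the limit of the germ of a curve gives definable compactness.
\<close>

section \<open>Definable predicates\<close>

text \<open>The obstacle is the finiteness of the set of germs converging to a point. If infinitely
  many sides converged to x, each basic neighbourhood of x would miss only finitely many points of
  some interval, but the basis has k parameters and no uniform bound for these finite sets is at
  hand. A dimension count replaces it: finite sets depending on k parameters cannot capture generic
  tuples of k + 1 points. It rests on exchanging two "infinitely many" quantifiers, which comes from
  the monotonicity theorem. One obtains a finite set meeting every basic neighbourhood of x,
  contrary to the Hausdorff property. Other exceptional sets are finite by selection: on an interval
  of exceptions a witness is chosen definably, and where the choice is a local homeomorphism the
  exception disappears. Infinitely many points may have to be added: for the discrete topology on
  the line no side converges and every side becomes a new point. This is why the compactification is
  coded in the plane by a base point and one of five labels, and why curves of new points need
  limits too.\<close>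

primrec ren_trm :: "(nat \<Rightarrow> nat) \<Rightarrow> 'f trm \<Rightarrow> 'f trm" where
  "ren_trm \<rho> (Var i) = Var (\<rho> i)"
| "ren_trm \<rho> (App f ts) = App f (map (ren_trm \<rho>) ts)"

primrec ren :: "(nat \<Rightarrow> nat) \<Rightarrow> ('f, 'r) fm \<Rightarrow> ('f, 'r) fm" where
  "ren \<rho> (Equal s t) = Equal (ren_trm \<rho> s) (ren_trm \<rho> t)"
| "ren \<rho> (Less s t) = Less (ren_trm \<rho> s) (ren_trm \<rho> t)"
| "ren \<rho> (Rel r ts) = Rel r (map (ren_trm \<rho>) ts)"
| "ren \<rho> (Neg p) = Neg (ren \<rho> p)"
| "ren \<rho> (Conj p q) = Conj (ren \<rho> p) (ren \<rho> q)"
| "ren \<rho> (Exist p) = Exist (ren (case_nat 0 (\<lambda>i. Suc (\<rho> i))) p)"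

lemma eval_ren: "eval M e (ren_trm \<rho> t) = eval M (\<lambda>i. e (\<rho> i)) t"
  by (induction t) (simp_all add: comp_def cong: map_cong)

lemma sat_ren: "sat M e (ren \<rho> p) = sat M (\<lambda>i. e (\<rho> i)) p"
proof (induction p arbitrary: e \<rho>)
  case (Exist p)
  have "(\<lambda>i. case_nat a e (case_nat 0 (\<lambda>i. Suc (\<rho> i)) i)) = case_nat a (\<lambda>i. e (\<rho> i))" for a
    by (auto split: nat.split)
  then show ?case by (simp add: Exist)
qed (simp_all add: eval_ren comp_def cong: map_cong)

text \<open>Splitting by parity rather than at a bound leaves infinitely many slots to the
  environment and to the parameters alike. The closure rules therefore never count free variables,
  and fresh parameters can always be inserted.\<close>

definition interleave :: "(nat \<Rightarrow> 'a) \<Rightarrow> (nat \<Rightarrow> 'a) \<Rightarrow> nat \<Rightarrow> 'a" where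
  "interleave e c i = (if even i then e (i div 2) else c (i div 2))"

lemma interleave_simps [simp]:
  "interleave e c (2 * i) = e i" "interleave e c (Suc (2 * i)) = c i" "interleave e c 0 = e 0"
  by (auto simp: interleave_def)

locale expansion_line =
  fixes M :: "('f, 'r, 'a::unbounded_dense_linorder) expansion"
begin

text \<open>Definability is stated for predicates on environments, so that it can be proved along the
  syntax of a higher-order term.  The formula sees an environment on its even variables and the
  parameters on its odd ones.\<close>

definition defpred :: "((nat \<Rightarrow> 'a) \<Rightarrow> bool) \<Rightarrow> bool" where
  "defpred P \<longleftrightarrow> (\<exists>p c. \<forall>e. P e \<longleftrightarrow> sat M (interleave e c) p)"

text \<open>Only the graph counts, with the value in variable 0; hence any definable function may be
  substituted like a term.\<close>

definition defterm :: "((nat \<Rightarrow> 'a) \<Rightarrow> 'a) \<Rightarrow> bool" where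
  "defterm f \<longleftrightarrow> defpred (\<lambda>e. e 0 = f (\<lambda>i. e (Suc i)))"

lemma defpred_reindex:
  assumes "\<And>e. P e \<longleftrightarrow> sat M (\<lambda>i. interleave e c (\<rho> i)) p"
  shows "defpred P"
  unfolding defpred_def by (rule exI[of _ "ren \<rho> p"], rule exI[of _ c]) (simp add: sat_ren assms)

lemma defpred_not: "defpred P \<Longrightarrow> defpred (\<lambda>e. \<not> P e)"
proof -
  assume "defpred P"
  then obtain p c where "\<And>e. P e \<longleftrightarrow> sat M (interleave e c) p"
    unfolding defpred_def by blast
  then show ?thesis
    unfolding defpred_def by (intro exI[of _ "Neg p"] exI[of _ c]) simp
qed

lemma defpred_conj:
  assumes "defpred P" "defpred Q"
  shows "defpred (\<lambda>e. P e \<and> Q e)"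
proof -
  obtain p c q d where p: "\<And>e. P e \<longleftrightarrow> sat M (interleave e c) p"
    and q: "\<And>e. Q e \<longleftrightarrow> sat M (interleave e d) q"
    using assms unfolding defpred_def by blast
  \<comment> \<open>Parameter j is moved to 2 * j + k, so that both parameter sequences fit into the
    single sequence \<open>interleave c d\<close>.\<close>
  define \<rho> where "\<rho> k i = (if even i then i else Suc (2 * (2 * (i div 2) + k)))" for k i :: nat
  have "(\<lambda>i. interleave e (interleave c d) (\<rho> 0 i)) = interleave e c"
    "(\<lambda>i. interleave e (interleave c d) (\<rho> 1 i)) = interleave e d" for e
    by (auto simp: fun_eq_iff \<rho>_def interleave_def elim!: oddE)
  then have "P e \<and> Q e \<longleftrightarrow> sat M (interleave e (interleave c d)) (Conj (ren (\<rho> 0) p) (ren (\<rho> 1) q))"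
    for e
    by (simp add: sat_ren p q)
  then show ?thesis unfolding defpred_def by blast
qed

lemma defpred_ren:
  assumes "defpred P"
  shows "defpred (\<lambda>e. P (\<lambda>i. e (\<rho> i)))"
proof -
  obtain p c where p: "\<And>e. P e \<longleftrightarrow> sat M (interleave e c) p"
    using assms unfolding defpred_def by blast
  have "(\<lambda>i. interleave e c (if even i then 2 * \<rho> (i div 2) else i)) = interleave (\<lambda>i. e (\<rho> i)) c"
    for e
    by (auto simp: interleave_def)
  then show ?thesis
    by (intro defpred_reindex[of _ c "\<lambda>i. if even i then 2 * \<rho> (i div 2) else i" p]) (simp add: p)
qed

lemma defpred_inst:
  assumes "defpred P"
  shows "defpred (\<lambda>e. P (case_nat a e))"
proof -
  obtain p c where p: "\<And>e. P e \<longleftrightarrow> sat M (interleave e c) p"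
    using assms unfolding defpred_def by blast
  \<comment> \<open>The instantiated value becomes parameter 0; the other parameters move up by one
    and the remaining environment down by one.\<close>
  let ?\<rho> = "\<lambda>i. if i = 0 then 1 else if even i then i - 2 else i + 2"
  have "interleave e (case_nat a c) (?\<rho> i) = interleave (case_nat a e) c i" for e i
  proof (cases "even i")
    case True
    then obtain j where "i = 2 * j" by blast
    then show ?thesis by (cases j) (auto simp: interleave_def)
  next
    case False
    then obtain j where "i = 2 * j + 1" by (metis oddE)
    then show ?thesis by (auto simp: interleave_def)
  qed
  then show ?thesis
    by (intro defpred_reindex[of _ "case_nat a c" ?\<rho> p]) (simp add: p)
qed

lemma defpred_ex:
  assumes "defpred (\<lambda>e. P (e 0) (\<lambda>i. e (Suc i)))"
  shows "defpred (\<lambda>e. \<exists>a. P a e)"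
proof -
  obtain p c where p: "\<And>e. P (e 0) (\<lambda>i. e (Suc i)) \<longleftrightarrow> sat M (interleave e c) p"
    using assms unfolding defpred_def by blast
  \<comment> \<open>A quantifier shifts all variables by one and so reverses parities; this renaming
    restores the convention under the binder.\<close>
  let ?\<rho> = "\<lambda>i. if i = 0 then 0 else if even i then i - 1 else Suc i"
  have "case_nat a (interleave e c) (?\<rho> i) = interleave (case_nat a e) c i" for a e i
  proof (cases "even i")
    case True
    then obtain j where "i = 2 * j" by blast
    then show ?thesis by (cases j) (auto simp: interleave_def)
  next
    case False
    then obtain j where "i = 2 * j + 1" by (metis oddE)
    then show ?thesis by (auto simp: interleave_def)
  qed
  then have "sat M (interleave e c) (Exist (ren ?\<rho> p)) \<longleftrightarrow>
      (\<exists>a. sat M (interleave (case_nat a e) c) p)" for e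
    by (simp add: sat_ren)
  moreover have "sat M (interleave (case_nat a e) c) p \<longleftrightarrow> P a e" for a e
    using p[of "case_nat a e"] by simp
  ultimately show ?thesis unfolding defpred_def by blast
qed

lemma defpred_eq_var: "defpred (\<lambda>e. e i = e j)"
  by (rule defpred_reindex[of _ undefined "\<lambda>i. 2 * i" "Equal (Var i) (Var j)"]) simp

lemma defpred_less_var: "defpred (\<lambda>e. e i < e j)"
  by (rule defpred_reindex[of _ undefined "\<lambda>i. 2 * i" "Less (Var i) (Var j)"]) simp

lemma defterm_var: "defterm (\<lambda>e. e i)"
  unfolding defterm_def by (rule defpred_eq_var)

lemma defterm_const: "defterm (\<lambda>e. c)"
proof -
  have "defpred (\<lambda>e. case_nat c e 1 = case_nat c e 0)" by (rule defpred_inst) (rule defpred_eq_var)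
  then show ?thesis by (simp add: defterm_def)
qed

lemma defterm_ren:
  assumes "defterm f"
  shows "defterm (\<lambda>e. f (\<lambda>i. e (\<rho> i)))"
  using defpred_ren[OF assms[unfolded defterm_def], of "case_nat 0 (\<lambda>i. Suc (\<rho> i))"]
  by (simp add: defterm_def)

text \<open>A definable function is not a syntactic term, so its value is introduced by a quantifier
  and tied to the graph.\<close>

lemma defpred_let:
  assumes "defterm f" "defpred (\<lambda>e. P (e 0) (\<lambda>i. e (Suc i)))"
  shows "defpred (\<lambda>e. P (f e) e)"
proof -
  have "defpred (\<lambda>e. \<exists>a. a = f e \<and> P a e)"
    by (rule defpred_ex, rule defpred_conj) (use assms in \<open>auto simp: defterm_def\<close>)
  then show ?thesis by simp
qed

section \<open>Definable sets, relations and functions of the line\<close>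

definition def2 :: "('a \<Rightarrow> 'a \<Rightarrow> bool) \<Rightarrow> bool" where
  "def2 R \<longleftrightarrow> defpred (\<lambda>e. R (e 0) (e 1))"

definition tame :: "'a set \<Rightarrow> bool" where
  "tame A \<longleftrightarrow> defpred (\<lambda>e. e 0 \<in> A)"

definition deffun :: "('a \<Rightarrow> 'a) \<Rightarrow> bool" where
  "deffun f \<longleftrightarrow> defpred (\<lambda>e. e 0 = f (e 1))"

lemma defpred_rel2:
  assumes "def2 R" "defterm f" "defterm g"
  shows "defpred (\<lambda>e. R (f e) (g e))"
proof (rule defpred_let[OF assms(2), where P = "\<lambda>a e. R a (g e)"],
    rule defpred_let[OF defterm_ren[OF assms(3)], where P = "\<lambda>b e. R (e 0) b"])
  show "defpred (\<lambda>e. R (e (Suc 0)) (e 0))"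
    using defpred_ren[OF assms(1)[unfolded def2_def], of "\<lambda>i. 1 - i"] by simp
qed

lemma defpred_tame: "tame S \<Longrightarrow> defterm f \<Longrightarrow> defpred (\<lambda>e. f e \<in> S)"
  by (rule defpred_let[where P = "\<lambda>a e. a \<in> S"]) (simp_all add: tame_def)

lemma defterm_app:
  assumes "deffun h" "defterm f"
  shows "defterm (\<lambda>e. h (f e))"
  unfolding defterm_def
proof (rule defpred_rel2[of "\<lambda>x y. y = h x"])
  show "def2 (\<lambda>x y. y = h x)"
    using defpred_ren[OF assms(1)[unfolded deffun_def], of "\<lambda>i. 1 - i"] by (simp add: def2_def)
  show "defterm (\<lambda>e. f (\<lambda>i. e (Suc i)))" by (rule defterm_ren[OF assms(2)])
qed (rule defterm_var)

lemma defpred_eq: "defterm f \<Longrightarrow> defterm g \<Longrightarrow> defpred (\<lambda>e. f e = g e)"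
  by (rule defpred_rel2[where R = "(=)"]) (simp_all add: def2_def defpred_eq_var)

lemma defpred_less: "defterm f \<Longrightarrow> defterm g \<Longrightarrow> defpred (\<lambda>e. f e < g e)"
  by (rule defpred_rel2[where R = "(<)"]) (simp_all add: def2_def defpred_less_var)

lemma defpred_le: "defterm f \<Longrightarrow> defterm g \<Longrightarrow> defpred (\<lambda>e. f e \<le> g e)"
  unfolding not_less[symmetric] by (intro defpred_not defpred_less)

lemma defpred_const: "defpred (\<lambda>e. Q)"
proof (cases Q)
  case True
  then show ?thesis using defpred_eq_var[of 0 0] by simp
next
  case False
  then show ?thesis using defpred_not[OF defpred_eq_var[of 0 0]] by simp
qed

lemma defpred_disj:
  assumes "defpred P" "defpred Q"
  shows "defpred (\<lambda>e. P e \<or> Q e)"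
proof -
  have "defpred (\<lambda>e. \<not> (\<not> P e \<and> \<not> Q e))" by (intro defpred_not defpred_conj assms)
  then show ?thesis by simp
qed

lemma defpred_imp: "defpred P \<Longrightarrow> defpred Q \<Longrightarrow> defpred (\<lambda>e. P e \<longrightarrow> Q e)"
  unfolding imp_conv_disj by (intro defpred_disj defpred_not)

lemma defpred_iff: "defpred P \<Longrightarrow> defpred Q \<Longrightarrow> defpred (\<lambda>e. P e \<longleftrightarrow> Q e)"
  unfolding iff_conv_conj_imp by (intro defpred_conj defpred_imp)

lemma defpred_all:
  assumes "defpred (\<lambda>e. P (e 0) (\<lambda>i. e (Suc i)))"
  shows "defpred (\<lambda>e. \<forall>a. P a e)"
proof -
  have "defpred (\<lambda>e. \<not> (\<exists>a. \<not> P a e))" by (intro defpred_not defpred_ex assms)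
  then show ?thesis by simp
qed

section \<open>Quantification over tuples\<close>

lemma defpred_fin_all: "(\<And>i. i < (n::nat) \<Longrightarrow> defpred (P i)) \<Longrightarrow> defpred (\<lambda>e. \<forall>i<n. P i e)"
proof (induction n)
  case 0
  then show ?case by (simp add: defpred_const)
next
  case (Suc n)
  then show ?case by (simp add: All_less_Suc defpred_conj)
qed

lemma defpred_ex_list:
  "defpred (\<lambda>e. P (map e [0..<n]) (\<lambda>i. e (i + n))) \<Longrightarrow> defpred (\<lambda>e. \<exists>u. length u = n \<and> P u e)"
proof (induction n arbitrary: P)
  case 0
  then show ?case by simp
next
  case (Suc n)
  \<comment> \<open>The induction hypothesis stores the tail in variables 0 to n - 1 and the head in
    variable n; the rotation brings the head to the front.\<close>
  let ?\<rho> = "\<lambda>i. if i = 0 then n else if i \<le> n then i - 1 else i"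
  have *: "map (\<lambda>i. e (?\<rho> i)) [0..<Suc n] = e n # map e [0..<n]" for e :: "nat \<Rightarrow> 'a"
    by (rule nth_equalityI) (auto simp: nth_Cons nth_append less_Suc_eq split: nat.split)
  have "defpred (\<lambda>e. P (e n # map e [0..<n]) (\<lambda>i. e (Suc i + n)))"
    using defpred_ren[OF Suc.prems, of ?\<rho>] unfolding * by simp
  then have "defpred (\<lambda>e. \<exists>u. length u = n \<and> P (e 0 # u) (\<lambda>i. e (Suc i)))"
    by (intro Suc.IH) simp
  then have "defpred (\<lambda>e. \<exists>a u. length u = n \<and> P (a # u) e)" by (rule defpred_ex)
  moreover have "(\<exists>a u. length u = n \<and> P (a # u) e) \<longleftrightarrow> (\<exists>u. length u = Suc n \<and> P u e)" for e
    by (auto simp: length_Suc_conv)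
  ultimately show ?case by simp
qed

lemma defpred_all_list:
  "defpred (\<lambda>e. P (map e [0..<n]) (\<lambda>i. e (i + n))) \<Longrightarrow> defpred (\<lambda>e. \<forall>u. length u = n \<longrightarrow> P u e)"
proof -
  assume "defpred (\<lambda>e. P (map e [0..<n]) (\<lambda>i. e (i + n)))"
  then have "defpred (\<lambda>e. \<not> (\<exists>u. length u = n \<and> \<not> P u e))" by (intro defpred_not defpred_ex_list)
  then show ?thesis by simp
qed

definition deftuple :: "nat \<Rightarrow> ((nat \<Rightarrow> 'a) \<Rightarrow> 'a list) \<Rightarrow> bool" where
  "deftuple n L \<longleftrightarrow> (\<forall>e. length (L e) = n) \<and> (\<forall>i<n. defterm (\<lambda>e. L e ! i))"

lemma deftuple_Nil: "deftuple 0 (\<lambda>e. [])"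
  by (simp add: deftuple_def)

lemma deftuple_Cons:
  assumes "defterm f" "deftuple n L"
  shows "deftuple (Suc n) (\<lambda>e. f e # L e)"
  unfolding deftuple_def
proof (intro conjI allI impI)
  fix i assume "i < Suc n"
  then show "defterm (\<lambda>e. (f e # L e) ! i)"
    using assms by (cases i) (auto simp: deftuple_def)
qed (use assms in \<open>simp add: deftuple_def\<close>)

lemma deftuple_append:
  assumes "deftuple m K" "deftuple n L"
  shows "deftuple (m + n) (\<lambda>e. K e @ L e)"
  unfolding deftuple_def
proof (intro conjI allI impI)
  fix i assume i: "i < m + n"
  have len: "length (K e) = m" for e using assms by (simp add: deftuple_def)
  show "defterm (\<lambda>e. (K e @ L e) ! i)"
  proof (cases "i < m")
    case True
    then show ?thesis using assms by (simp add: deftuple_def nth_append)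
  next
    case False
    then have "defterm (\<lambda>e. L e ! (i - m))" using assms i by (simp add: deftuple_def)
    with False show ?thesis by (simp add: nth_append len)
  qed
qed (use assms in \<open>simp add: deftuple_def\<close>)

lemma deftuple_map: "(\<And>i. i < n \<Longrightarrow> defterm (f i)) \<Longrightarrow> deftuple n (\<lambda>e. map (\<lambda>i. f i e) [0..<n])"
  by (simp add: deftuple_def)

lemma deftuple_vars: "deftuple n (\<lambda>e. map e [0..<n])"
  using deftuple_map[of n "\<lambda>i e. e i"] by (simp add: defterm_var)

lemma deftuple_ren: "deftuple n (\<lambda>e. map (\<lambda>i. e (\<rho> i)) [0..<n])"
  by (intro deftuple_map defterm_var)

lemma deftuple_const: "length u = n \<Longrightarrow> deftuple n (\<lambda>e. u)"
  by (simp add: deftuple_def defterm_const)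

section \<open>Translation between definable sets and definable predicates\<close>

lemma defpred_definable:
  assumes A: "definable M n A" and L: "deftuple n L"
  shows "defpred (\<lambda>e. L e \<in> A)"
proof -
  obtain p c where p: "A = {xs. length xs = n \<and> sat M (\<lambda>i. if i < n then xs ! i else c i) p}"
    using A unfolding definable_def by blast
  have "defpred (\<lambda>e. map e [0..<n] \<in> A)"
  proof (rule defpred_reindex[of _ c "\<lambda>i. if i < n then 2 * i else Suc (2 * i)" p])
    fix e
    have "(\<lambda>i. if i < n then map e [0..<n] ! i else c i) =
        (\<lambda>i. interleave e c (if i < n then 2 * i else Suc (2 * i)))"
      by auto
    then show "map e [0..<n] \<in> A \<longleftrightarrow> sat M (\<lambda>i. interleave e c (if i < n then 2 * i else Suc (2 * i)))
        p"
      by (simp add: p)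
  qed
  moreover have "defpred (\<lambda>e. \<forall>i<n. map e [0..<n] ! i = L (\<lambda>i. e (i + n)) ! i)"
  proof (rule defpred_fin_all)
    fix i assume "i < n"
    then show "defpred (\<lambda>e. map e [0..<n] ! i = L (\<lambda>i. e (i + n)) ! i)"
      using defpred_eq[OF defterm_var defterm_ren[of "\<lambda>e. L e ! i" "\<lambda>i. i + n"], of i] L
        by (simp add: deftuple_def)
  qed
  ultimately have "defpred (\<lambda>e. \<exists>u. length u = n \<and> (\<forall>i<n. u ! i = L e ! i) \<and> u \<in> A)"
    by (intro defpred_ex_list defpred_conj)
  moreover have "(\<exists>u. length u = n \<and> (\<forall>i<n. u ! i = L e ! i) \<and> u \<in> A) \<longleftrightarrow> L e \<in> A" for e
  proof
    assume "\<exists>u. length u = n \<and> (\<forall>i<n. u ! i = L e ! i) \<and> u \<in> A"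
    then obtain u where u: "length u = n" "\<forall>i<n. u ! i = L e ! i" "u \<in> A" by blast
    with L have "u = L e" by (intro nth_equalityI) (auto simp: deftuple_def)
    with u show "L e \<in> A" by simp
  qed (use L in \<open>auto simp: deftuple_def\<close>)
  ultimately show ?thesis by simp
qed

lemma definable_of_defpred:
  assumes "defpred P"
  shows "definable M n {xs. length xs = n \<and> P (\<lambda>i. if i < n then xs ! i else d i)}"
proof -
  obtain p c where p: "\<And>e. P e \<longleftrightarrow> sat M (interleave e c) p"
    using assms unfolding defpred_def by blast
  \<comment> \<open>Coordinates are the even variables below 2 * n; all others, including the
    environment entries taken from \<open>d\<close>, become parameters placed from n on.\<close>
  let ?\<rho> = "\<lambda>i. if even i \<and> i div 2 < n then i div 2 else n + i"
  let ?c = "\<lambda>i. interleave d c (i - n)"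
  have "(\<lambda>i. if ?\<rho> i < n then xs ! ?\<rho> i else ?c (?\<rho> i)) =
      interleave (\<lambda>i. if i < n then xs ! i else d i) c" for xs :: "'a list"
    by (auto simp: interleave_def)
  then show ?thesis
    unfolding definable_def
    by (intro exI[of _ "ren ?\<rho> p"] exI[of _ ?c]) (simp add: sat_ren p)
qed

lemmas defpred_rules = defpred_const defpred_not defpred_conj defpred_disj defpred_imp defpred_iff
  defpred_ex defpred_all defpred_eq defpred_less defpred_le
  defterm_var defterm_const

lemma tame_singleton: "tame {x}"
  by (simp add: tame_def) (intro defpred_rules)

lemma tame_compl: "tame A \<Longrightarrow> tame (- A)"
  by (simp add: tame_def defpred_not)

lemma tame_Int: "tame A \<Longrightarrow> tame B \<Longrightarrow> tame (A \<inter> B)"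
  by (simp add: tame_def defpred_conj)

lemma tame_Un: "tame A \<Longrightarrow> tame B \<Longrightarrow> tame (A \<union> B)"
  by (simp add: tame_def defpred_disj)

lemma tame_Diff: "tame A \<Longrightarrow> tame B \<Longrightarrow> tame (A - B)"
  using tame_Int[OF _ tame_compl] by (simp add: Diff_eq)

lemma tame_empty: "tame {}"
  by (simp add: tame_def defpred_const)

lemma tame_finite: "finite A \<Longrightarrow> tame A"
proof (induction A rule: finite_induct)
  case (insert x A)
  then show ?case using tame_Un[OF tame_singleton, of A x] by simp
qed (rule tame_empty)

lemma tame_ioo: "tame {a<..<b}"
  by (simp add: tame_def) (intro defpred_rules)

lemma tame_iff_definable: "tame A \<longleftrightarrow> definable M 1 ((\<lambda>t. [t]) ` A)"
proof
  assume "tame A"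
  from definable_of_defpred[OF this[unfolded tame_def], of 1 "\<lambda>_. undefined"]
  show "definable M 1 ((\<lambda>t. [t]) ` A)"
    by (rule back_subst[where P = "definable M 1"]) (auto simp: length_Suc_conv image_iff)
next
  assume "definable M 1 ((\<lambda>t. [t]) ` A)"
  from defpred_definable[OF this, of "\<lambda>e. [e 0]"] show "tame A"
    using deftuple_Cons[OF defterm_var deftuple_Nil, of 0] by (auto simp: tame_def image_iff)
qed

end

section \<open>Germs of the line\<close>

text \<open>Over an o-minimal structure the definable one-types are the points, the two sides of every
  point, and the two ends of the line; \<open>ev g A\<close> says that \<open>A\<close> belongs to the type \<open>g\<close>.\<close>

datatype 'a germ = Pt 'a | Rgt 'a | Lft 'a | PosInf | NegInf

text \<open>For a bound s with \<open>side g s\<close> the set \<open>nbd g s\<close> is a basic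
  member of the germ. A one-sided germ needs s on the correct side of its base point, while at
  infinity every s is admissible.\<close>

primrec side :: "'a::linorder germ \<Rightarrow> 'a \<Rightarrow> bool" where
  "side (Pt x) s \<longleftrightarrow> True"
| "side (Rgt t) s \<longleftrightarrow> t < s"
| "side (Lft t) s \<longleftrightarrow> s < t"
| "side PosInf s \<longleftrightarrow> True"
| "side NegInf s \<longleftrightarrow> True"

primrec nbd :: "'a::linorder germ \<Rightarrow> 'a \<Rightarrow> 'a set" where
  "nbd (Pt x) s = {x}"
| "nbd (Rgt t) s = {t<..<s}"
| "nbd (Lft t) s = {s<..<t}"
| "nbd PosInf s = {s<..}"
| "nbd NegInf s = {..<s}"

definition ev :: "'a::linorder germ \<Rightarrow> 'a set \<Rightarrow> bool" where
  "ev g A \<longleftrightarrow> (\<exists>s. side g s \<and> nbd g s \<subseteq> A)"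

lemma side_ex: "\<exists>s. side (g :: 'a::unbounded_dense_linorder germ) s"
  by (cases g) (auto simp: gt_ex lt_ex)

lemma nbd_nonempty: "side (g :: 'a::unbounded_dense_linorder germ) s \<Longrightarrow> nbd g s \<noteq> {}"
  by (cases g) (auto simp: gt_ex lt_ex dense set_eq_iff)

lemma nbd_directed:
  assumes "side (g :: 'a::unbounded_dense_linorder germ) s" "side g t"
  obtains r where "side g r" "nbd g r \<subseteq> nbd g s \<inter> nbd g t"
proof (cases g)
  case (Rgt x)
  then show ?thesis using assms that[of "min s t"] by auto
next
  case (Lft x)
  then show ?thesis using assms that[of "max s t"] by auto
next
  case PosInf
  then show ?thesis using assms that[of "max s t"] by auto
next
  case NegInf
  then show ?thesis using assms that[of "min s t"] by auto
qed (use assms that in auto)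

lemma nbd_open:
  assumes "\<And>x. g \<noteq> Pt x" "q \<in> nbd (g :: 'a::unbounded_dense_linorder germ) s"
  shows "\<exists>l u. l < q \<and> q < u \<and> {l<..<u} \<subseteq> nbd g s"
proof (cases g)
  case (Rgt x)
  then show ?thesis using assms by auto
next
  case (Lft x)
  then show ?thesis using assms by auto
next
  case PosInf
  obtain u where "q < u" using gt_ex by blast
  with PosInf assms show ?thesis by (intro exI[of _ s] exI[of _ u]) auto
next
  case NegInf
  obtain l where "l < q" using lt_ex by blast
  with NegInf assms show ?thesis by (intro exI[of _ l] exI[of _ s]) auto
qed (use assms in blast)

lemma ev_mono: "ev g A \<Longrightarrow> A \<subseteq> B \<Longrightarrow> ev g B"
  unfolding ev_def by blast

lemma ev_nbd: "side g s \<Longrightarrow> ev g (nbd g s)"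
  unfolding ev_def by blast

lemma ev_Pt [simp]: "ev (Pt x) A \<longleftrightarrow> x \<in> A"
  by (simp add: ev_def)

lemma ev_UNIV: "ev (g :: 'a::unbounded_dense_linorder germ) UNIV"
  unfolding ev_def using side_ex by blast

lemma ev_Int_iff: "ev (g :: 'a::unbounded_dense_linorder germ) (A \<inter> B) \<longleftrightarrow> ev g A \<and> ev g B"
proof
  assume "ev g A \<and> ev g B"
  then obtain s t where st: "side g s" "nbd g s \<subseteq> A" "side g t" "nbd g t \<subseteq> B"
    unfolding ev_def by blast
  from nbd_directed[OF st(1,3)] st show "ev g (A \<inter> B)" unfolding ev_def
    by (metis Int_mono order_trans)
qed (auto intro: ev_mono)

lemma ev_meets: "ev (g :: 'a::unbounded_dense_linorder germ) A \<Longrightarrow> ev g B \<Longrightarrow> A \<inter> B \<noteq> {}"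
proof -
  assume "ev g A" "ev g B"
  then have "ev g (A \<inter> B)" by (simp add: ev_Int_iff)
  then obtain s where "side g s" "nbd g s \<subseteq> A \<inter> B" unfolding ev_def by blast
  with nbd_nonempty[of g s] show ?thesis by blast
qed

lemma ev_ex: "ev (g :: 'a::unbounded_dense_linorder germ) A \<Longrightarrow> \<exists>x. x \<in> A"
  using ev_meets by blast

lemma ev_near:
  assumes "l < q" "q < u" "{l<..<u} \<subseteq> A"
  shows "ev (Rgt q) A" "ev (Lft q) A"
proof -
  show "ev (Rgt q) A" unfolding ev_def using assms by (intro exI[of _ u]) (auto simp: subset_iff)
  show "ev (Lft q) A" unfolding ev_def using assms by (intro exI[of _ l]) (auto simp: subset_iff)
qed

text \<open>Near an end the basic sets are open intervals, so each of their points carries both of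
  its sides along. This lets information pass between a germ and the sides of the points close to
  it.\<close>

lemma ev_nbd_sides:
  assumes "\<And>x. g \<noteq> Pt x" "q \<in> nbd (g :: 'a::unbounded_dense_linorder germ) s"
  shows "ev (Rgt q) (nbd g s)" "ev (Lft q) (nbd g s)"
  using nbd_open[OF assms] ev_near by metis+

lemma ev_infinite:
  assumes "ev (g :: 'a::unbounded_dense_linorder germ) A" "\<And>x. g \<noteq> Pt x"
  shows "\<exists>l u. l < u \<and> {l<..<u} \<subseteq> A"
proof -
  obtain s where s: "side g s" "nbd g s \<subseteq> A" using assms unfolding ev_def by blast
  then obtain q where "q \<in> nbd g s" using nbd_nonempty by blast
  then show ?thesis using nbd_open[of g q s] assms(2) s by fastforce
qed

section \<open>Definability of conditions on germs\<close>

context expansion_line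
begin

text \<open>In such a family of germs the constructor is constant and only the base point varies;
  quantification over all germs is then split into the five constructors.\<close>

definition defgerm :: "((nat \<Rightarrow> 'a) \<Rightarrow> 'a germ) \<Rightarrow> bool" where
  "defgerm K \<longleftrightarrow> (\<exists>f. defterm f \<and> (K = (\<lambda>e. Pt (f e)) \<or> K = (\<lambda>e. Rgt (f e)) \<or> K = (\<lambda>e. Lft (f e))))
     \<or> K = (\<lambda>e. PosInf) \<or> K = (\<lambda>e. NegInf)"

lemma defgerm_intros:
  "defterm f \<Longrightarrow> defgerm (\<lambda>e. Pt (f e))" "defterm f \<Longrightarrow> defgerm (\<lambda>e. Rgt (f e))"
    "defterm f \<Longrightarrow> defgerm (\<lambda>e. Lft (f e))"
  "defgerm (\<lambda>e. PosInf)" "defgerm (\<lambda>e. NegInf)"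
  unfolding defgerm_def by blast+

lemma defgerm_const: "defgerm (\<lambda>e. g)"
  by (cases g) (auto intro: defgerm_intros defterm_const)

lemma defgerm_cases:
  assumes "defgerm K"
  obtains f where "defterm f" "K = (\<lambda>e. Pt (f e))" | f where "defterm f" "K = (\<lambda>e. Rgt (f e))"
    | f where "defterm f" "K = (\<lambda>e. Lft (f e))" | "K = (\<lambda>e. PosInf)" | "K = (\<lambda>e. NegInf)"
  using assms unfolding defgerm_def by blast

lemma defgerm_ren: "defgerm K \<Longrightarrow> defgerm (\<lambda>e. K (\<lambda>i. e (\<rho> i)))"
  by (erule defgerm_cases) (auto intro!: defgerm_intros intro: defterm_ren)

lemma defpred_side: "defgerm K \<Longrightarrow> defterm f \<Longrightarrow> defpred (\<lambda>e. side (K e) (f e))"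
  by (erule defgerm_cases) (auto intro: defpred_const defpred_less)

lemma defpred_nbd: "defgerm K \<Longrightarrow> defterm f \<Longrightarrow> defterm h \<Longrightarrow> defpred (\<lambda>e. h e \<in> nbd (K e) (f e))"
  by (erule defgerm_cases) (auto intro!: defpred_conj defpred_eq defpred_less)

lemma defpred_ev:
  assumes "defgerm K" "defpred (\<lambda>e. P (e 0) (\<lambda>i. e (Suc i)))"
  shows "defpred (\<lambda>e. ev (K e) {r. P r e})"
proof -
  have "defpred (\<lambda>e. P (e 0) (\<lambda>i. e (Suc (Suc i))))"
    using defpred_ren[OF assms(2), of "case_nat 0 (\<lambda>i. Suc (Suc i))"] by simp
  then have "defpred (\<lambda>e. \<exists>s. side (K e) s \<and> (\<forall>r. r \<in> nbd (K e) s \<longrightarrow> P r e))"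
    by (intro defpred_ex defpred_conj defpred_all defpred_imp defpred_nbd defpred_side defterm_var
      defgerm_ren[OF defgerm_ren[OF assms(1)]]
        defgerm_ren[OF assms(1)])
  then show ?thesis unfolding ev_def subset_iff by simp
qed

lemma defpred_ev_tame: "defgerm K \<Longrightarrow> tame A \<Longrightarrow> defpred (\<lambda>e. ev (K e) A)"
  using defpred_ev[of K "\<lambda>r e. r \<in> A"] by (simp add: tame_def)

lemma defpred_all_germ:
  assumes "defpred (\<lambda>e. P (Pt (e 0)) (\<lambda>i. e (Suc i)))" "defpred (\<lambda>e. P (Rgt (e 0)) (\<lambda>i. e (Suc i)))"
    "defpred (\<lambda>e. P (Lft (e 0)) (\<lambda>i. e (Suc i)))" "defpred (\<lambda>e. P PosInf e)"
      "defpred (\<lambda>e. P NegInf e)"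
  shows "defpred (\<lambda>e. \<forall>g. P g e)"
proof -
  have "(\<forall>g. P g e) \<longleftrightarrow> (\<forall>t. P (Pt t) e) \<and> (\<forall>t. P (Rgt t) e) \<and> (\<forall>t. P (Lft t) e) \<and> P PosInf e \<and>
      P NegInf e" for e
    by (metis germ.exhaust)
  moreover have "defpred (\<lambda>e. (\<forall>t. P (Pt t) e) \<and> (\<forall>t. P (Rgt t) e) \<and> (\<forall>t. P (Lft t) e) \<and>
      P PosInf e \<and> P NegInf e)"
    by (intro defpred_conj defpred_all assms)
  ultimately show ?thesis by simp
qed

end

section \<open>Germs as complete types\<close>

locale omin_line = expansion_line M for M :: "('f, 'r, 'a::unbounded_dense_linorder) expansion" +
  assumes omin: "o_minimal M"
begin

lemma tame_decomp:
  assumes "tame A"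
  shows "\<exists>\<I>. finite \<I> \<and> A = \<Union>\<I> \<and> (\<forall>I\<in>\<I>. (\<exists>t. I = {t}) \<or> (\<exists>a b. I = ointerval a b))"
proof -
  have "{t. [t] \<in> (\<lambda>t. [t]) ` A} = A" by auto
  then show ?thesis
    using omin assms unfolding o_minimal_def tame_iff_definable by metis
qed

lemma ev_Un: "ev g A \<Longrightarrow> ev g (A \<union> B)" "ev g B \<Longrightarrow> ev g (A \<union> B)"
  by (auto intro: ev_mono)

lemma decided_Pt: "ev g {x} \<or> ev (g :: 'a germ) (- {x})"
proof (cases g)
  case (Rgt t)
  show ?thesis
  proof (cases "x \<le> t")
    case True
    then show ?thesis using Rgt gt_ex[of t] by (auto simp: ev_def)
  next
    case False
    then show ?thesis using Rgt by (auto simp: ev_def intro!: exI[of _ x])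
  qed
next
  case (Lft t)
  show ?thesis
  proof (cases "t \<le> x")
    case True
    then show ?thesis using Lft lt_ex[of t] by (auto simp: ev_def)
  next
    case False
    then show ?thesis using Lft by (auto simp: ev_def intro!: exI[of _ x])
  qed
next
  case PosInf
  then show ?thesis by (auto simp: ev_def intro!: exI[of _ x])
next
  case NegInf
  then show ?thesis by (auto simp: ev_def intro!: exI[of _ x])
qed auto

lemma decided_lower: "ev g {t. a < Fin t} \<or> ev (g :: 'a germ) (- {t. a < Fin t})"
proof (cases a)
  case (Fin x)
  have sets: "{t. a < Fin t} = {x<..}" "- {t. a < Fin t} = {..x}" using Fin by auto
  show ?thesis
  proof (cases g)
    case (Rgt t)
    show ?thesis
    proof (cases "x \<le> t")
      case True
      obtain u where "t < u" using gt_ex by blast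
      with True have "ev g {x<..}" unfolding Rgt ev_def by (intro exI[of _ u]) auto
      then show ?thesis by (simp add: sets)
    next
      case False
      then have "ev g {..x}" unfolding Rgt ev_def by (intro exI[of _ x]) auto
      then show ?thesis by (simp add: sets)
    qed
  next
    case (Lft t)
    show ?thesis
    proof (cases "t \<le> x")
      case True
      obtain u where "u < t" using lt_ex by blast
      with True have "ev g {..x}" unfolding Lft ev_def by (intro exI[of _ u]) auto
      then show ?thesis by (simp add: sets)
    next
      case False
      then have "ev g {x<..}" unfolding Lft ev_def by (intro exI[of _ x]) auto
      then show ?thesis by (simp add: sets)
    qed
  next
    case PosInf
    then have "ev g {x<..}" unfolding ev_def by (intro exI[of _ x]) auto
    then show ?thesis by (simp add: sets)
  next
    case NegInf
    then have "ev g {..x}" unfolding ev_def by (intro exI[of _ x]) auto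
    then show ?thesis by (simp add: sets)
  qed (auto simp: sets)
qed (use ev_UNIV[of g] in auto)

lemma decided_upper: "ev g {t. Fin t < b} \<or> ev (g :: 'a germ) (- {t. Fin t < b})"
proof (cases b)
  case (Fin x)
  have "- {t. Fin t < b} = {x} \<union> {t. b < Fin t}" "{t. Fin t < b} = - {x} \<inter> - {t. b < Fin t}"
    using Fin by auto
  then show ?thesis
    using decided_Pt[of g x] decided_lower[of g b] by (metis ev_Int_iff ev_Un)
qed (use ev_UNIV[of g] in auto)

lemma decided_ointerval: "ev g (ointerval a b) \<or> ev (g :: 'a germ) (- ointerval a b)"
proof -
  have "ointerval a b = {t. a < Fin t} \<inter> {t. Fin t < b}"
    by (auto simp: ointerval_def)
  then show ?thesis
    using decided_lower[of g a] decided_upper[of g b]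
    by (metis Compl_Int ev_Int_iff ev_Un)
qed

lemma decided_ointerval_or_Pt:
  "(\<exists>t. I = {t}) \<or> (\<exists>a b. I = ointerval a b) \<Longrightarrow> ev g I \<or> ev (g :: 'a germ) (- I)"
  using decided_Pt decided_ointerval by blast

text \<open>Points and intervals are decided by every germ, and decidedness passes to finite unions.
  So on the definable sets each germ is an ultrafilter.\<close>

lemma tame_decided:
  assumes "tame A"
  shows "ev g A \<or> ev (g :: 'a germ) (- A)"
proof -
  obtain \<I> where "finite \<I>" and A: "A = \<Union>\<I>"
    and I: "\<forall>I\<in>\<I>. (\<exists>t. I = {t}) \<or> (\<exists>a b. I = ointerval a b)"
    using tame_decomp[OF assms] by blast
  from \<open>finite \<I>\<close> I have "ev g (\<Union>\<I>) \<or> ev g (- \<Union>\<I>)"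
  proof (induction \<I> rule: finite_induct)
    case empty
    then show ?case by (simp add: ev_UNIV)
  next
    case (insert I \<I>)
    from insert.prems have "ev g I \<or> ev g (- I)" by (intro decided_ointerval_or_Pt) simp
    moreover have "ev g (\<Union>\<I>) \<or> ev g (- \<Union>\<I>)" using insert by blast
    ultimately show ?case by (auto simp: ev_Int_iff intro: ev_Un)
  qed
  with A show ?thesis by simp
qed

lemma not_ev: "tame A \<Longrightarrow> \<not> ev g A \<longleftrightarrow> ev (g :: 'a germ) (- A)"
  using tame_decided[of A g] ev_meets[of g A "- A"] by blast

lemma tame_infinite:
  assumes "tame A" "infinite A"
  obtains l u where "l < u" "{l<..<u} \<subseteq> A"
proof -
  obtain \<I> where "finite \<I>" and A: "A = \<Union>\<I>"
    and I: "\<forall>I\<in>\<I>. (\<exists>t. I = {t}) \<or> (\<exists>a b. I = ointerval a b)"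
    using tame_decomp[OF assms(1)] by blast
  then obtain I where "I \<in> \<I>" "infinite I" using assms(2) by blast
  with I obtain a b where ab: "I = ointerval a b" by fastforce
  obtain l u where lu: "l \<in> I" "u \<in> I" "l < u"
  proof -
    obtain l where "l \<in> I" using \<open>infinite I\<close> infinite_imp_nonempty by blast
    moreover obtain u where "u \<in> I - {l}" using \<open>infinite I\<close>
      by (metis infinite_imp_nonempty infinite_remove ex_in_conv)
    ultimately show ?thesis using that[of l u] that[of u l] by fastforce
  qed
  have "{l<..<u} \<subseteq> I"
  proof
    fix t assume "t \<in> {l<..<u}"
    then have "Fin l < Fin t" "Fin t < Fin u" by auto
    then show "t \<in> I"
      using lu ab less_trans[of a "Fin l" "Fin t"] less_trans[of "Fin t" "Fin u" b]
      by (simp add: ointerval_def)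
  qed
  with \<open>I \<in> \<I>\<close> A lu(3) that show ?thesis by blast
qed

lemma infinite_tame_iff: "tame A \<Longrightarrow> infinite A \<longleftrightarrow> (\<exists>l u. l < u \<and> {l<..<u} \<subseteq> A)"
  using tame_infinite infinite_Ioo finite_subset by metis

lemma ointerval_sup:
  assumes "(\<exists>t. I = {t}) \<or> (\<exists>a b. I = ointerval a b)" "I \<noteq> {}" "\<forall>x\<in>I. x \<le> c"
  shows "\<exists>m. (\<forall>x\<in>I. x \<le> m) \<and> (\<forall>m'<m. \<exists>x\<in>I. m' < (x :: 'a))"
  using assms(1)
proof
  assume "\<exists>t. I = {t}"
  then show ?thesis by auto
next
  assume "\<exists>a b. I = ointerval a b"
  then obtain a b where ab: "I = ointerval a b" by blast
  then obtain x where x: "a < Fin x" "Fin x < b" using assms(2) by (auto simp: ointerval_def)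
  show ?thesis
  proof (cases b)
    case (Fin m)
    have "\<exists>x\<in>I. m' < x" if m': "m' < m" for m'
    proof -
      obtain y where "max m' x < y" "y < m" using dense[of "max m' x" m] m' x Fin by auto
      with x Fin ab show ?thesis
        by (intro bexI[of _ y]) (auto simp: ointerval_def intro: less_trans[of _ "Fin x"])
    qed
    with Fin ab show ?thesis by (intro exI[of _ m]) (auto simp: ointerval_def)
  next
    case Pinf
    obtain y where "max c x < y" using gt_ex by blast
    with x Pinf ab have "y \<in> I" by (auto simp: ointerval_def intro: less_trans[of _ "Fin x"])
    with \<open>max c x < y\<close> assms(3) show ?thesis by auto
  qed (use x in auto)
qed

text \<open>The line need not be Dedekind complete: the supremum is the largest one among the
  suprema of the finitely many pieces of S, which are points or endpoints of intervals.\<close>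

lemma tame_sup:
  assumes "tame S" "S \<noteq> {}" "\<forall>x\<in>S. x \<le> c"
  obtains m where "\<forall>x\<in>S. x \<le> m" "\<forall>m'<m. \<exists>x\<in>S. m' < x"
proof -
  obtain \<I> where fin: "finite \<I>" and S: "S = \<Union>\<I>"
    and I: "\<forall>I\<in>\<I>. (\<exists>t. I = {t}) \<or> (\<exists>a b. I = ointerval a b)"
    using tame_decomp[OF assms(1)] by blast
  let ?J = "\<I> - {{}}"
  have "\<forall>I\<in>?J. \<exists>m. (\<forall>x\<in>I. x \<le> m) \<and> (\<forall>m'<m. \<exists>x\<in>I. m' < x)"
  proof
    fix I assume J: "I \<in> ?J"
    show "\<exists>m. (\<forall>x\<in>I. x \<le> m) \<and> (\<forall>m'<m. \<exists>x\<in>I. m' < x)"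
      by (rule ointerval_sup[of _ c]) (use J I assms(3) S in auto)
  qed
  then obtain m where m: "\<forall>I\<in>?J. (\<forall>x\<in>I. x \<le> m I) \<and> (\<forall>m'<m I. \<exists>x\<in>I. m' < x)" by metis
  have ne: "m ` ?J \<noteq> {}" "finite (m ` ?J)" using assms(2) S fin by auto
  show ?thesis
  proof (rule that[of "Max (m ` ?J)"])
    show "\<forall>x\<in>S. x \<le> Max (m ` ?J)"
    proof
      fix x assume "x \<in> S"
      then obtain I where "I \<in> ?J" "x \<in> I" using S by blast
      with m have "x \<le> m I" by blast
      with \<open>I \<in> ?J\<close> ne(2) show "x \<le> Max (m ` ?J)" by (meson Max_ge image_eqI order_trans)
    qed
    obtain I where "I \<in> ?J" "m I = Max (m ` ?J)" using Max_in[OF ne(2,1)] by fastforce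
    then show "\<forall>m'<Max (m ` ?J). \<exists>x\<in>S. m' < x" using m S by (metis (no_types) DiffD1 UnionI)
  qed
qed

text \<open>The infimum is the supremum of the definable set of lower bounds.\<close>

lemma tame_inf:
  assumes S: "tame S" "S \<noteq> {}" "\<forall>x\<in>S. c \<le> x"
  obtains m where "\<forall>x\<in>S. m \<le> x" "\<forall>m'>m. \<exists>x\<in>S. x < m'"
proof -
  let ?L = "{l. \<forall>x. x \<in> S \<longrightarrow> l \<le> x}"
  have "tame ?L" unfolding tame_def mem_Collect_eq by (intro defpred_rules defpred_tame[OF S(1)])
  moreover obtain x where x: "x \<in> S" using S(2) by blast
  moreover have "?L \<noteq> {}" "\<forall>l\<in>?L. l \<le> x" using S(3) x by auto
  ultimately obtain m where m: "\<forall>l\<in>?L. l \<le> m" "\<forall>m'<m. \<exists>l\<in>?L. m' < l"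
    using tame_sup[of ?L x] by blast
  have "\<forall>x\<in>S. m \<le> x"
  proof (intro ballI leI notI)
    fix x assume "x \<in> S" "x < m"
    then obtain l where "l \<in> ?L" "x < l" using m(2) by blast
    then show False using \<open>x \<in> S\<close> leD by blast
  qed
  moreover have "\<exists>x\<in>S. x < m'" if m': "m < m'" for m'
  proof (rule ccontr)
    assume "\<not> ?thesis"
    then have "m' \<in> ?L" by (simp add: not_less Ball_def)
    then have "m' \<le> m" using m(1) by blast
    then show False using m' leD by blast
  qed
  ultimately show ?thesis by (intro that) blast+
qed

text \<open>The elements lying below a whole member of the family form an initial segment of the
  line. If it is empty or everything, the germ is an end of the line; otherwise its supremum
  \<open>s0\<close> locates the germ at or beside \<open>s0\<close>. Definability of the family as a
  whole enters through \<open>L\<close>, which makes the supremum exist. In this statement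
  \<open>generic\<close> is just a bound variable.\<close>

lemma directed_germ:
  fixes \<F> :: "'a set set"
  assumes defterm: "\<And>F. F \<in> \<F> \<Longrightarrow> tame F" and ne: "\<And>F. F \<in> \<F> \<Longrightarrow> F \<noteq> {}"
    and dir: "\<And>F generic. F \<in> \<F> \<Longrightarrow> generic \<in> \<F> \<Longrightarrow> \<exists>H\<in>\<F>. H \<subseteq> F \<inter> generic"
    and L: "tame {s. \<exists>F\<in>\<F>. F \<subseteq> {s..}}"
  shows "\<exists>g. \<forall>F\<in>\<F>. ev g F"
proof -
  let ?L = "{s. \<exists>F\<in>\<F>. F \<subseteq> {s..}}"
  have down: "s \<in> ?L" if s': "s' \<in> ?L" "s \<le> s'" for s s'
  proof -
    obtain F where F: "F \<in> \<F>" "F \<subseteq> {s'..}" using s'(1) by blast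
    have "{s'..} \<subseteq> {s..}" using s'(2) by auto
    with F(2) have "F \<subseteq> {s..}" by (rule order_trans)
    with F(1) show ?thesis by (intro CollectI bexI)
  qed
  consider "?L = {}" | "?L = UNIV" | b where "?L \<noteq> {}" "b \<notin> ?L" by blast
  then show ?thesis
  proof cases
    case 1
    have "ev NegInf F" if F: "F \<in> \<F>" for F
    proof (rule ccontr)
      assume "\<not> ev NegInf F"
      then obtain s where "{..<s} \<subseteq> - F" using not_ev[OF defterm[OF F], of NegInf] unfolding ev_def
        by auto
      then have "F \<subseteq> {s..}" by (auto simp: subset_iff not_less[symmetric])
      then have "s \<in> ?L" using F by blast
      with 1 show False by simp
    qed
    then show ?thesis by blast
  next
    case 2
    have "ev PosInf F" if F: "F \<in> \<F>" for F
    proof (rule ccontr)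
      assume "\<not> ev PosInf F"
      then obtain s where s: "{s<..} \<subseteq> - F" using not_ev[OF defterm[OF F], of PosInf]
        unfolding ev_def by auto
      obtain s' where s': "s < s'" using gt_ex by blast
      from 2 obtain generic where "generic \<in> \<F>" "generic \<subseteq> {s'..}" by blast
      then obtain H where "H \<in> \<F>" "H \<subseteq> F \<inter> generic" using dir \<open>F \<in> \<F>\<close> by blast
      moreover have "F \<inter> generic = {}"
      proof -
        have "s < x" if "x \<in> generic" for x using \<open>generic \<subseteq> {s'..}\<close> s' less_le_trans[of s s' x]
          that by auto
        with s show ?thesis by auto
      qed
      ultimately show False using ne by blast
    qed
    then show ?thesis by blast
  next
    case 3
    have "\<forall>x\<in>?L. x \<le> b"
    proof
      fix x assume "x \<in> ?L"
      then show "x \<le> b" using down[of x b] 3(2) linear[of x b] by blast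
    qed
    then obtain s0 where ub: "\<forall>x\<in>?L. x \<le> s0" and lub: "\<forall>m'<s0. \<exists>x\<in>?L. m' < x"
      using tame_sup[OF L 3(1)] by blast
    \<comment> \<open>A member lying above a point just below \<open>s0\<close> pushes a common
      refinement to the right of \<open>s1\<close>, and no member lies entirely above
      \<open>s2\<close>.\<close>
    have meet: "\<exists>x\<in>F. s1 < x \<and> x < s2" if F: "F \<in> \<F>" and "s1 < s0" "s0 < s2" for F s1 s2
    proof -
      obtain s' where "s' \<in> ?L" "s1 < s'" using lub \<open>s1 < s0\<close> by blast
      then obtain generic where "generic \<in> \<F>" "generic \<subseteq> {s'..}" by blast
      then obtain H where H: "H \<in> \<F>" "H \<subseteq> F \<inter> generic" using dir F by blast
      have "s2 \<notin> ?L" using ub \<open>s0 < s2\<close> not_less by blast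
      then have "\<not> H \<subseteq> {s2..}" using H(1) by blast
      then obtain x where "x \<in> H" "x < s2" by (auto simp: subset_iff not_le)
      with H \<open>generic \<subseteq> {s'..}\<close> \<open>s1 < s'\<close> show ?thesis by (intro bexI[of _ x]) auto
    qed
    show ?thesis
    proof (rule ccontr)
      assume neg: "\<not> ?thesis"
      \<comment> \<open>Only three germs are possible at \<open>s0\<close>. If each fails for some
        member, a common refinement of the three members has no points near \<open>s0\<close>,
        against \<open>meet\<close>.\<close>
      then obtain F1 F2 F3 where F: "F1 \<in> \<F>" "\<not> ev (Pt s0) F1" "F2 \<in> \<F>" "\<not> ev (Lft s0) F2"
        "F3 \<in> \<F>" "\<not> ev (Rgt s0) F3" by blast
      obtain H where H: "H \<in> \<F>" "H \<subseteq> F1 \<inter> F2 \<inter> F3"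
        using dir[OF F(1,3)] dir[OF _ F(5)] by blast
      obtain s1 s2 where s: "s1 < s0" "s0 < s2" "{s1<..<s0} \<subseteq> - F2" "{s0<..<s2} \<subseteq> - F3"
        using F(4,6) not_ev[OF defterm[OF F(3)], of "Lft s0"] not_ev[OF defterm[OF F(5)], of
          "Rgt s0"]
        unfolding ev_def by auto
      obtain x where "x \<in> H" "s1 < x" "x < s2" using meet[OF H(1) s(1,2)] by blast
      with H(2) s F(2) show False by (cases x s0 rule: linorder_cases) auto
    qed
  qed
qed

text \<open>The images of the basic sets of g form a directed definable family and so lie in a germ
  h. Applying the resulting implication to the complement of U as well turns it into an
  equivalence.\<close>

lemma push_germ:
  assumes f: "deffun f"
  shows "\<exists>h. \<forall>U. tame U \<longrightarrow> (ev h U \<longleftrightarrow> ev g {x. f x \<in> U})"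
proof -
  define \<F> where "\<F> = (\<lambda>s. f ` nbd g s) ` {s. side g s}"
  have "\<exists>h. \<forall>F\<in>\<F>. ev h F"
  proof (rule directed_germ)
    fix F generic assume "F \<in> \<F>" "generic \<in> \<F>"
    then obtain s t where st: "side g s" "F = f ` nbd g s" "side g t" "generic = f ` nbd g t"
      unfolding \<F>_def by blast
    obtain r where "side g r" "nbd g r \<subseteq> nbd g s \<inter> nbd g t" by (rule nbd_directed[OF st(1,3)])
    with st show "\<exists>H\<in>\<F>. H \<subseteq> F \<inter> generic" unfolding \<F>_def by blast
  next
    have "defpred (\<lambda>e. \<exists>s. side g s \<and> (\<forall>x. x \<in> nbd g s \<longrightarrow> e 0 \<le> f x))"
      by (intro defpred_rules defpred_side defpred_nbd defgerm_const defterm_app[OF f])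
    moreover have "s \<in> {s. \<exists>F\<in>\<F>. F \<subseteq> {s..}} \<longleftrightarrow> (\<exists>t. side g t \<and> (\<forall>x. x \<in> nbd g t \<longrightarrow> s \<le> f x))" for s
      unfolding \<F>_def by auto
    ultimately show "tame {s. \<exists>F\<in>\<F>. F \<subseteq> {s..}}" unfolding tame_def by simp
  next
    fix F assume "F \<in> \<F>"
    then obtain s where s: "side g s" "F = f ` nbd g s" unfolding \<F>_def by blast
    then show "F \<noteq> {}" using nbd_nonempty by blast
    have "defpred (\<lambda>e. \<exists>x. x \<in> nbd g s \<and> e 0 = f x)"
      by (intro defpred_rules defpred_nbd defgerm_const defterm_app[OF f])
    then show "tame F" using s by (simp add: tame_def image_iff Bex_def)
  qed
  then obtain h where h: "\<And>s. side g s \<Longrightarrow> ev h (f ` nbd g s)" unfolding \<F>_def by blast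
  have *: "ev h U" if "ev g {x. f x \<in> U}" for U
  proof -
    obtain s where "side g s" "nbd g s \<subseteq> {x. f x \<in> U}" using \<open>ev g _\<close> unfolding ev_def by blast
    then show ?thesis using h[of s] by (auto intro: ev_mono)
  qed
  have "ev g {x. f x \<in> U}" if "tame U" "ev h U" for U
  proof (rule ccontr)
    assume "\<not> ?thesis"
    moreover have "tame {x. f x \<in> U}"
      unfolding tame_def using defpred_tame[OF \<open>tame U\<close> defterm_app[OF f defterm_var]] by simp
    ultimately have "ev g (- {x. f x \<in> U})" by (simp add: not_ev)
    then have "ev g {x. f x \<in> - U}" by (simp add: Collect_neg_eq)
    then have "ev h (- U)" by (rule *)
    from ev_meets[OF this \<open>ev h U\<close>] show False by blast
  qed
  with * show ?thesis by blast
qed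

end

section \<open>Monotonicity\<close>

text \<open>The order is a parameter so that van den Dries' argument on local minima below also applies
  to the reversed line.\<close>

locale tame_order =
  fixes lt :: "'a \<Rightarrow> 'a \<Rightarrow> bool" and T :: "'a set \<Rightarrow> bool"
  assumes irrefl: "\<not> lt x x"
    and trans: "lt x y \<Longrightarrow> lt y z \<Longrightarrow> lt x z"
    and total: "x \<noteq> y \<Longrightarrow> lt x y \<or> lt y x"
    and dense: "lt x y \<Longrightarrow> \<exists>z. lt x z \<and> lt z y"
    and inf: "T S \<Longrightarrow> x \<in> S \<Longrightarrow> \<forall>x\<in>S. \<not> lt x c \<Longrightarrow>
      \<exists>m. (\<forall>x\<in>S. \<not> lt x m) \<and> (\<forall>m'. lt m m' \<longrightarrow> (\<exists>x\<in>S. lt x m'))"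
    and left: "T S \<Longrightarrow> lt l z \<Longrightarrow> \<exists>s. lt s z \<and> \<not> lt s l \<and>
      ((\<forall>y. lt s y \<and> lt y z \<longrightarrow> y \<in> S) \<or> (\<forall>y. lt s y \<and> lt y z \<longrightarrow> y \<notin> S))"
begin

lemma trans': "lt x y \<Longrightarrow> \<not> lt z y \<Longrightarrow> lt x z" "\<not> lt y x \<Longrightarrow> lt y z \<Longrightarrow> lt x z"
  using total trans by metis+

text \<open>Read \<open>r x y\<close> as f x < f y, where every point of the interval is a strict
  local minimum. From some \<open>a'\<close> on, every point has a later point with a smaller value.
  Fix c beyond \<open>a'\<close>: near b the values are below f c, and the point where f falls below
  f c for good is the drop sought.\<close>

lemma local_min_drop:
  assumes ab: "lt a b"
    and r: "\<And>x y z. r x y \<Longrightarrow> r y z \<Longrightarrow> r x z" "\<And>x. \<not> r x x"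
    and rtot: "\<And>x y. lt a x \<Longrightarrow> lt x b \<Longrightarrow> lt a y \<Longrightarrow> lt y b \<Longrightarrow> x \<noteq> y \<Longrightarrow> r x y \<or> r y x"
    and minR: "\<And>x. lt a x \<Longrightarrow> lt x b \<Longrightarrow> \<exists>s. lt x s \<and> (\<forall>y. lt x y \<and> lt y s \<longrightarrow> r x y)"
    and minL: "\<And>x. lt a x \<Longrightarrow> lt x b \<Longrightarrow> \<exists>s. lt s x \<and> (\<forall>y. lt s y \<and> lt y x \<longrightarrow> r x y)"
    and TB: "T {x. lt a x \<and> lt x b \<and> (\<forall>y. lt x y \<and> lt y b \<longrightarrow> r x y)}"
    and TD: "\<And>c. T {d. \<not> lt d c \<and> lt d b \<and> (\<forall>y. lt d y \<and> lt y b \<longrightarrow> r c y)}"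
    and TE: "\<And>c. T {d. \<not> lt d c \<and> lt d b \<and> (\<forall>y. lt d y \<and> lt y b \<longrightarrow> r y c)}"
    and TS: "\<And>c. T {y. r c y}"
  shows "\<exists>z l u. lt a z \<and> lt z b \<and> lt l z \<and> lt z u \<and>
    (\<forall>x y. lt l x \<and> lt x z \<and> lt z y \<and> lt y u \<longrightarrow> r y x)"
proof -
  \<comment> \<open>\<open>?B\<close> collects the points whose value is smaller than all later
    ones. If it filled a left neighbourhood of b, f would increase there, which no local minimum
    allows.\<close>
  let ?B = "{x. lt a x \<and> lt x b \<and> (\<forall>y. lt x y \<and> lt y b \<longrightarrow> r x y)}"
  obtain a' where a': "lt a' b" "\<not> lt a' a" and noB: "\<forall>y. lt a' y \<and> lt y b \<longrightarrow> y \<notin> ?B"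
  proof -
    obtain s where s: "lt s b" "\<not> lt s a"
      and "(\<forall>y. lt s y \<and> lt y b \<longrightarrow> y \<in> ?B) \<or> (\<forall>y. lt s y \<and> lt y b \<longrightarrow> y \<notin> ?B)"
      using left[OF TB ab] by blast
    moreover have False if all: "\<forall>y. lt s y \<and> lt y b \<longrightarrow> y \<in> ?B"
    proof -
      obtain y where y: "lt s y" "lt y b" using dense s(1) by blast
      have "lt a y" using trans'(2)[OF s(2) y(1)] .
      then obtain q where q: "lt q y" "\<forall>z. lt q z \<and> lt z y \<longrightarrow> r y z" using minL y by blast
      obtain x where x: "lt s x" "lt q x" "lt x y"
      proof (cases "lt s q")
        case True
        obtain x where "lt q x" "lt x y" using dense q(1) by blast
        then show ?thesis using that trans[OF True] by blast
      next
        case False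
        obtain x where "lt s x" "lt x y" using dense y(1) by blast
        then show ?thesis using that trans'(2)[OF False] by blast
      qed
      have "lt x b" using trans x y by blast
      with all x y have "r x y" by blast
      moreover have "r y x" using q x by blast
      ultimately show False using r by blast
    qed
    ultimately show ?thesis using that by blast
  qed
  obtain c where c: "lt a' c" "lt c b" using dense a' by blast
  have inJ: "lt a y" if "\<not> lt y c" for y
    using trans'(2)[OF a'(2)] trans'(1)[OF c(1) that] by blast
  have later: "\<exists>y. lt x y \<and> lt y b \<and> r y x" if x: "\<not> lt x c" "lt x b" for x
  proof -
    have "lt a x" "lt a' x" using inJ x trans'(1)[OF c(1) x(1)] by blast+
    then have "\<not> (\<forall>y. lt x y \<and> lt y b \<longrightarrow> r x y)" using noB x by blast
    then obtain y where y: "lt x y" "lt y b" "\<not> r x y" by blast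
    moreover have "x \<noteq> y" using y irrefl by blast
    moreover have "lt a y" using trans \<open>lt a x\<close> y by blast
    ultimately show ?thesis using rtot[of x y] \<open>lt a x\<close> x by blast
  qed
  have below: "\<exists>y. lt s y \<and> lt t y \<and> lt y z" if "lt s z" "lt t z" for s t z
  proof (cases "lt s t")
    case True
    then show ?thesis using dense[OF \<open>lt t z\<close>] trans by blast
  next
    case False
    then show ?thesis using dense[OF \<open>lt s z\<close>] trans'(2)[OF False] by blast
  qed
  \<comment> \<open>The values cannot stay above f c up to b. At the infimum d of the possible
    starting points, either f c < f d and the local minimum at d lets the start move further left,
    or \<open>later\<close> provides a value below f d and hence below f c.\<close>
  have noD: False if D: "\<not> lt d0 c" "lt d0 b" "\<forall>y. lt d0 y \<and> lt y b \<longrightarrow> r c y" for d0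
  proof -
    let ?D = "{d. \<not> lt d c \<and> lt d b \<and> (\<forall>y. lt d y \<and> lt y b \<longrightarrow> r c y)}"
    have d0: "d0 \<in> ?D" using D by blast
    obtain d where d: "\<forall>x\<in>?D. \<not> lt x d" "\<forall>m'. lt d m' \<longrightarrow> (\<exists>x\<in>?D. lt x m')"
      using inf[OF TD d0, of c] by auto
    have right: "r c y" if y: "lt d y" "lt y b" for y using d(2) y by blast
    have "\<not> lt d c"
    proof
      assume "lt d c"
      then obtain x where "x \<in> ?D" "lt x c" using d(2) by blast
      then show False by blast
    qed
    have "lt d b" using d(1) d0 D(2) trans'(2) by blast
    from \<open>\<not> lt d c\<close> have "lt a d" using inJ by blast
    consider "r c d" | "d = c \<or> r d c" using rtot[of c d] c \<open>lt a d\<close> \<open>lt d b\<close> inJ[OF irrefl]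
      by blast
    then show False
    proof cases
      case 1
      then have "c \<noteq> d" using r(2)[of c] by auto
      then have "lt c d" using \<open>\<not> lt d c\<close> total[of c d] by blast
      obtain s where s: "lt s d" "\<forall>y. lt s y \<and> lt y d \<longrightarrow> r d y" using minL \<open>lt a d\<close> \<open>lt d b\<close> by blast
      obtain x where x: "lt s x" "lt c x" "lt x d" using below[OF s(1) \<open>lt c d\<close>] by blast
      have "r c y" if y: "lt x y" "lt y b" for y
      proof -
        consider "lt y d" | "y = d" | "lt d y" using total by blast
        then show ?thesis
        proof cases
          case 1
          then have "r d y" using s(2) trans[OF x(1) y(1)] by blast
          then show ?thesis using \<open>r c d\<close> r(1) by blast
        qed (use \<open>r c d\<close> right y in auto)
      qed
      then have "x \<in> ?D" using x trans \<open>lt d b\<close> irrefl by blast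
      then show False using d(1) x(3) by blast
    next
      case 2
      obtain y where "lt d y" "lt y b" "r y d" using later \<open>\<not> lt d c\<close> \<open>lt d b\<close> by blast
      moreover from this have "r y c" using 2 r(1) by blast
      ultimately show False using right r by blast
    qed
  qed
  let ?E = "{d. \<not> lt d c \<and> lt d b \<and> (\<forall>y. lt d y \<and> lt y b \<longrightarrow> r y c)}"
  obtain e0 where e0: "e0 \<in> ?E"
  proof -
    obtain s where s: "lt s b" "\<not> lt s c"
      and "(\<forall>y. lt s y \<and> lt y b \<longrightarrow> y \<in> {y. r c y}) \<or> (\<forall>y. lt s y \<and> lt y b \<longrightarrow> y \<notin> {y. r c y})"
      using left[OF TS c(2)] by blast
    then have notr: "\<not> r c y" if y: "lt s y" "lt y b" for y using noD[of s] y by blast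
    have "r y c" if y: "lt s y" "lt y b" for y
    proof -
      have "lt c y" using trans'(2)[OF s(2) y(1)] .
      then show ?thesis using notr[OF y] rtot[of c y] c y inJ[OF irrefl] trans irrefl by blast
    qed
    then show ?thesis using that[of s] s by blast
  qed
  \<comment> \<open>From \<open>\<beta>\<close> on the values stay below f c. It differs from c
    because c is a local minimum, and just left of it f exceeds f c, since otherwise membership in
    \<open>?E\<close> would extend to the left.\<close>
  obtain \<beta> where \<beta>: "\<forall>x\<in>?E. \<not> lt x \<beta>" "\<forall>m'. lt \<beta> m' \<longrightarrow> (\<exists>x\<in>?E. lt x m')"
    using inf[OF TE e0, of c] by auto
  have right: "r y c" if y: "lt \<beta> y" "lt y b" for y using \<beta>(2) y by blast
  have "\<not> lt \<beta> c"
  proof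
    assume "lt \<beta> c"
    then obtain x where "x \<in> ?E" "lt x c" using \<beta>(2) by blast
    then show False by blast
  qed
  have "lt \<beta> b" using \<beta>(1) e0 trans'(2) by blast
  have "\<beta> \<noteq> c"
  proof
    assume eq: "\<beta> = c"
    obtain s where s: "lt c s" "\<forall>y. lt c y \<and> lt y s \<longrightarrow> r c y" using minR c inJ[OF irrefl] by blast
    have "\<exists>y. lt c y \<and> lt y b \<and> lt y s"
      using dense[OF s(1)] dense[OF c(2)] trans total by metis
    then show False using right s(2) r eq by blast
  qed
  with \<open>\<not> lt \<beta> c\<close> have "lt c \<beta>" using total by blast
  have "lt a \<beta>" using inJ \<open>\<not> lt \<beta> c\<close> by blast
  have \<beta>c: "r c \<beta> \<or> r \<beta> c"
    using rtot[of c \<beta>] \<open>\<beta> \<noteq> c\<close> c \<open>lt a \<beta>\<close> \<open>lt \<beta> b\<close> inJ[OF irrefl] by blast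
  obtain s where s: "lt s \<beta>" "\<not> lt s c"
    and dec: "(\<forall>y. lt s y \<and> lt y \<beta> \<longrightarrow> y \<in> {y. r c y}) \<or> (\<forall>y. lt s y \<and> lt y \<beta> \<longrightarrow> y \<notin> {y. r c y})"
    using left[OF TS \<open>lt c \<beta>\<close>] by blast
  have "\<forall>y. lt s y \<and> lt y \<beta> \<longrightarrow> r c y"
  proof (rule ccontr)
    assume "\<not> ?thesis"
    then have neg: "\<not> r c y" if "lt s y" "lt y \<beta>" for y using dec that by blast
    obtain q where q: "lt q \<beta>" "\<forall>y. lt q y \<and> lt y \<beta> \<longrightarrow> r \<beta> y" using minL \<open>lt a \<beta>\<close> \<open>lt \<beta> b\<close> by blast
    obtain x where x: "lt s x" "lt q x" "lt x \<beta>" using below[OF s(1) q(1)] by blast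
    have "\<not> r c \<beta>"
    proof
      assume "r c \<beta>"
      then have "r c x" using q(2) x r(1) by blast
      then show False using neg x by blast
    qed
    with \<beta>c have "r \<beta> c" by blast
    have "r y c" if y: "lt x y" "lt y b" for y
    proof -
      consider "lt y \<beta>" | "y = \<beta>" | "lt \<beta> y" using total by blast
      then show ?thesis
      proof cases
        case 1
        have "lt s y" using x y trans by blast
        then have "\<not> r c y" "lt c y" using neg 1 trans'(2)[OF s(2)] by blast+
        then show ?thesis using rtot[of c y] c y inJ[OF irrefl] trans irrefl by blast
      qed (use \<open>r \<beta> c\<close> right y in auto)
    qed
    moreover have "lt x b" using x \<open>lt \<beta> b\<close> trans by blast
    moreover have "\<not> lt x c" using trans'(2)[OF s(2) x(1)] trans irrefl by blast
    ultimately have "x \<in> ?E" by blast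
    then show False using \<beta>(1) x(3) by blast
  qed
  then have "\<forall>x y. lt s x \<and> lt x \<beta> \<and> lt \<beta> y \<and> lt y b \<longrightarrow> r y x"
    using right r(1) by blast
  then show ?thesis using \<open>lt a \<beta>\<close> \<open>lt \<beta> b\<close> s(1) by blast
qed

end

section \<open>Sections of definable predicates and the quantifier "infinitely many"\<close>

context expansion_line
begin

lemma defpred_fix:
  assumes "defpred P"
  shows "defpred (\<lambda>e'. P (case_nat (e' 0) e))"
proof -
  obtain p c where p: "\<And>e. P e \<longleftrightarrow> sat M (interleave e c) p"
    using assms unfolding defpred_def by blast
  let ?c = "interleave (case_nat undefined e) c"
  have "(\<lambda>i. interleave e' ?c (if i = 0 then 0 else Suc (2 * i))) =
      interleave (case_nat (e' 0) e) c" for e'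
    by (rule ext) (auto simp: interleave_def split: nat.split)
  then show ?thesis
    by (intro defpred_reindex[of _ ?c "\<lambda>i. if i = 0 then 0 else Suc (2 * i)" p]) (simp add: p)
qed

lemma tame_section:
  assumes "defpred (\<lambda>e. P (e 0) (\<lambda>i. e (Suc i)))"
  shows "tame {y. P y e}"
  using defpred_fix[OF assms, of e] by (simp add: tame_def)

lemma tame_Collect: "defpred (\<lambda>e. P (e 0)) \<Longrightarrow> tame {y. P y}"
  by (simp add: tame_def)

end

context omin_line
begin

text \<open>By o-minimality a definable set of the line is infinite exactly if it contains an
  interval, which makes "infinitely many" a first-order quantifier.\<close>

lemma defpred_infinite:
  assumes "defpred (\<lambda>e. P (e 0) (\<lambda>i. e (Suc i)))"
  shows "defpred (\<lambda>e. infinite {y. P y e})"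
proof -
  have *: "defpred (\<lambda>e. P (e 0) (\<lambda>i. e (Suc (Suc (Suc i)))))"
    using defpred_ren[OF assms, of "case_nat 0 (\<lambda>i. Suc (Suc (Suc i)))"] by simp
  have "defpred (\<lambda>e. \<exists>l u. l < u \<and> (\<forall>y. l < y \<and> y < u \<longrightarrow> P y e))"
    by (intro defpred_rules *)
  moreover have "infinite {y. P y e} \<longleftrightarrow> (\<exists>l u. l < u \<and> (\<forall>y. l < y \<and> y < u \<longrightarrow> P y e))" for e
    using infinite_tame_iff[OF tame_section[OF assms]] by (simp add: subset_iff)
  ultimately show ?thesis by simp
qed

lemma tame_order_up: "tame_order (<) tame"
proof
  fix S :: "'a set" and x c assume "tame S" "x \<in> S" "\<forall>x\<in>S. \<not> x < c"
  then show "\<exists>m. (\<forall>x\<in>S. \<not> x < m) \<and> (\<forall>m'. m < m' \<longrightarrow> (\<exists>x\<in>S. x < m'))"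
    using tame_inf[of S c] by (metis empty_iff not_less)
next
  fix S :: "'a set" and l z :: 'a assume S: "tame S" and "l < z"
  from tame_decided[OF S, of "Lft z"] obtain s where s: "s < z" "{s<..<z} \<subseteq> S \<or> {s<..<z} \<subseteq> - S"
    unfolding ev_def by auto
  then show "\<exists>s. s < z \<and> \<not> s < l \<and> ((\<forall>y. s < y \<and> y < z \<longrightarrow> y \<in> S) \<or> (\<forall>y. s < y \<and> y < z \<longrightarrow> y \<notin> S))"
    using \<open>l < z\<close> by (intro exI[of _ "max s l"]) auto
qed (auto simp: dense)

lemma tame_order_down: "tame_order (\<lambda>x y. y < x) tame"
proof
  fix S :: "'a set" and x c assume "tame S" "x \<in> S" "\<forall>x\<in>S. \<not> c < x"
  then show "\<exists>m. (\<forall>x\<in>S. \<not> m < x) \<and> (\<forall>m'. m' < m \<longrightarrow> (\<exists>x\<in>S. m' < x))"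
    using tame_sup[of S c] by (metis empty_iff not_less)
next
  fix S :: "'a set" and l z :: 'a assume S: "tame S" and "z < l"
  from tame_decided[OF S, of "Rgt z"] obtain s where s: "z < s" "{z<..<s} \<subseteq> S \<or> {z<..<s} \<subseteq> - S"
    unfolding ev_def by auto
  then show "\<exists>s. z < s \<and> \<not> l < s \<and> ((\<forall>y. y < s \<and> z < y \<longrightarrow> y \<in> S) \<or> (\<forall>y. y < s \<and> z < y \<longrightarrow> y \<notin> S))"
    using \<open>z < l\<close> by (intro exI[of _ "min s l"]) auto
next
  fix x y :: 'a assume "y < x" then show "\<exists>z. z < x \<and> y < z" using dense by blast
qed auto

lemma infinite_partition:
  assumes "a < b" "{a<..<b} \<subseteq> \<Union>\<A>" "finite \<A>" "\<And>A. A \<in> \<A> \<Longrightarrow> tame A"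
  obtains A c d where "A \<in> \<A>" "a \<le> c" "c < d" "d \<le> b" "{c<..<d} \<subseteq> A"
proof -
  have "\<exists>A\<in>\<A>. infinite ({a<..<b} \<inter> A)"
  proof (rule ccontr)
    assume "\<not> ?thesis"
    then have "finite (\<Union>A\<in>\<A>. {a<..<b} \<inter> A)" using assms(3) by blast
    moreover have "(\<Union>A\<in>\<A>. {a<..<b} \<inter> A) = {a<..<b}" using assms(2) by blast
    ultimately have "finite {a<..<b}" by (simp only:)
    then show False using infinite_Ioo[OF assms(1)] by blast
  qed
  then obtain A where A: "A \<in> \<A>" "infinite ({a<..<b} \<inter> A)" by blast
  obtain c d where cd: "c < d" "{c<..<d} \<subseteq> {a<..<b} \<inter> A"
    using tame_infinite[OF tame_Int[OF tame_ioo assms(4)[OF A(1)]] A(2)] .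
  from this(2) have "{c<..<d} \<subseteq> {a..b}" by (rule order_trans) auto
  then have "a \<le> c" "d \<le> b" using cd(1) by (auto simp:
    greaterThanLessThan_subseteq_atLeastAtMost_iff)
  with cd A show ?thesis by (intro that) auto
qed

lemma local_min_drop_up:
  assumes "a < b" "def2 r"
    and r: "\<And>x y z. r x y \<Longrightarrow> r y z \<Longrightarrow> r x z" "\<And>x. \<not> r x x"
    and rtot: "\<And>x y. x \<in> {a<..<b} \<Longrightarrow> y \<in> {a<..<b} \<Longrightarrow> x \<noteq> y \<Longrightarrow> r x y \<or> r y x"
    and min: "\<And>x. x \<in> {a<..<b} \<Longrightarrow> ev (Rgt x) {y. r x y} \<and> ev (Lft x) {y. r x y}"
  shows "\<exists>z\<in>{a<..<b}. \<exists>l u. l < z \<and> z < u \<and> (\<forall>x y. l < x \<and> x < z \<and> z < y \<and> y < u \<longrightarrow> r y x)"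
proof -
  interpret tame_order "(<)" tame by (rule tame_order_up)
  have "\<exists>z l u. a < z \<and> z < b \<and> l < z \<and> z < u \<and> (\<forall>x y. l < x \<and> x < z \<and> z < y \<and> y < u \<longrightarrow> r y x)"
  proof (rule local_min_drop[where r = r])
    show "\<exists>s. x < s \<and> (\<forall>y. x < y \<and> y < s \<longrightarrow> r x y)" if x: "a < x" "x < b" for x
      using min[of x] x by (auto simp: ev_def subset_iff)
    show "\<exists>s. s < x \<and> (\<forall>y. s < y \<and> y < x \<longrightarrow> r x y)" if x: "a < x" "x < b" for x
      using min[of x] x by (auto simp: ev_def subset_iff)
    show "r x y \<or> r y x" if "a < x" "x < b" "a < y" "y < b" "x \<noteq> y" for x y
      using rtot that by simp
    show "r x y \<Longrightarrow> r y z \<Longrightarrow> r x z" "\<not> r x x" for x y z using r by blast+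
  qed ((rule tame_Collect, intro defpred_rules defpred_rel2[OF assms(2)]) | rule assms(1))+
  then show ?thesis by force
qed

lemma local_min_drop_down:
  assumes "a < b" "def2 r"
    and r: "\<And>x y z. r x y \<Longrightarrow> r y z \<Longrightarrow> r x z" "\<And>x. \<not> r x x"
    and rtot: "\<And>x y. x \<in> {a<..<b} \<Longrightarrow> y \<in> {a<..<b} \<Longrightarrow> x \<noteq> y \<Longrightarrow> r x y \<or> r y x"
    and min: "\<And>x. x \<in> {a<..<b} \<Longrightarrow> ev (Rgt x) {y. r x y} \<and> ev (Lft x) {y. r x y}"
  shows "\<exists>z\<in>{a<..<b}. \<exists>l u. l < z \<and> z < u \<and> (\<forall>x y. l < x \<and> x < z \<and> z < y \<and> y < u \<longrightarrow> r x y)"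
proof -
  interpret tame_order "\<lambda>x y. y < x" tame by (rule tame_order_down)
  have "\<exists>z l u. z < b \<and> a < z \<and> z < l \<and> u < z \<and> (\<forall>x y. x < l \<and> z < x \<and> y < z \<and> u < y \<longrightarrow> r y x)"
  proof (rule local_min_drop[where r = r])
    show "\<exists>s. s < x \<and> (\<forall>y. y < x \<and> s < y \<longrightarrow> r x y)" if x: "x < b" "a < x" for x
      using min[of x] x by (auto simp: ev_def subset_iff)
    show "\<exists>s. x < s \<and> (\<forall>y. y < s \<and> x < y \<longrightarrow> r x y)" if x: "x < b" "a < x" for x
      using min[of x] x by (auto simp: ev_def subset_iff)
    show "r x y \<or> r y x" if "x < b" "a < x" "y < b" "a < y" "x \<noteq> y" for x y
      using rtot that by simp
    show "r x y \<Longrightarrow> r y z \<Longrightarrow> r x z" "\<not> r x x" for x y z using r by blast+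
  qed ((rule tame_Collect, intro defpred_rules defpred_rel2[OF assms(2)]) | rule assms(1))+
  then show ?thesis by force
qed

text \<open>By \<open>local_min_drop_up\<close> every subinterval contains a drop point, so the
  definable set of drop points fills an interval. The mirrored argument finds in that interval a
  point with the opposite jump, and the two are incompatible.\<close>

lemma local_min_False:
  assumes "a < b" "def2 r"
    and r: "\<And>x y z. r x y \<Longrightarrow> r y z \<Longrightarrow> r x z" "\<And>x. \<not> r x x"
    and rtot: "\<And>x y. x \<in> {a<..<b} \<Longrightarrow> y \<in> {a<..<b} \<Longrightarrow> x \<noteq> y \<Longrightarrow> r x y \<or> r y x"
    and min: "\<And>x. x \<in> {a<..<b} \<Longrightarrow> ev (Rgt x) {y. r x y} \<and> ev (Lft x) {y. r x y}"
  shows False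
proof -
  let ?\<Psi> = "{z. \<exists>l u. l < z \<and> z < u \<and> (\<forall>x y. l < x \<and> x < z \<and> z < y \<and> y < u \<longrightarrow> r y x)}"
  have tame_\<Psi>: "tame ?\<Psi>" by (rule tame_Collect) (intro defpred_rules defpred_rel2[OF assms(2)])
  have drop: "\<exists>z\<in>{c<..<d}. z \<in> ?\<Psi>" if cd: "a \<le> c" "c < d" "d \<le> b" for c d
  proof -
    have "x \<in> {a<..<b}" if "x \<in> {c<..<d}" for x using cd that by auto
    then have "\<exists>z\<in>{c<..<d}. \<exists>l u. l < z \<and> z < u \<and> (\<forall>x y. l < x \<and> x < z \<and> z < y \<and> y < u \<longrightarrow> r y x)"
      using rtot min by (intro local_min_drop_up[OF cd(2) assms(2) r(1) r(2)]) blast+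
    then show ?thesis by blast
  qed
  obtain A c d where A: "A \<in> {?\<Psi>, - ?\<Psi>}" "a \<le> c" "c < d" "d \<le> b" "{c<..<d} \<subseteq> A"
    by (rule infinite_partition[OF assms(1), of "{?\<Psi>, - ?\<Psi>}"]) (use tame_\<Psi> tame_compl in auto)
  then have \<Psi>: "{c<..<d} \<subseteq> ?\<Psi>" using drop[of c d] by blast
  have "x \<in> {a<..<b}" if "x \<in> {c<..<d}" for x using A that by auto
  then have "\<exists>z\<in>{c<..<d}. \<exists>l u. l < z \<and> z < u \<and> (\<forall>x y. l < x \<and> x < z \<and> z < y \<and> y < u \<longrightarrow> r x y)"
    using rtot min by (intro local_min_drop_down[OF A(3) assms(2) r(1) r(2)]) blast+
  then obtain z l u where z: "z \<in> {c<..<d}" "l < z" "z < u"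
    "\<forall>x y. l < x \<and> x < z \<and> z < y \<and> y < u \<longrightarrow> r x y"
    by blast
  then obtain l' u' where z': "l' < z" "z < u'" "\<forall>x y. l' < x \<and> x < z \<and> z < y \<and> y < u' \<longrightarrow> r y x"
    using \<Psi> by blast
  obtain x where "max l l' < x" "x < z" using dense[of "max l l'" z] z z' by auto
  moreover obtain y where "z < y" "y < min u u'" using dense[of z "min u u'"] z z' by auto
  ultimately have "r x y" "r y x" using z(4) z'(3) by auto
  then show False using r by blast
qed

text \<open>A least-upper-bound argument: the supremum of the initial segments after x on which r
  holds from x cannot lie inside the interval, since the local comparison on its two sides would
  extend the segment.\<close>

lemma local_increasing:
  assumes "def2 r" and r: "\<And>x y z. r x y \<Longrightarrow> r y z \<Longrightarrow> r x z"
    and loc: "\<And>x. x \<in> {a<..<b} \<Longrightarrow> ev (Rgt x) {y. r x y} \<and> ev (Lft x) {y. r y x}"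
    and xy: "x \<in> {a<..<b}" "y \<in> {a<..<b}" "x < y"
  shows "r x y"
proof -
  let ?S = "{s. x < s \<and> s \<le> b \<and> (\<forall>y. x < y \<and> y < s \<longrightarrow> r x y)}"
  have tmS: "tame ?S" by (rule tame_Collect) (intro defpred_rules defpred_rel2[OF assms(1)])
  obtain s0 where s0: "x < s0" "\<forall>y. x < y \<and> y < s0 \<longrightarrow> r x y"
    using loc[OF xy(1)] by (auto simp: ev_def subset_iff)
  then have min: "min s0 b \<in> ?S" using xy by auto
  obtain s where s: "\<forall>x\<in>?S. x \<le> s" "\<forall>m'<s. \<exists>x\<in>?S. m' < x"
    by (rule tame_sup[OF tmS, of b]) (use min in blast)+
  have up: "r x z" if z: "x < z" "z < s" for z using s(2) z by blast
  have "x < min s0 b" using min by blast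
  also have "min s0 b \<le> s" using min s(1) by blast
  finally have "x < s" .
  have "b \<le> s"
  proof (rule ccontr)
    assume "\<not> b \<le> s"
    then have sb: "s \<in> {a<..<b}" using \<open>x < s\<close> xy by auto
    then obtain q p where q: "q < s" "\<forall>y. q < y \<and> y < s \<longrightarrow> r y s" and p: "s < p"
      "\<forall>y. s < y \<and> y < p \<longrightarrow> r s y"
      using loc[OF sb] by (auto simp: ev_def subset_iff)
    obtain z where "max q x < z" "z < s" using dense[of "max q x" s] q \<open>x < s\<close> by auto
    then have "r x s" using up[of z] q(2) r by auto
    have "r x z" if z: "x < z" "z < min p b" for z
    proof (cases z s rule: linorder_cases)
      case less
      then show ?thesis using z up by blast
    next
      case greater
      then have "r s z" using z p(2) by simp
      then show ?thesis using \<open>r x s\<close> r by blast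
    qed (use \<open>r x s\<close> in simp)
    moreover have "x < min p b" using less_trans[OF \<open>x < s\<close> p(1)] less_trans[OF \<open>x < s\<close>, of b] sb
      by simp
    ultimately have "min p b \<in> ?S" by simp
    then have "min p b \<le> s" using s(1) by blast
    then show False using p(1) sb by (auto simp: min_le_iff_disj)
  qed
  then show ?thesis using up[of y] xy by auto
qed

definition mono_on_ioo :: "('a \<Rightarrow> 'a) \<Rightarrow> 'a \<Rightarrow> 'a \<Rightarrow> bool" where
  "mono_on_ioo f c d \<longleftrightarrow> (\<forall>x\<in>{c<..<d}. \<forall>y\<in>{c<..<d}. x < y \<longrightarrow> f x < f y) \<or>
     (\<forall>x\<in>{c<..<d}. \<forall>y\<in>{c<..<d}. x < y \<longrightarrow> f y < f x)"

text \<open>Injectivity leaves four patterns of smaller and larger values on the two sides of a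
  point, and one pattern holds throughout a subinterval. The two patterns of a local extremum are
  impossible; the other two propagate to strict monotonicity.\<close>

lemma injective_monotone:
  assumes f: "deffun f" and "a < b" and inj: "inj_on f {a<..<b}"
  obtains c d where "a \<le> c" "c < d" "d \<le> b" "mono_on_ioo f c d"
proof -
  let ?r = "\<lambda>x y. f x < f y" and ?r' = "\<lambda>x y. f y < f x"
  have d2: "def2 ?r" "def2 ?r'" unfolding def2_def by (intro defpred_rules defterm_app[OF f])+
  let ?R = "\<lambda>x. ev (Rgt x) {y. ?r x y}" and ?R' = "\<lambda>x. ev (Rgt x) {y. ?r' x y}"
  let ?L = "\<lambda>x. ev (Lft x) {y. ?r x y}" and ?L' = "\<lambda>x. ev (Lft x) {y. ?r' x y}"
  have tmr: "tame {y. ?r x y}" for x by (rule tame_Collect) (intro defpred_rules defterm_app[OF f])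
  have nbr: "ev (Rgt x) {a<..<b}" "ev (Lft x) {a<..<b}" if "x \<in> {a<..<b}" for x
    using that ev_near[of a x b] by auto
  have dec: "ev g {y. ?r x y} \<or> ev g {y. ?r' x y}"
    if x: "x \<in> {a<..<b}" and g: "ev g {a<..<b}" "g = Rgt x \<or> g = Lft x" for g x
  proof -
    have "ev g (- {x})" using g(2) gt_ex[of x] lt_ex[of x] by (auto simp: ev_def)
    then have "ev g ({a<..<b} \<inter> - {x})" using g(1) by (simp add: ev_Int_iff)
    moreover have "ev g {y. ?r x y} \<or> ev g (- {y. ?r x y})" by (rule tame_decided[OF tmr])
    moreover have "{a<..<b} \<inter> - {x} \<inter> - {y. ?r x y} \<subseteq> {y. ?r' x y}"
    proof
      fix y assume y: "y \<in> {a<..<b} \<inter> - {x} \<inter> - {y. ?r x y}"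
      then have "f y \<noteq> f x" using inj x by (auto dest: inj_onD)
      with y show "y \<in> {y. ?r' x y}" by auto
    qed
    ultimately show ?thesis
      using ev_mono[of g "{a<..<b} \<inter> - {x} \<inter> - {y. ?r x y}" "{y. ?r' x y}"]
        ev_Int_iff[of g "{a<..<b} \<inter> - {x}" "- {y. ?r x y}"] by argo
  qed
  let ?\<A> = "{{x. ?R x \<and> ?L x}, {x. ?R x \<and> ?L' x}, {x. ?R' x \<and> ?L x}, {x. ?R' x \<and> ?L' x}}"
  have cover: "{a<..<b} \<subseteq> \<Union>?\<A>"
  proof
    fix x assume x: "x \<in> {a<..<b}"
    have "?R x \<or> ?R' x" by (rule dec[OF x nbr(1)[OF x]]) simp
    moreover have "?L x \<or> ?L' x" by (rule dec[OF x nbr(2)[OF x]]) simp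
    ultimately show "x \<in> \<Union>?\<A>" by auto
  qed
  have tmA: "tame A" if "A \<in> ?\<A>" for A
    using that
    by (elim insertE emptyE; simp only:; intro tame_Collect defpred_rules defpred_ev defgerm_intros
      defterm_app[OF f])
  obtain A c d where A: "A \<in> ?\<A>" "a \<le> c" "c < d" "d \<le> b" "{c<..<d} \<subseteq> A"
    by (rule infinite_partition[OF \<open>a < b\<close> cover _ tmA]) auto
  have sub: "{c<..<d} \<subseteq> {a<..<b}" using A by auto
  have tot: "f x < f y \<or> f y < f x" if "x \<in> {c<..<d}" "y \<in> {c<..<d}" "x \<noteq> y" for x y
    using inj that sub unfolding inj_on_def by (meson linorder_neqE subsetD)
  have "mono_on_ioo f c d"
  proof -
    consider "{c<..<d} \<subseteq> {x. ?R x \<and> ?L x}" | "{c<..<d} \<subseteq> {x. ?R x \<and> ?L' x}"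
      | "{c<..<d} \<subseteq> {x. ?R' x \<and> ?L x}" | "{c<..<d} \<subseteq> {x. ?R' x \<and> ?L' x}"
      using A(1,5) by auto
    then show ?thesis
    proof cases
      case 1
      have False
        by (rule local_min_False[OF A(3) d2(1)]) (use 1 tot in auto)
      then show ?thesis ..
    next
      case 2
      have "f x < f y" if "x \<in> {c<..<d}" "y \<in> {c<..<d}" "x < y" for x y
        by (rule local_increasing[OF d2(1) _ _ that]) (use 2 in auto)
      then show ?thesis unfolding mono_on_ioo_def by blast
    next
      case 3
      have "f y < f x" if "x \<in> {c<..<d}" "y \<in> {c<..<d}" "x < y" for x y
        by (rule local_increasing[OF d2(2) _ _ that]) (use 3 in auto)
      then show ?thesis unfolding mono_on_ioo_def by blast
    next
      case 4
      have False
        by (rule local_min_False[OF A(3) d2(2)]) (use 4 tot in auto)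
      then show ?thesis ..
    qed
  qed
  with A show ?thesis by (intro that)
qed

end

section \<open>Exchange\<close>

context omin_line
begin

lemma subinterval_bounds:
  fixes a b c d :: 'a
  assumes "c < d" "{c<..<d} \<subseteq> {a<..<b}"
  shows "a \<le> c" "d \<le> b"
proof -
  from assms(2) have "{c<..<d} \<subseteq> {a..b}" by (rule order_trans) auto
  then show "a \<le> c" "d \<le> b"
    using assms(1) by (auto simp: greaterThanLessThan_subseteq_atLeastAtMost_iff)
qed

text \<open>On the points where f takes a value for the first time f is injective, and with finite
  fibres there are infinitely many such points.\<close>

lemma finite_to_one_monotone:
  assumes f: "deffun f" and "a < b" and fin: "\<And>v. finite {x\<in>{a<..<b}. f x = v}"
  obtains c d where "a \<le> c" "c < d" "d \<le> b" "mono_on_ioo f c d"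
proof -
  let ?S = "{x. a < x \<and> x < b \<and> (\<forall>y. a < y \<and> y < x \<longrightarrow> f y \<noteq> f x)}"
  have tmS: "tame ?S" by (rule tame_Collect) (intro defpred_rules defterm_app[OF f])
  have "infinite ?S"
  proof
    assume "finite ?S"
    have "{a<..<b} \<subseteq> (\<Union>v\<in>f ` ?S. {x\<in>{a<..<b}. f x = v})"
    proof
      fix x assume x: "x \<in> {a<..<b}"
      let ?F = "{y\<in>{a<..<b}. f y = f x}"
      have ne: "?F \<noteq> {}" "finite ?F" using x fin by auto
      have m: "Min ?F \<in> ?F" using Min_in[OF ne(2,1)] .
      have "f y \<noteq> f (Min ?F)" if y: "a < y" "y < Min ?F" for y
      proof
        assume "f y = f (Min ?F)"
        then have "y \<in> ?F" using m y by auto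
        then show False using Min_le[OF ne(2)] y(2) leD by blast
      qed
      then have "Min ?F \<in> ?S" using m by auto
      moreover have "f x = f (Min ?F)" using m by auto
      ultimately show "x \<in> (\<Union>v\<in>f ` ?S. {x\<in>{a<..<b}. f x = v})" using x by blast
    qed
    moreover have "finite (\<Union>v\<in>f ` ?S. {x\<in>{a<..<b}. f x = v})"
      using \<open>finite ?S\<close> fin by blast
    ultimately show False using infinite_Ioo[OF \<open>a < b\<close>] finite_subset by blast
  qed
  then obtain c d where cd: "c < d" "{c<..<d} \<subseteq> ?S" using tame_infinite[OF tmS] by blast
  then have sub: "{c<..<d} \<subseteq> {a<..<b}" by auto
  have "inj_on f {c<..<d}"
  proof (rule linorder_inj_onI)
    fix x y assume xy: "x < y" "x \<in> {c<..<d}" "y \<in> {c<..<d}"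
    then have "a < x" "y \<in> ?S" using cd(2) by blast+
    with xy(1) show "f x \<noteq> f y" by blast
  qed auto
  then obtain c' d' where "c \<le> c'" "c' < d'" "d' \<le> d" "mono_on_ioo f c' d'"
    using injective_monotone[OF f cd(1)] by blast
  with subinterval_bounds[OF cd(1) sub] show ?thesis by (intro that) auto
qed

text \<open>Finite nonempty fibres make the minimum a definable choice; finiteness in the other
  direction makes this choice function finite-to-one.\<close>

lemma select_monotone:
  assumes R: "def2 R" and "a < b"
    and ne: "\<And>t. t \<in> {a<..<b} \<Longrightarrow> finite {x. R t x} \<and> {x. R t x} \<noteq> {}"
    and fin: "\<And>x. finite {t\<in>{a<..<b}. R t x}"
  obtains f c d where "deffun f" "a \<le> c" "c < d" "d \<le> b" "mono_on_ioo f c d"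
    "\<And>t. t \<in> {a<..<b} \<Longrightarrow> f t = Min {x. R t x}" "\<And>t. t \<in> {a<..<b} \<Longrightarrow> R t (f t)"
proof -
  \<comment> \<open>\<open>deffun\<close> concerns total functions, so f is continued by the
    identity.\<close>
  define f where "f t = (if t \<in> {a<..<b} then Min {x. R t x} else t)" for t
  have fR: "R t (f t)" if "t \<in> {a<..<b}" for t
    using Min_in[of "{x. R t x}"] ne that by (auto simp: f_def)
  have "defpred (\<lambda>e. (a < e 1 \<and> e 1 < b \<and> R (e 1) (e 0) \<and> (\<forall>x. R (e 1) x \<longrightarrow> e 0 \<le> x)) \<or>
      (\<not> (a < e 1 \<and> e 1 < b) \<and> e 0 = e 1))"
    by (intro defpred_rules defpred_rel2[OF R])
  moreover have "y = f t \<longleftrightarrow> (a < t \<and> t < b \<and> R t y \<and> (\<forall>x. R t x \<longrightarrow> y \<le> x)) \<or>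
      (\<not> (a < t \<and> t < b) \<and> y = t)" for y t
  proof (cases "t \<in> {a<..<b}")
    case True
    then show ?thesis
      using ne[of t] Min_eq_iff[of "{x. R t x}" y] by (auto simp: f_def)
  qed (auto simp: f_def)
  ultimately have f: "deffun f" unfolding deffun_def by simp
  have "finite {x\<in>{a<..<b}. f x = v}" for v
    by (rule finite_subset[OF _ fin[of v]]) (use fR in auto)
  then obtain c d where cd: "a \<le> c" "c < d" "d \<le> b" "mono_on_ioo f c d"
    using finite_to_one_monotone[OF f \<open>a < b\<close>] by blast
  show ?thesis
    by (rule that[OF f cd]) (use fR in \<open>auto simp: f_def\<close>)
qed

text \<open>The sides of p correspond to the sides of \<open>f p\<close>, with orientation kept or
  reversed. Stated through preimages, this transports membership in germs at \<open>f p\<close> to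
  germs at p.\<close>

definition local_homeo :: "('a \<Rightarrow> 'a) \<Rightarrow> 'a \<Rightarrow> bool" where
  "local_homeo f p \<longleftrightarrow>
    (\<forall>U. ev (Rgt (f p)) U \<longrightarrow> ev (Rgt p) {r. f r \<in> U}) \<and>
    (\<forall>U. ev (Lft (f p)) U \<longrightarrow> ev (Lft p) {r. f r \<in> U}) \<or>
    (\<forall>U. ev (Rgt (f p)) U \<longrightarrow> ev (Lft p) {r. f r \<in> U}) \<and>
    (\<forall>U. ev (Lft (f p)) U \<longrightarrow> ev (Rgt p) {r. f r \<in> U})"

text \<open>A monotone map may jump. The point p is taken with its value in the interior of the
  image, so that values close to \<open>f p\<close> on both sides are attained.\<close>

lemma monotone_local_homeo:
  assumes f: "deffun f" and "c < d" and mono: "mono_on_ioo f c d"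
  obtains p where "p \<in> {c<..<d}" "local_homeo f p"
proof -
  have inj: "inj_on f {c<..<d}"
    by (rule linorder_inj_onI) (use mono in \<open>unfold mono_on_ioo_def, force+\<close>)
  have "defpred (\<lambda>e. \<exists>x. c < x \<and> x < d \<and> e 0 = f x)" by (intro defpred_rules defterm_app[OF f])
  then have "tame (f ` {c<..<d})"
    unfolding tame_def image_iff by (simp add: Bex_def conj_assoc)
  moreover have "infinite (f ` {c<..<d})"
    using finite_imageD[OF _ inj] infinite_Ioo[OF \<open>c < d\<close>] by blast
  ultimately obtain l u where lu: "l < u" "{l<..<u} \<subseteq> f ` {c<..<d}" using tame_infinite by blast
  obtain v where v: "l < v" "v < u" using dense[OF lu(1)] by blast
  then obtain p where p: "p \<in> {c<..<d}" "f p = v" using lu(2) by force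
  have right: "\<exists>q\<in>{c<..<d}. v < f q \<and> {v<..<f q} \<subseteq> U" if U: "ev (Rgt v) U" for U
  proof -
    obtain s where s: "v < s" "{v<..<s} \<subseteq> U" using U by (auto simp: ev_def)
    obtain w where w: "v < w" "w < min u s" using dense[of v "min u s"] s v by auto
    then have "w \<in> {l<..<u}" using v by auto
    then obtain q where "q \<in> {c<..<d}" "f q = w" using lu(2) by force
    then show ?thesis using w s by force
  qed
  have left: "\<exists>q\<in>{c<..<d}. f q < v \<and> {f q<..<v} \<subseteq> U" if U: "ev (Lft v) U" for U
  proof -
    obtain s where s: "s < v" "{s<..<v} \<subseteq> U" using U by (auto simp: ev_def)
    obtain w where w: "max l s < w" "w < v" using dense[of "max l s" v] s v by auto
    then have "w \<in> {l<..<u}" using v by auto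
    then obtain q where "q \<in> {c<..<d}" "f q = w" using lu(2) by force
    then show ?thesis using w s by force
  qed
  have evR: "ev (Rgt p) S" if "p < q" "\<And>r. p < r \<Longrightarrow> r < q \<Longrightarrow> r \<in> S" for q S
    unfolding ev_def using that by (intro exI[of _ q]) auto
  have evL: "ev (Lft p) S" if "q < p" "\<And>r. q < r \<Longrightarrow> r < p \<Longrightarrow> r \<in> S" for q S
    unfolding ev_def using that by (intro exI[of _ q]) auto
  have btw: "r \<in> {c<..<d}" if "q \<in> {c<..<d}" "q' \<in> {c<..<d}" "q < r" "r < q'" for q q' r
    using that by (auto intro: less_trans)
  consider (inc) "\<And>x y. x \<in> {c<..<d} \<Longrightarrow> y \<in> {c<..<d} \<Longrightarrow> x < y \<Longrightarrow> f x < f y"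
    | (decr) "\<And>x y. x \<in> {c<..<d} \<Longrightarrow> y \<in> {c<..<d} \<Longrightarrow> x < y \<Longrightarrow> f y < f x"
    using mono unfolding mono_on_ioo_def by blast
  then have "local_homeo f p"
  proof cases
    case inc
    have "ev (Rgt p) {r. f r \<in> U}" if U: "ev (Rgt (f p)) U" for U
    proof -
      obtain q where q: "q \<in> {c<..<d}" "v < f q" "{v<..<f q} \<subseteq> U" using right[of U] U p(2) by blast
      have "p < q" using inc[of q p] q p by (metis less_asym neqE)
      then show ?thesis
      proof (rule evR)
        fix r assume r: "p < r" "r < q"
        have "f p < f r" "f r < f q" using inc btw[OF p(1) q(1) r] r p q by auto
        then show "r \<in> {r. f r \<in> U}" using q p by auto
      qed
    qed
    moreover have "ev (Lft p) {r. f r \<in> U}" if U: "ev (Lft (f p)) U" for U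
    proof -
      obtain q where q: "q \<in> {c<..<d}" "f q < v" "{f q<..<v} \<subseteq> U" using left[of U] U p(2) by blast
      have "q < p" using inc[of p q] q p by (metis less_asym neqE)
      then show ?thesis
      proof (rule evL)
        fix r assume r: "q < r" "r < p"
        have "f q < f r" "f r < f p" using inc btw[OF q(1) p(1) r] r p q by auto
        then show "r \<in> {r. f r \<in> U}" using q p by auto
      qed
    qed
    ultimately show ?thesis unfolding local_homeo_def by blast
  next
    case decr
    have "ev (Lft p) {r. f r \<in> U}" if U: "ev (Rgt (f p)) U" for U
    proof -
      obtain q where q: "q \<in> {c<..<d}" "v < f q" "{v<..<f q} \<subseteq> U" using right[of U] U p(2) by blast
      have "q < p" using decr[of p q] q p by (metis less_asym neqE)
      then show ?thesis
      proof (rule evL)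
        fix r assume r: "q < r" "r < p"
        have "f p < f r" "f r < f q" using decr btw[OF q(1) p(1) r] r p q by auto
        then show "r \<in> {r. f r \<in> U}" using q p by auto
      qed
    qed
    moreover have "ev (Rgt p) {r. f r \<in> U}" if U: "ev (Lft (f p)) U" for U
    proof -
      obtain q where q: "q \<in> {c<..<d}" "f q < v" "{f q<..<v} \<subseteq> U" using left[of U] U p(2) by blast
      have "p < q" using decr[of q p] q p by (metis less_asym neqE)
      then show ?thesis
      proof (rule evR)
        fix r assume r: "p < r" "r < q"
        have "f q < f r" "f r < f p" using decr btw[OF p(1) q(1) r] r p q by auto
        then show "r \<in> {r. f r \<in> U}" using q p by auto
      qed
    qed
    ultimately show ?thesis unfolding local_homeo_def by blast
  qed
  with p show ?thesis by (intro that)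
qed

text \<open>Serves to refute infinite exceptional sets: on an interval of exceptions a witness is
  selected, and at the point p the selection carries neighbourhoods of \<open>f p\<close> back to
  p.\<close>

lemma select_local_homeo:
  assumes R: "def2 R" and "a < b"
    and ne: "\<And>t. t \<in> {a<..<b} \<Longrightarrow> finite {x. R t x} \<and> {x. R t x} \<noteq> {}"
    and fin: "\<And>x. finite {t\<in>{a<..<b}. R t x}"
  obtains p f where "p \<in> {a<..<b}" "local_homeo f p" "\<forall>t\<in>{a<..<b}. R t (f t)"
proof -
  obtain f c d where f: "deffun f" "a \<le> c" "c < d" "d \<le> b" "mono_on_ioo f c d"
    "\<And>t. t \<in> {a<..<b} \<Longrightarrow> f t = Min {x. R t x}" "\<And>t. t \<in> {a<..<b} \<Longrightarrow> R t (f t)"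
    using select_monotone[OF R \<open>a < b\<close> ne fin] by blast
  obtain p where "p \<in> {c<..<d}" "local_homeo f p" using monotone_local_homeo[OF f(1,3,5)] .
  with f show ?thesis by (intro that[of p f]) auto
qed

text \<open>A Fubini statement for the plane, and the core of the dimension argument. Call
  \<open>{y. P x y}\<close> the row of x. If only finitely many y belonged to infinitely many rows,
  the remaining y could be charged to the least x whose row contains them in its interior; this
  choice would be strictly monotone on an interval and yet have a local maximum there.\<close>

lemma infinite_swap:
  assumes P: "def2 P" and inf: "infinite {x. infinite {y. P x y}}"
  shows "infinite {y. infinite {x. P x y}}"
proof
  let ?bad = "{y. infinite {x. P x y}}"
  assume bad: "finite ?bad"
  have tmbad: "tame ?bad" using tame_finite[OF bad] .
  have tmP: "tame {y. P x y}" for x by (rule tame_Collect) (intro defpred_rules defpred_rel2[OF P])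
  have "tame {x. infinite {y. P x y}}"
    by (rule tame_Collect) (intro defpred_infinite defpred_rel2[OF P] defterm_var)
  then obtain a b where ab: "a < b" "{a<..<b} \<subseteq> {x. infinite {y. P x y}}"
    using tame_infinite inf by blast
  \<comment> \<open>Only interior points of the rows are kept, so that the relation persists near y
    with x fixed; the finitely many bad y are removed.\<close>
  define Q where "Q x y \<longleftrightarrow> a < x \<and> x < b \<and> y \<notin> ?bad \<and> (\<exists>l u. l < y \<and> y < u \<and> (\<forall>z. l < z \<and> z < u \<longrightarrow>
      P x z))" for x y
  have dQ: "defpred (\<lambda>e. Q (f e) (g e))" if fg: "defterm f" "defterm g" for f g
    unfolding Q_def by (intro defpred_rules fg defterm_ren[OF fg(1)] defterm_ren[OF fg(2)]
        defterm_ren[OF defterm_ren[OF fg(1)]] defterm_ren[OF defterm_ren[OF fg(2)]]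
        defterm_ren[OF defterm_ren[OF defterm_ren[OF fg(1)]]] defpred_rel2[OF P] defpred_tame[OF
          tmbad])
  have d2Q: "def2 Q" unfolding def2_def by (intro dQ defterm_var)
  have Qinf: "infinite {y. Q x y}" if x: "x \<in> {a<..<b}" for x
  proof -
    have "infinite {y. P x y}" using ab x by blast
    then obtain l u where lu: "l < u" "{l<..<u} \<subseteq> {y. P x y}" using tame_infinite[OF tmP] by blast
    then have "{l<..<u} - ?bad \<subseteq> {y. Q x y}" using x by (auto simp: Q_def subset_iff)
    moreover have "infinite ({l<..<u} - ?bad)"
      using Diff_infinite_finite[OF bad infinite_Ioo[OF lu(1)]] .
    ultimately show ?thesis using finite_subset by blast
  qed
  have QP: "P x y" if "Q x y" for x y using that unfolding Q_def by blast
  have Qfin: "finite {x. Q x y}" for y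
  proof (cases "y \<in> ?bad")
    case True
    then have "{x. Q x y} = {}" by (auto simp: Q_def)
    then show ?thesis by simp
  next
    case False
    then have "finite {x. P x y}" by blast
    then show ?thesis by (rule rev_finite_subset) (use QP in blast)
  qed
  \<comment> \<open>The y charged to x. These sets are disjoint for distinct x.\<close>
  define F where "F x = {y. Q x y \<and> (\<forall>x'. Q x' y \<longrightarrow> x \<le> x')}" for x
  have dF: "defpred (\<lambda>e. g e \<in> F (f e))" if fg: "defterm f" "defterm g" for f g
    unfolding F_def by (simp, intro defpred_rules dQ fg defterm_ren[OF fg(1)] defterm_ren[OF fg(2)])
  have tmF: "tame (F x)" for x unfolding tame_def by (intro dF defterm_var defterm_const)
  have Funiq: "x = x'" if "y \<in> F x" "y \<in> F x'" for x x' y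
    using that unfolding F_def by (auto intro: antisym)
  have Fex: "\<exists>x'\<le>x. y \<in> F x'" if "Q x y" for x y
  proof -
    have "Min {x. Q x y} \<in> {x. Q x y}" using Min_in[OF Qfin[of y]] that by blast
    moreover have "Min {x. Q x y} \<le> x'" if "Q x' y" for x' using Min_le[OF Qfin] that by blast
    ultimately show ?thesis using that unfolding F_def by blast
  qed
  have "finite {x. infinite (F x)}"
  proof (rule ccontr)
    assume infF: "\<not> ?thesis"
    \<comment> \<open>\<open>?E\<close> holds the points at which some \<open>F x\<close> stops on
      the right. No interval consists of such points, while infinitely many infinite sets
      \<open>F x\<close> would give infinitely many of them.\<close>
    let ?E = "{y. \<exists>x. ev (Lft y) (F x) \<and> \<not> (y \<in> F x \<and> ev (Rgt y) (F x))}"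
    have tmE: "tame ?E"
    proof (rule tame_Collect)
      have "defpred (\<lambda>e. \<exists>x. ev (Lft (e 0)) {y. y \<in> F x} \<and> \<not> (e 0 \<in> F x \<and>
          ev (Rgt (e 0)) {y. y \<in> F x}))"
        by (intro defpred_rules defpred_ev defgerm_intros dF)
      then show "defpred (\<lambda>e. \<exists>x. ev (Lft (e 0)) (F x) \<and> \<not> (e 0 \<in> F x \<and> ev (Rgt (e 0)) (F x)))"
        by simp
    qed
    have Eex: "\<exists>y. ev (Lft y) (F x) \<and> \<not> (y \<in> F x \<and> ev (Rgt y) (F x))"
      if x: "infinite (F x)" and top: "\<not> ev PosInf (F x)" for x
    proof -
      obtain l u where lu: "l < u" "{l<..<u} \<subseteq> F x" using tame_infinite[OF tmF x] by blast
      let ?S = "{s. l < s \<and> (\<forall>y. l < y \<and> y < s \<longrightarrow> y \<in> F x)}"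
      have tmS: "tame ?S" by (rule tame_Collect) (intro defpred_rules dF)
      have u: "u \<in> ?S" using lu by auto
      have "ev PosInf (- F x)" using top not_ev[OF tmF] by blast
      then obtain t where t: "{t<..} \<subseteq> - F x" by (auto simp: ev_def)
      have "\<forall>s\<in>?S. s \<le> max l t"
      proof
        fix s assume s: "s \<in> ?S"
        show "s \<le> max l t"
        proof (rule ccontr)
          assume "\<not> ?thesis"
          then obtain y where "max l t < y" "y < s" using dense[of "max l t" s] unfolding not_le
            by blast
          then show False using s t by auto
        qed
      qed
      then obtain m where m: "\<forall>s\<in>?S. s \<le> m" "\<forall>m'<m. \<exists>s\<in>?S. m' < s"
        using tame_sup[OF tmS, of "max l t"] u by blast
      have "l < m" using u m(1) by (auto intro: less_le_trans)
      have lm: "y \<in> F x" if "l < y" "y < m" for y using m(2) that by blast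
      then have "ev (Lft m) (F x)" using \<open>l < m\<close> unfolding ev_def by (intro exI[of _ l]) auto
      moreover have "\<not> (m \<in> F x \<and> ev (Rgt m) (F x))"
      proof
        assume mF: "m \<in> F x \<and> ev (Rgt m) (F x)"
        then obtain s where s: "m < s" "{m<..<s} \<subseteq> F x" by (auto simp: ev_def)
        obtain s' where s': "m < s'" "s' < s" using dense[OF s(1)] by blast
        have "y \<in> F x" if y: "l < y" "y < s'" for y
          using mF lm[OF y(1)] s(2) s' y by (cases y m rule: linorder_cases) auto
        then have "s' \<in> ?S" using less_trans[OF \<open>l < m\<close> s'(1)] by blast
        then have "s' \<le> m" using m(1) by blast
        then show False using s'(1) by auto
      qed
      ultimately show ?thesis by blast
    qed
    let ?W = "{x. infinite (F x) \<and> \<not> ev PosInf (F x)}"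
    obtain g where g: "\<And>x. x \<in> ?W \<Longrightarrow> ev (Lft (g x)) (F x) \<and> \<not> (g x \<in> F x \<and> ev (Rgt (g x)) (F x))"
      using Eex by (metis (mono_tags, lifting) mem_Collect_eq)
    have same: "x = x'" if "ev h (F x)" "ev h (F x')" for h x x'
      using ev_meets[OF that] Funiq by blast
    have "inj_on g ?W"
      by (rule inj_onI) (metis g same)
    moreover have "g ` ?W \<subseteq> ?E" using g by blast
    moreover have "infinite ?W"
    proof
      assume "finite ?W"
      moreover have "{x. infinite (F x)} \<subseteq> ?W \<union> {x. ev PosInf (F x)}" by blast
      moreover have "finite {x. ev PosInf (F x)}"
      proof (cases "{x. ev PosInf (F x)} = {}")
        case False
        then obtain x where "ev PosInf (F x)" by blast
        then have "{x. ev PosInf (F x)} \<subseteq> {x}" using same by blast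
        then show ?thesis using finite_subset by blast
      qed simp
      ultimately show False using infF by (metis finite_Un finite_subset)
    qed
    ultimately have "infinite ?E" using inj_on_finite by blast
    then obtain c d where cd: "c < d" "{c<..<d} \<subseteq> ?E" using tame_infinite[OF tmE] by blast
    obtain y where y: "c < y" "y < d" using dense[OF cd(1)] by blast
    then obtain x where x: "ev (Lft y) (F x)" using cd(2) by force
    then obtain q where q: "q < y" "{q<..<y} \<subseteq> F x" by (auto simp: ev_def)
    obtain w where w: "max q c < w" "w < y" using dense[of "max q c" y] q y by auto
    then have wF: "w \<in> F x" "ev (Lft w) (F x)" "ev (Rgt w) (F x)"
      using q ev_near[of q w y "F x"] by auto
    have "w \<in> ?E" using cd(2) w less_trans[OF w(2) y(2)] by auto
    then obtain x' where "ev (Lft w) (F x')" "\<not> (w \<in> F x' \<and> ev (Rgt w) (F x'))" by blast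
    then show False using same wF by blast
  qed
  then have finF: "finite ({x. infinite (F x)} \<inter> {a<..<b})" by blast
  \<comment> \<open>After shortening the interval all \<open>F x\<close> are finite, so that sending
    y to its charge will be a finite-to-one function.\<close>
  obtain b' where b': "a < b'" "b' \<le> b" "\<And>x. a < x \<Longrightarrow> x < b' \<Longrightarrow> finite (F x)"
  proof (cases "{x. infinite (F x)} \<inter> {a<..<b} = {}")
    case True
    then show ?thesis using ab(1) by (intro that[of b]) auto
  next
    case False
    let ?m = "Min ({x. infinite (F x)} \<inter> {a<..<b})"
    have m: "?m \<in> {x. infinite (F x)} \<inter> {a<..<b}" using Min_in[OF finF False] .
    show ?thesis
    proof (rule that[of ?m])
      fix x assume x: "a < x" "x < ?m"
      show "finite (F x)"
      proof (rule ccontr)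
        assume "infinite (F x)"
        then have "x \<in> {x. infinite (F x)} \<inter> {a<..<b}" using x m by auto
        then show False using Min_le[OF finF] x(2) leD by blast
      qed
    qed (use m in auto)
  qed
  obtain x0 where x0: "a < x0" "x0 < b'" using dense[OF b'(1)] by blast
  have "tame {y. Q x0 y}" by (rule tame_Collect) (intro dQ defterm_var defterm_const)
  then obtain l u where lu: "l < u" "{l<..<u} \<subseteq> {y. Q x0 y}"
    using tame_infinite Qinf[of x0] x0 b'(2) by (metis greaterThanLessThan_iff less_le_trans)
  \<comment> \<open>Each y in the row of \<open>x0\<close> is charged to an x between a and
    \<open>x0\<close>, hence to one with finite \<open>F x\<close>.\<close>
  have sec: "\<exists>x\<le>x0. {x. y \<in> F x} = {x} \<and> a < x" if y: "y \<in> {l<..<u}" for y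
  proof -
    obtain x where x: "x \<le> x0" "y \<in> F x" using Fex lu(2) y by blast
    moreover have "a < x" using x(2) by (simp add: F_def Q_def)
    ultimately show ?thesis using Funiq by blast
  qed
  have "def2 (\<lambda>y x. y \<in> F x)" unfolding def2_def by (intro dF defterm_var)
  moreover have "finite {x. y \<in> F x} \<and> {x. y \<in> F x} \<noteq> {}" if "y \<in> {l<..<u}" for y
    using sec[OF that] by force
  moreover have "finite {y \<in> {l<..<u}. y \<in> F x}" for x
  proof (cases "{y \<in> {l<..<u}. y \<in> F x} = {}")
    case False
    then obtain y where y: "y \<in> {l<..<u}" "y \<in> F x" by blast
    obtain x' where "x' \<le> x0" "{x. y \<in> F x} = {x'}" "a < x'" using sec y(1) by blast
    moreover from this y(2) have "x = x'" by blast
    ultimately have "a < x" "x \<le> x0" by simp_all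
    then have "finite (F x)" using b'(3)[of x] x0(2) by (auto intro: le_less_trans)
    then show ?thesis by (rule rev_finite_subset) blast
  qed (simp only: finite.emptyI)
  ultimately obtain f c d where f: "l \<le> c" "c < d" "d \<le> u" "mono_on_ioo f c d"
    "\<And>t. t \<in> {l<..<u} \<Longrightarrow> t \<in> F (f t)"
    by (rule select_monotone[OF _ lu(1)]) blast+
  obtain y where y: "c < y" "y < d" using dense[OF f(2)] by blast
  have sub: "{c<..<d} \<subseteq> {l<..<u}" using f by auto
  have "Q (f y) y" using f(5)[of y] sub y by (auto simp: F_def)
  then obtain l' u' where lu': "l' < y" "y < u'" "\<forall>z. l' < z \<and> z < u' \<longrightarrow> P (f y) z" "a < f y"
    "f y < b"
    unfolding Q_def by blast
  \<comment> \<open>For z close to y the relation \<open>Q (f y) z\<close> still holds, and f z is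
    the least element related to z. So f has a local maximum at y, against strict
    monotonicity.\<close>
  have le: "f z \<le> f y" if z: "l' < z" "z < u'" "z \<in> {c<..<d}" for z
  proof -
    have "z \<in> {l<..<u}" using z sub by blast
    then have "z \<notin> ?bad" using lu(2) unfolding Q_def by blast
    then have "Q (f y) z" unfolding Q_def using z lu' by blast
    then show ?thesis using f(5)[OF \<open>z \<in> {l<..<u}\<close>] unfolding F_def by blast
  qed
  obtain z where z: "max l' c < z" "z < y" using dense[of "max l' c" y] lu' y by auto
  obtain z' where z': "y < z'" "z' < min u' d" using dense[of y "min u' d"] lu' y by auto
  have "f z \<le> f y" by (rule le) (use z y lu' in auto)
  moreover have "f z' \<le> f y" by (rule le) (use z' y lu' in auto)
  moreover have "z \<in> {c<..<d}" "z' \<in> {c<..<d}" "y \<in> {c<..<d}" using y z z' by auto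
  ultimately show False
    using f(4) z(2) z'(1) unfolding mono_on_ioo_def by (meson leD)
qed

text \<open>Iterates "infinitely many", with the latest value at the head of the list. It stands in
  for the statement that a set of n-tuples has full dimension.\<close>

primrec inf_many :: "nat \<Rightarrow> ('a list \<Rightarrow> bool) \<Rightarrow> 'a list \<Rightarrow> bool" where
  "inf_many 0 J ys \<longleftrightarrow> J ys"
| "inf_many (Suc n) J ys \<longleftrightarrow> infinite {y. inf_many n J (y # ys)}"

lemma inf_many_mono: "(\<And>ys. J ys \<Longrightarrow> K ys) \<Longrightarrow> inf_many n J ys \<Longrightarrow> inf_many n K ys"
proof (induction n arbitrary: ys)
  case (Suc n)
  from Suc.prems(2) have "infinite {y. inf_many n J (y # ys)}" by simp
  moreover have "{y. inf_many n J (y # ys)} \<subseteq> {y. inf_many n K (y # ys)}"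
    using Suc.IH Suc.prems(1) by blast
  ultimately have "infinite {y. inf_many n K (y # ys)}" using finite_subset by blast
  then show ?case by simp
qed simp

lemma inf_many_drop:
  assumes "\<And>ys zs. set zs \<subseteq> set ys \<Longrightarrow> J ys \<Longrightarrow> J zs" "set zs \<subseteq> set ys" "inf_many n J ys"
  shows "inf_many n J zs"
  using assms(2,3)
proof (induction n arbitrary: ys zs)
  case 0
  then show ?case using assms(1) by simp
next
  case (Suc n)
  from Suc.prems(2) have "infinite {y. inf_many n J (y # ys)}" by simp
  moreover have "{y. inf_many n J (y # ys)} \<subseteq> {y. inf_many n J (y # zs)}"
  proof
    fix y assume "y \<in> {y. inf_many n J (y # ys)}"
    then show "y \<in> {y. inf_many n J (y # zs)}"
      using Suc.IH[of "y # zs" "y # ys"] Suc.prems(1) by auto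
  qed
  ultimately have "infinite {y. inf_many n J (y # zs)}" using finite_subset by blast
  then show ?case by simp
qed

definition definable_rel :: "('a list \<Rightarrow> 'a \<Rightarrow> bool) \<Rightarrow> bool" where
  "definable_rel R \<longleftrightarrow> (\<forall>k L f. deftuple k L \<longrightarrow> defterm f \<longrightarrow> defpred (\<lambda>e. R (L e) (f e)))"

lemma deftuple_ren': "deftuple n L \<Longrightarrow> deftuple n (\<lambda>e. L (\<lambda>i. e (\<rho> i)))"
  unfolding deftuple_def by (auto intro: defterm_ren)

lemma defpred_inf_many:
  assumes R: "definable_rel R"
  shows "deftuple k L \<Longrightarrow> defterm f \<Longrightarrow> defpred (\<lambda>e. inf_many n (\<lambda>ys. R ys (f e)) (L e))"
proof (induction n arbitrary: k L f)
  case 0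
  then show ?case using R by (simp add: definable_rel_def)
next
  case (Suc n)
  have "defpred (\<lambda>e. inf_many n (\<lambda>ys. R ys (f (\<lambda>i. e (Suc i)))) (e 0 # L (\<lambda>i. e (Suc i))))"
    by (rule Suc.IH[OF deftuple_Cons[OF defterm_var deftuple_ren'[OF Suc.prems(1)]] defterm_ren[OF
      Suc.prems(2)]])
  from defpred_infinite[of "\<lambda>y e. inf_many n (\<lambda>ys. R ys (f e)) (y # L e)", OF this]
  show ?case by simp
qed

text \<open>If generic tuples of length n + 1 have some a, then either one a serves generic tuples
  of that length, or infinitely many a serve generic tuples of length n. The base case is the
  pigeonhole principle. In the step the alternatives are sorted by the first entry y, and the second
  one is turned around by \<open>infinite_swap\<close>.\<close>

lemma inf_many_exchange:
  assumes R: "definable_rel R" and anti: "\<And>ys zs a. set zs \<subseteq> set ys \<Longrightarrow> R ys a \<Longrightarrow> R zs a"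
  shows "inf_many (Suc n) (\<lambda>ys. \<exists>a. R ys a) ys0 \<Longrightarrow>
    (\<exists>a. inf_many (Suc n) (\<lambda>ys. R ys a) ys0) \<or> infinite {a. inf_many n (\<lambda>ys. R ys a) ys0}"
proof (induction n arbitrary: ys0)
  case (0 ys0)
  show ?case
  proof (rule ccontr)
    assume neg: "\<not> ?case"
    have "{y. \<exists>a. R (y # ys0) a} \<subseteq> (\<Union>a\<in>{a. R ys0 a}. {y. R (y # ys0) a})"
    proof
      fix y assume "y \<in> {y. \<exists>a. R (y # ys0) a}"
      then obtain a where a: "R (y # ys0) a" by blast
      then have "R ys0 a" by (rule anti[rotated]) auto
      with a show "y \<in> (\<Union>a\<in>{a. R ys0 a}. {y. R (y # ys0) a})" by blast
    qed
    moreover have "finite (\<Union>a\<in>{a. R ys0 a}. {y. R (y # ys0) a})" using neg by simp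
    ultimately have "finite {y. \<exists>a. R (y # ys0) a}" using finite_subset by blast
    with 0 show False by simp
  qed
next
  case (Suc n ys0)
  let ?A = "\<lambda>y a. inf_many (Suc n) (\<lambda>ys. R ys a) (y # ys0)"
  let ?B = "\<lambda>y a. inf_many n (\<lambda>ys. R ys a) (y # ys0)"
  let ?YA = "{y. \<exists>a. ?A y a}" and ?YB = "{y. infinite {a. ?B y a}}"
  have "{y. inf_many (Suc n) (\<lambda>ys. \<exists>a. R ys a) (y # ys0)} \<subseteq> ?YA \<union> ?YB"
    using Suc.IH by blast
  moreover have "infinite {y. inf_many (Suc n) (\<lambda>ys. \<exists>a. R ys a) (y # ys0)}"
    using Suc.prems by simp
  ultimately have "infinite ?YA \<or> infinite ?YB" by (metis finite_Un finite_subset)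
  then show ?case
  proof
    assume inf: "infinite ?YA"
    show ?case
    proof (rule ccontr)
      assume neg: "\<not> ?case"
      have "inf_many (Suc n) (\<lambda>ys. R ys a) ys0" if "?A y a" for y a
        by (rule inf_many_drop[OF _ _ that]) (use anti in auto)
      then have "?YA \<subseteq> (\<Union>a\<in>{a. inf_many (Suc n) (\<lambda>ys. R ys a) ys0}. {y. ?A y a})" by blast
      moreover have "finite {y. ?A y a}" for a using neg by auto
      moreover have "finite {a. inf_many (Suc n) (\<lambda>ys. R ys a) ys0}" using neg by blast
      ultimately show False using inf finite_subset by (metis (no_types, lifting) finite_UN_I)
    qed
  next
    assume inf: "infinite ?YB"
    have "def2 ?B"
      unfolding def2_def
      by (rule defpred_inf_many[OF R deftuple_Cons[OF defterm_var deftuple_const[OF refl]]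
        defterm_var])
    from infinite_swap[OF this inf] show ?case by simp
  qed
qed

text \<open>This weak form of additivity of dimension takes the place of uniform finiteness in several
  parameters, which would require cell decomposition.\<close>

lemma finite_family_inf_many:
  assumes "\<And>L f. deftuple k L \<Longrightarrow> defterm f \<Longrightarrow> defpred (\<lambda>e. D (L e) (f e))"
    and "\<And>u. length u = k \<Longrightarrow> finite {y. D u y}"
  shows "\<not> inf_many (Suc k) (\<lambda>ys. \<exists>u. length u = k \<and> (\<forall>y\<in>set ys. D u y)) []"
  using assms
proof (induction k arbitrary: D)
  case 0
  then show ?case by simp
next
  case (Suc k D)
  \<comment> \<open>The first of the \<open>Suc k\<close> parameters is split off; it is the value
    to be exchanged.\<close>
  define R where "R ys a \<longleftrightarrow> (\<exists>u. length u = k \<and> (\<forall>y\<in>set ys. D (a # u) y))" for ys a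
  have R: "definable_rel R"
    unfolding definable_rel_def
  proof (intro allI impI)
    fix m L f assume L: "deftuple m L" and f: "defterm f"
    have len: "length (L e) = m" for e using L by (simp add: deftuple_def)
    have "defpred (\<lambda>e. \<exists>u. length u = k \<and> (\<forall>i<m. D (f e # u) (L e ! i)))"
    proof (rule defpred_ex_list, rule defpred_fin_all, rule Suc.prems(1))
      fix i assume "i < m"
      then have "defterm (\<lambda>e. L e ! i)" using L by (simp add: deftuple_def)
      then show "defterm (\<lambda>e. L (\<lambda>i. e (i + k)) ! i)" by (rule defterm_ren)
      show "deftuple (Suc k) (\<lambda>e. f (\<lambda>i. e (i + k)) # map e [0..<k])"
        by (intro deftuple_Cons deftuple_vars defterm_ren[OF f])
    qed
    then show "defpred (\<lambda>e. R (L e) (f e))"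
      unfolding R_def all_set_conv_all_nth len .
  qed
  have anti: "R zs a" if "set zs \<subseteq> set ys" "R ys a" for ys zs a
    using that unfolding R_def by blast
  have noR: "\<not> inf_many (Suc k) (\<lambda>ys. R ys a) []" for a
    unfolding R_def
  proof (rule Suc.IH)
    show "defpred (\<lambda>e. D (a # L e) (f e))" if "deftuple k L" "defterm f" for L f
      by (intro Suc.prems(1) deftuple_Cons defterm_const that)
    show "finite {y. D (a # u) y}" if "length u = k" for u
      using Suc.prems(2) that by simp
  qed
  show ?case
  proof
    assume *: "inf_many (Suc (Suc k)) (\<lambda>ys. \<exists>u. length u = Suc k \<and> (\<forall>y\<in>set ys. D u y)) []"
    have "inf_many (Suc (Suc k)) (\<lambda>ys. \<exists>a. R ys a) []"
      by (rule inf_many_mono[OF _ *]) (auto simp: R_def length_Suc_conv)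
    \<comment> \<open>Either outcome yields a fixed a for which the remaining k parameters would
      capture generic tuples of \<open>Suc k\<close> points, against \<open>noR\<close>.\<close>
    from inf_many_exchange[OF R _ this] anti
    consider a where "inf_many (Suc (Suc k)) (\<lambda>ys. R ys a) []"
      | "infinite {a. inf_many (Suc k) (\<lambda>ys. R ys a) []}" by blast
    then show False
    proof cases
      case (1 a)
      then have "infinite {y. inf_many (Suc k) (\<lambda>ys. R ys a) [y]}" by simp
      then obtain y where "inf_many (Suc k) (\<lambda>ys. R ys a) [y]"
        using not_finite_existsD by blast
      then have "inf_many (Suc k) (\<lambda>ys. R ys a) []"
        by (rule inf_many_drop[rotated 2]) (use anti in auto)
      then show False using noR by blast
    next
      case 2
      then show False using noR by simp
    qed
  qed
qed

lemma inf_many_all: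
  assumes "infinite I" "\<And>ys. set ys \<subseteq> I \<Longrightarrow> J ys" "set zs \<subseteq> I"
  shows "inf_many n J zs"
  using assms(3)
proof (induction n arbitrary: zs)
  case 0
  then show ?case using assms(2) by simp
next
  case (Suc n)
  then have "I \<subseteq> {y. inf_many n J (y # zs)}" by auto
  then show ?case using assms(1) finite_subset by auto
qed

text \<open>Y is a finite test set, uniform in u. If every finite part of I were contained in some
  \<open>D u\<close>, the points of I alone would satisfy \<open>Suc k\<close> nested "infinitely
  many" quantifiers.\<close>

lemma no_finite_covering_family:
  assumes "\<And>L f. deftuple k L \<Longrightarrow> defterm f \<Longrightarrow> defpred (\<lambda>e. D (L e) (f e))"
    and "\<And>u. length u = k \<Longrightarrow> finite {y. D u y}" "infinite I"
  obtains Y where "finite Y" "Y \<subseteq> I" "\<And>u. length u = k \<Longrightarrow> \<exists>y\<in>Y. \<not> D u y"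
proof -
  have "\<exists>ys. set ys \<subseteq> I \<and> \<not> (\<exists>u. length u = k \<and> (\<forall>y\<in>set ys. D u y))"
  proof (rule ccontr)
    assume neg: "\<not> ?thesis"
    have "inf_many (Suc k) (\<lambda>ys. \<exists>u. length u = k \<and> (\<forall>y\<in>set ys. D u y)) []"
      by (rule inf_many_all[OF assms(3)]) (use neg in auto)
    moreover have "\<not> inf_many (Suc k) (\<lambda>ys. \<exists>u. length u = k \<and> (\<forall>y\<in>set ys. D u y)) []"
      by (rule finite_family_inf_many) (fact assms)+
    ultimately show False by blast
  qed
  then obtain ys where "set ys \<subseteq> I" "\<not> (\<exists>u. length u = k \<and> (\<forall>y\<in>set ys. D u y))" by blast
  then show ?thesis by (intro that[of "set ys"]) auto
qed

end

section \<open>Germs in a Hausdorff space\<close>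

text \<open>The topology lives on \<open>X \<subseteq> R\<close> rather than on lists of length one; \<open>Om \<subseteq> R\<^sup>k\<close> indexes the
  definable basis.\<close>

locale hausdorff_line = omin_line M for M :: "('f, 'r, 'a::unbounded_dense_linorder) expansion" +
  fixes X :: "'a set" and opn :: "'a set \<Rightarrow> bool" and k :: nat
    and Om :: "'a list set" and Bas :: "'a list \<Rightarrow> 'a set"
  assumes tame_X: "tame X"
    and opn_X: "opn X"
    and opn_sub: "opn U \<Longrightarrow> U \<subseteq> X"
    and opn_Int: "opn U \<Longrightarrow> opn V \<Longrightarrow> opn (U \<inter> V)"
    and opn_local: "(\<And>x. x \<in> U \<Longrightarrow> \<exists>V. opn V \<and> x \<in> V \<and> V \<subseteq> U) \<Longrightarrow> opn U"
    and opn_Bas: "u \<in> Om \<Longrightarrow> opn (Bas u)"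
    and Bas_ex: "opn U \<Longrightarrow> x \<in> U \<Longrightarrow> \<exists>u\<in>Om. x \<in> Bas u \<and> Bas u \<subseteq> U"
    and Om_length: "u \<in> Om \<Longrightarrow> length u = k"
    and defpred_Om: "deftuple k L \<Longrightarrow> defpred (\<lambda>e. L e \<in> Om)"
    and defpred_Bas: "deftuple k L \<Longrightarrow> defterm f \<Longrightarrow> defpred (\<lambda>e. L e \<in> Om \<and> f e \<in> Bas (L e))"
    and separate: "x \<in> X \<Longrightarrow> y \<in> X \<Longrightarrow> x \<noteq> y \<Longrightarrow> \<exists>U V. opn U \<and> opn V \<and> x \<in> U \<and> y \<in> V \<and> U \<inter> V = {}"
begin

definition conv :: "'a germ \<Rightarrow> 'a \<Rightarrow> bool" where
  "conv g x \<longleftrightarrow> x \<in> X \<and> (\<forall>U. opn U \<and> x \<in> U \<longrightarrow> ev g U)"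

definition cl :: "'a set \<Rightarrow> 'a set" where
  "cl A = {y\<in>X. \<forall>V. opn V \<and> y \<in> V \<longrightarrow> V \<inter> A \<noteq> {}}"

text \<open>Testing on the basis alone turns convergence into a first-order condition;
  \<open>cl_Bas\<close> does the same for closures.\<close>

lemma conv_Bas: "conv g x \<longleftrightarrow> x \<in> X \<and> (\<forall>u. u \<in> Om \<and> x \<in> Bas u \<longrightarrow> ev g (Bas u))"
proof
  assume *: "x \<in> X \<and> (\<forall>u. u \<in> Om \<and> x \<in> Bas u \<longrightarrow> ev g (Bas u))"
  have "ev g U" if "opn U" "x \<in> U" for U
    using Bas_ex[OF that] * ev_mono by blast
  with * show "conv g x" by (simp add: conv_def)
qed (auto simp: conv_def intro: opn_Bas)

lemma conv_ev_X: "conv g x \<Longrightarrow> ev g X" "conv g x \<Longrightarrow> x \<in> X"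
  unfolding conv_def using opn_X by blast+

lemma cl_Bas: "y \<in> cl A \<longleftrightarrow> y \<in> X \<and> (\<forall>u. u \<in> Om \<and> y \<in> Bas u \<longrightarrow> (\<exists>z. z \<in> Bas u \<and> z \<in> A))"
proof
  assume *: "y \<in> X \<and> (\<forall>u. u \<in> Om \<and> y \<in> Bas u \<longrightarrow> (\<exists>z. z \<in> Bas u \<and> z \<in> A))"
  have "V \<inter> A \<noteq> {}" if "opn V" "y \<in> V" for V
    using Bas_ex[OF that] * by blast
  with * show "y \<in> cl A" by (simp add: cl_def)
next
  assume "y \<in> cl A"
  then have y: "y \<in> X" "\<And>V. opn V \<Longrightarrow> y \<in> V \<Longrightarrow> V \<inter> A \<noteq> {}" unfolding cl_def by auto
  have "\<exists>z. z \<in> Bas u \<and> z \<in> A" if "u \<in> Om" "y \<in> Bas u" for u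
    using y(2)[OF opn_Bas] that by blast
  with y(1) show "y \<in> X \<and> (\<forall>u. u \<in> Om \<and> y \<in> Bas u \<longrightarrow> (\<exists>z. z \<in> Bas u \<and> z \<in> A))" by blast
qed

lemma opn_compl_cl: "opn (X - cl A)"
proof (rule opn_local)
  fix x assume "x \<in> X - cl A"
  then obtain V where V: "opn V" "x \<in> V" "V \<inter> A = {}" unfolding cl_def by blast
  then have "V \<subseteq> X - cl A" using opn_sub[OF V(1)] unfolding cl_def by blast
  with V show "\<exists>V. opn V \<and> x \<in> V \<and> V \<subseteq> X - cl A" by blast
qed

lemma subset_cl: "A \<subseteq> X \<Longrightarrow> A \<subseteq> cl A"
  unfolding cl_def by blast

lemma conv_cl: "conv g y \<Longrightarrow> ev g A \<Longrightarrow> y \<in> cl A"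
  unfolding conv_def cl_def using ev_meets by blast

lemma conv_unique:
  assumes "conv g x" "conv g y"
  shows "x = y"
proof (rule ccontr)
  assume "x \<noteq> y"
  then obtain U V where "opn U" "opn V" "x \<in> U" "y \<in> V" "U \<inter> V = {}"
    using separate assms unfolding conv_def by blast
  then show False using assms ev_meets[of g U V] unfolding conv_def by blast
qed

lemma conv_Pt: "conv (Pt y) x \<longleftrightarrow> x = y \<and> x \<in> X"
proof
  assume *: "conv (Pt y) x"
  have "y \<in> X" using conv_ev_X(1)[OF *] by simp
  then have "conv (Pt y) y" by (simp add: conv_def)
  then show "x = y \<and> x \<in> X" using conv_unique[OF *] \<open>y \<in> X\<close> by blast
qed (auto simp: conv_def)

lemma tame_Bas: "u \<in> Om \<Longrightarrow> tame (Bas u)"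
  unfolding tame_def using defpred_Bas[OF deftuple_const[OF Om_length] defterm_var, of u 0] by simp

lemma defpred_conv:
  assumes K: "defgerm K" and f: "defterm f"
  shows "defpred (\<lambda>e. conv (K e) (f e))"
proof -
  have "defpred (\<lambda>e. f e \<in> X \<and> (\<forall>u. length u = k \<longrightarrow> (u \<in> Om \<and> f e \<in> Bas u \<longrightarrow> ev (K e) {r. u \<in> Om \<and>
      r \<in> Bas u})))"
    by (intro defpred_conj defpred_tame[OF tame_X f] defpred_all_list defpred_imp defpred_ev
      defpred_Bas deftuple_vars deftuple_ren defgerm_ren[OF K]
        defterm_ren[OF f] defterm_var)
  moreover have "conv (K e) (f e) \<longleftrightarrow> f e \<in> X \<and> (\<forall>u. length u = k \<longrightarrow>
      (u \<in> Om \<and> f e \<in> Bas u \<longrightarrow> ev (K e) {r. u \<in> Om \<and> r \<in> Bas u}))" for e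
    unfolding conv_Bas using Om_length by auto
  ultimately show ?thesis by simp
qed

text \<open>Curve selection: the traces on F of the basic neighbourhoods of x form a directed
  definable family, and a germ contained in all of them lies in F and converges to x.\<close>

lemma cl_germ:
  assumes F: "tame F" and x: "x \<in> cl F"
  shows "\<exists>g. ev g F \<and> conv g x"
proof -
  have xX: "x \<in> X" using x by (simp add: cl_def)
  define \<F> where "\<F> = (\<lambda>u. Bas u \<inter> F) ` {u\<in>Om. x \<in> Bas u}"
  have "\<exists>g. \<forall>A\<in>\<F>. ev g A"
  proof (rule directed_germ)
    fix A assume "A \<in> \<F>"
    then obtain u where u: "u \<in> Om" "x \<in> Bas u" "A = Bas u \<inter> F" unfolding \<F>_def by blast
    then show "tame A" using tame_Int[OF tame_Bas F] by blast
    show "A \<noteq> {}" using x opn_Bas[OF u(1)] u(2,3) unfolding cl_def by blast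
  next
    fix A B assume "A \<in> \<F>" "B \<in> \<F>"
    then obtain u v where uv: "u \<in> Om" "x \<in> Bas u" "A = Bas u \<inter> F" "v \<in> Om" "x \<in> Bas v"
      "B = Bas v \<inter> F"
      unfolding \<F>_def by blast
    obtain w where w: "w \<in> Om" "x \<in> Bas w" "Bas w \<subseteq> Bas u \<inter> Bas v"
      using Bas_ex[OF opn_Int[OF opn_Bas[OF uv(1)] opn_Bas[OF uv(4)]], of x] uv(2,5) by auto
    then have "Bas w \<inter> F \<in> \<F>" unfolding \<F>_def by blast
    moreover have "Bas w \<inter> F \<subseteq> A \<inter> B" using w(3) uv by auto
    ultimately show "\<exists>C\<in>\<F>. C \<subseteq> A \<inter> B" by blast
  next
    have "defpred (\<lambda>e. \<exists>u. length u = k \<and> ((u \<in> Om \<and> x \<in> Bas u) \<and> (\<forall>y. (u \<in> Om \<and> y \<in> Bas u) \<and>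
        y \<in> F \<longrightarrow> e 0 \<le> y)))"
      by (intro defpred_rules defpred_ex_list defpred_Bas deftuple_vars deftuple_ren defpred_tame[OF
        F])
    moreover have "s \<in> {s. \<exists>A\<in>\<F>. A \<subseteq> {s..}} \<longleftrightarrow>
        (\<exists>u. length u = k \<and> ((u \<in> Om \<and> x \<in> Bas u) \<and> (\<forall>y. (u \<in> Om \<and> y \<in> Bas u) \<and> y \<in> F \<longrightarrow>
          s \<le> y)))" for s
      unfolding \<F>_def using Om_length by auto
    ultimately show "tame {s. \<exists>A\<in>\<F>. A \<subseteq> {s..}}" unfolding tame_def by simp
  qed
  then obtain g where g: "\<And>u. u \<in> Om \<Longrightarrow> x \<in> Bas u \<Longrightarrow> ev g (Bas u \<inter> F)" unfolding \<F>_def by blast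
  then have "conv g x" unfolding conv_Bas using xX by (simp add: ev_Int_iff)
  moreover have "ev g F" using Bas_ex[OF opn_X xX] g by (auto simp: ev_Int_iff)
  ultimately show ?thesis by blast
qed

text \<open>By \<open>cl_germ\<close>, a point of U in the closure of the complement would be the
  limit of a germ of the complement.\<close>

lemma opn_by_germs:
  assumes U: "tame U" "U \<subseteq> X" and germs: "\<And>x g. x \<in> U \<Longrightarrow> conv g x \<Longrightarrow> ev g U"
  shows "opn U"
proof -
  have "cl (X - U) \<subseteq> X - U"
  proof
    fix x assume x: "x \<in> cl (X - U)"
    then obtain g where g: "ev g (X - U)" "conv g x" using cl_germ[OF tame_Diff[OF tame_X U(1)]]
      by blast
    then have "x \<notin> U" using germs ev_meets[of g U "X - U"] by blast
    then show "x \<in> X - U" using x by (simp add: cl_def)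
  qed
  then have "cl (X - U) = X - U" using subset_cl[of "X - U"] by blast
  then have "X - cl (X - U) = U" using U(2) by blast
  then show ?thesis using opn_compl_cl[of "X - U"] by simp
qed

lemma ev_not_finite:
  fixes A :: "'a set"
  assumes "finite A" "\<And>x. g \<noteq> Pt x"
  shows "ev g (- A)"
proof (rule ccontr)
  assume "\<not> ev g (- A)"
  then have "ev g A" using not_ev[OF tame_compl[OF tame_finite[OF assms(1)]]] by simp
  then show False using ev_infinite[OF _ assms(2)] finite_subset[OF _ assms(1)] infinite_Ioo
    by blast
qed

text \<open>If these sides converged to x for all points of an interval, every basic neighbourhood
  of x would contain all but finitely many points of that interval. A finite test set would then
  meet all of them, yet the Hausdorff property gives a neighbourhood that avoids it.\<close>

lemma finite_conv:
  assumes \<sigma>: "\<sigma> \<in> {Rgt, Lft}"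
  shows "finite {t. conv (\<sigma> t) x}"
proof (rule ccontr)
  assume inf: "infinite {t. conv (\<sigma> t) x}"
  have defgerm_\<sigma>: "defgerm (\<lambda>e. \<sigma> (e i))" for i using \<sigma> by (auto intro: defgerm_intros defterm_var)
  have "infinite ({t. conv (\<sigma> t) x} - {x})" using inf by simp
  moreover have "tame {t. conv (\<sigma> t) x}" by (rule tame_Collect) (intro defpred_conv defgerm_\<sigma>
    defterm_const)
  ultimately obtain a b where ab: "a < b" "{a<..<b} \<subseteq> {t. conv (\<sigma> t) x} - {x}"
    using tame_infinite tame_Diff tame_singleton by metis
  \<comment> \<open>The part of the interval that the neighbourhood \<open>Bas u\<close> of x
    misses; it is empty if \<open>Bas u\<close> is no neighbourhood of x.\<close>
  define D where "D u y \<longleftrightarrow> a < y \<and> y < b \<and> (u \<in> Om \<and> x \<in> Bas u) \<and> \<not> (u \<in> Om \<and> y \<in> Bas u)" for u y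
  have fin: "finite {y. D u y}" for u
  proof (cases "u \<in> Om \<and> x \<in> Bas u")
    case True
    have "finite ({a<..<b} - Bas u)"
    proof (rule ccontr)
      assume "infinite ({a<..<b} - Bas u)"
      then obtain c d where cd: "c < d" "{c<..<d} \<subseteq> {a<..<b} - Bas u"
        using tame_infinite[OF tame_Diff[OF tame_ioo tame_Bas]] True by metis
      obtain t where t: "c < t" "t < d" using dense[OF cd(1)] by blast
      then have "t \<in> {a<..<b}" using cd(2) by auto
      then have "conv (\<sigma> t) x" using ab(2) by blast
      then have "ev (\<sigma> t) (Bas u)" using True unfolding conv_Bas by blast
      moreover have "ev (\<sigma> t) {c<..<d}" using ev_near[OF t] \<sigma> by auto
      ultimately show False using ev_meets cd(2) by blast
    qed
    then show ?thesis by (rule rev_finite_subset) (auto simp: D_def)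
  qed (simp add: D_def)
  have dpD: "defpred (\<lambda>e. D (L e) (f e))" if "deftuple k L" "defterm f" for L f
    unfolding D_def by (intro defpred_rules defpred_Bas that)
  obtain Y where Y: "finite Y" "Y \<subseteq> {a<..<b}" "\<And>u. length u = k \<Longrightarrow> \<exists>y\<in>Y. \<not> D u y"
    using no_finite_covering_family[of k D, OF dpD fin infinite_Ioo[OF ab(1)]] by blast
  have "\<exists>U. opn U \<and> x \<in> U \<and> U \<inter> Y = {}"
    using Y(1,2)
  proof (induction Y rule: finite_induct)
    case empty
    obtain t where "t \<in> {a<..<b}" using dense[OF ab(1)] by auto
    then show ?case using opn_X ab(2) conv_ev_X(2) by blast
  next
    case (insert y Y)
    from insert.prems have y: "y \<in> {a<..<b}" and "Y \<subseteq> {a<..<b}" by auto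
    then obtain U where U: "opn U" "x \<in> U" "U \<inter> Y = {}" using insert.IH by blast
    have "x \<noteq> y" using y ab(2) by blast
    show ?case
    proof (cases "y \<in> X")
      case True
      then obtain V W where "opn V" "opn W" "x \<in> V" "y \<in> W" "V \<inter> W = {}"
        using separate[of x y] U(2) opn_sub[OF U(1)] \<open>x \<noteq> y\<close> by blast
      then show ?thesis using U opn_Int[of U V] by (intro exI[of _ "U \<inter> V"]) auto
    next
      case False
      then show ?thesis using U opn_sub[OF U(1)] by (intro exI[of _ U]) auto
    qed
  qed
  then obtain U where U: "opn U" "x \<in> U" "U \<inter> Y = {}" by blast
  then obtain u where u: "u \<in> Om" "x \<in> Bas u" "Bas u \<subseteq> U" using Bas_ex by blast
  then obtain y where "y \<in> Y" "\<not> D u y" using Y(3)[OF Om_length] by blast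
  then show False using u U(3) Y(2) unfolding D_def by auto
qed

section \<open>Points, the limits of their sides, and points that share a limit\<close>

definition tends :: "'a \<Rightarrow> 'a \<Rightarrow> bool" where
  "tends t x \<longleftrightarrow> conv (Rgt t) x \<or> conv (Lft t) x"

lemma tendsI: "\<sigma> \<in> {Rgt, Lft} \<Longrightarrow> conv (\<sigma> t) x \<Longrightarrow> tends t x"
  unfolding tends_def by auto

lemma defpred_tends: "defterm f \<Longrightarrow> defterm g \<Longrightarrow> defpred (\<lambda>e. tends (f e) (g e))"
  unfolding tends_def by (intro defpred_disj defpred_conv defgerm_intros)

lemma finite_tends_src: "finite {t. tends t x}"
  using finite_conv[of Rgt x] finite_conv[of Lft x] unfolding tends_def Collect_disj_eq by simp

lemma finite_conv_tgt: "finite {x. conv g x}"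
proof (cases "{x. conv g x} = {}")
  case False
  then obtain x where "conv g x" by blast
  then have "{x. conv g x} \<subseteq> {x}" using conv_unique by blast
  then show ?thesis using finite_subset by blast
qed simp

lemma finite_tends_tgt: "finite {x. tends t x}"
  unfolding tends_def Collect_disj_eq by (simp add: finite_conv_tgt)

definition tied :: "'a \<Rightarrow> 'a \<Rightarrow> bool" where
  "tied q a \<longleftrightarrow> q = a \<or> (\<exists>x. tends q x \<and> tends a x)"

lemma tied_sym: "tied q a \<longleftrightarrow> tied a q"
  unfolding tied_def by blast

lemma defpred_tied: "defterm f \<Longrightarrow> defterm g \<Longrightarrow> defpred (\<lambda>e. tied (f e) (g e))"
  unfolding tied_def by (intro defpred_rules defpred_tends defterm_ren[of f Suc] defterm_ren[of g
    Suc])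

lemma finite_tied: "finite {a. tied q a}"
proof -
  have "{a. tied q a} \<subseteq> {q} \<union> (\<Union>x\<in>{x. tends q x}. {a. tends a x})"
    unfolding tied_def by blast
  moreover have "finite ({q} \<union> (\<Union>x\<in>{x. tends q x}. {a. tends a x}))"
    using finite_tends_src finite_tends_tgt by blast
  ultimately show ?thesis using finite_subset by blast
qed

text \<open>At a torn point, saturating an interval under \<open>tied\<close> would not give an open set.\<close>

definition torn :: "'a \<Rightarrow> 'a \<Rightarrow> bool" where
  "torn t a \<longleftrightarrow> tied t a \<and> (\<exists>l u. l < a \<and> a < u \<and>
    \<not> (ev (Rgt t) {q. \<exists>a'. (l < a' \<and> a' < u) \<and> tied q a'} \<and> ev (Lft t) {q. \<exists>a'. (l < a' \<and> a' < u) \<and>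
      tied q a'}))"

lemma def2_torn: "def2 torn"
  unfolding def2_def torn_def by (intro defpred_rules defpred_ev defgerm_intros defpred_tied)

text \<open>If U were absent from g, the points close to g would lie outside U together with both of
  their sides.\<close>

lemma ev_sides_imp:
  fixes g :: "'a germ" and \<sigma> :: "'a \<Rightarrow> 'a germ"
  assumes "ev g {r. ev (\<sigma> r) U}" "\<And>x. g \<noteq> Pt x" "\<sigma> \<in> {Rgt, Lft}" "tame U"
  shows "ev g U"
proof (rule ccontr)
  assume "\<not> ev g U"
  then have "ev g (- U)" using not_ev[OF assms(4)] by blast
  then have "ev g ({r. ev (\<sigma> r) U} \<inter> - U)" using assms(1) by (simp add: ev_Int_iff)
  then obtain s where s: "side g s" "nbd g s \<subseteq> {r. ev (\<sigma> r) U} \<inter> - U" unfolding ev_def by blast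
  obtain r where r: "r \<in> nbd g s" using nbd_nonempty[OF s(1)] by blast
  have "ev (\<sigma> r) (nbd g s)" using ev_nbd_sides[OF assms(2) r] assms(3) by auto
  then have "ev (\<sigma> r) (- U)" using s(2) ev_mono by blast
  moreover have "ev (\<sigma> r) U" using r s(2) by blast
  ultimately show False using ev_meets by blast
qed

lemma ev_imp_sides:
  fixes g :: "'a germ" and \<sigma> :: "'a \<Rightarrow> 'a germ"
  assumes "ev g U" "\<And>x. g \<noteq> Pt x" "\<sigma> \<in> {Rgt, Lft}"
  shows "ev g {r. ev (\<sigma> r) U}"
proof -
  obtain s where s: "side g s" "nbd g s \<subseteq> U" using assms(1) unfolding ev_def by blast
  have "nbd g s \<subseteq> {r. ev (\<sigma> r) U}"
  proof
    fix r assume "r \<in> nbd g s"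
    then have "ev (\<sigma> r) (nbd g s)" using ev_nbd_sides[OF assms(2)] assms(3) by auto
    then show "r \<in> {r. ev (\<sigma> r) U}" using ev_mono s(2) by blast
  qed
  then show ?thesis using s(1) unfolding ev_def by blast
qed

lemma local_homeo_forward:
  "local_homeo f p \<Longrightarrow> \<tau> \<in> {Rgt, Lft} \<Longrightarrow> \<exists>\<tau>'\<in>{Rgt, Lft}. \<forall>U. ev (\<tau> (f p)) U \<longrightarrow> ev (\<tau>' p) {r. f r \<in> U}"
  unfolding local_homeo_def by auto

lemma local_homeo_backward:
  "local_homeo f p \<Longrightarrow> \<tau> \<in> {Rgt, Lft} \<Longrightarrow> \<exists>\<tau>'\<in>{Rgt, Lft}. \<forall>U. ev (\<tau>' (f p)) U \<longrightarrow> ev (\<tau> p) {r. f r \<in> U}"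
  unfolding local_homeo_def by auto

text \<open>On an interval of torn points a point \<open>f t\<close> tied to t is selected. Where f
  is a local homeomorphism, points near p are tied to points near \<open>f p\<close>, so p is not
  torn at \<open>f p\<close>.\<close>

lemma finite_torn: "finite {t. \<exists>a. torn t a}"
proof (rule ccontr)
  assume inf: "\<not> ?thesis"
  have "tame {t. \<exists>a. torn t a}" by (rule tame_Collect) (intro defpred_rules defpred_rel2[OF
    def2_torn])
  then obtain a b where ab: "a < b" "{a<..<b} \<subseteq> {t. \<exists>a. torn t a}" using tame_infinite inf by blast
  have 1: "finite {x. torn t x} \<and> {x. torn t x} \<noteq> {}" if "t \<in> {a<..<b}" for t
  proof
    show "finite {x. torn t x}" by (rule finite_subset[OF _ finite_tied[of t]]) (auto simp:
      torn_def)
    show "{x. torn t x} \<noteq> {}" using ab(2) that by blast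
  qed
  have 2: "finite {t\<in>{a<..<b}. torn t x}" for x
    by (rule finite_subset[OF _ finite_tied[of x]]) (auto simp: torn_def tied_sym)
  obtain p f where p: "p \<in> {a<..<b}" "local_homeo f p" and f: "\<forall>t\<in>{a<..<b}. torn t (f t)"
    by (rule select_local_homeo[OF def2_torn ab(1) 1 2])
  obtain l u where lu: "l < f p" "f p < u"
    and no: "\<not> (ev (Rgt p) {q. \<exists>a'. (l < a' \<and> a' < u) \<and> tied q a'} \<and> ev (Lft p) {q. \<exists>a'. (l < a' \<and>
        a' < u) \<and> tied q a'})"
    using bspec[OF f p(1)] unfolding torn_def by blast
  have "ev (\<tau> p) {q. \<exists>a'. (l < a' \<and> a' < u) \<and> tied q a'}" if \<tau>: "\<tau> \<in> {Rgt, Lft}" for \<tau>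
  proof -
    obtain \<tau>' where \<tau>': "\<tau>' \<in> {Rgt, Lft}" "\<forall>U. ev (\<tau>' (f p)) U \<longrightarrow> ev (\<tau> p) {r. f r \<in> U}"
      using local_homeo_backward[OF p(2) \<tau>] by blast
    have "ev (\<tau>' (f p)) {l<..<u}" using ev_near[OF lu] \<tau>'(1) by auto
    then have "ev (\<tau> p) {r. f r \<in> {l<..<u}}" using \<tau>'(2) by blast
    moreover have "ev (\<tau> p) {a<..<b}" using ev_near[of a p b] p(1) \<tau> by auto
    ultimately have "ev (\<tau> p) ({r. f r \<in> {l<..<u}} \<inter> {a<..<b})" by (simp add: ev_Int_iff)
    then show ?thesis by (rule ev_mono) (use f in \<open>auto simp: torn_def\<close>)
  qed
  then show False using no by blast
qed

end

section \<open>Generic points and saturated open sets of a regular space\<close>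

locale regular_line = hausdorff_line M X opn k Om Bas
  for M :: "('f, 'r, 'a::unbounded_dense_linorder) expansion" and X opn k Om Bas +
  assumes regular: "opn U \<Longrightarrow> x \<in> U \<Longrightarrow> \<exists>V. opn V \<and> x \<in> V \<and> cl V \<subseteq> U"
begin

lemma regular_Bas:
  assumes "opn U" "x \<in> U"
  obtains v where "v \<in> Om" "x \<in> Bas v" "cl (Bas v) \<subseteq> U"
proof -
  obtain V where V: "opn V" "x \<in> V" "cl V \<subseteq> U" using regular[OF assms] by blast
  then obtain v where v: "v \<in> Om" "x \<in> Bas v" "Bas v \<subseteq> V" using Bas_ex by blast
  then have "cl (Bas v) \<subseteq> cl V" unfolding cl_def by blast
  with v V that show ?thesis by blast
qed

text \<open>On an interval of exceptions let f t be the limit of the side \<open>\<sigma>\<close> of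
  t, and let f be a local homeomorphism at p. Near p, points r and their limits \<open>f r\<close>
  approach the same y: if the \<open>f r\<close> lie in a neighbourhood of y, so do the sides of r
  and hence r itself; the converse uses regularity.\<close>

lemma finite_unbalanced:
  assumes \<sigma>: "\<sigma> \<in> {Rgt, Lft}"
  shows "finite {p. \<exists>x. conv (\<sigma> p) x \<and> \<not> (\<forall>y. tends x y \<longleftrightarrow> tends p y)}"
proof (rule ccontr)
  assume inf: "\<not> ?thesis"
  have defgerm_\<sigma>: "defgerm (\<lambda>e. \<sigma> (e i))" for i using \<sigma> by (auto intro: defgerm_intros defterm_var)
  let ?R = "\<lambda>p x. conv (\<sigma> p) x \<and> \<not> (\<forall>y. tends x y \<longleftrightarrow> tends p y)"
  have "tame {p. \<exists>x. ?R p x}" by (rule tame_Collect) (intro defpred_rules defpred_conv defpred_tends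
    defgerm_\<sigma>)
  then obtain a b where ab: "a < b" "{a<..<b} \<subseteq> {p. \<exists>x. ?R p x}" using tame_infinite inf by blast
  have 0: "def2 ?R" unfolding def2_def by (intro defpred_rules defpred_conv defpred_tends defgerm_\<sigma>)
  have 1: "finite {x. ?R t x} \<and> {x. ?R t x} \<noteq> {}" if "t \<in> {a<..<b}" for t
  proof
    show "finite {x. ?R t x}" by (rule finite_subset[OF _ finite_conv_tgt[of "\<sigma> t"]]) blast
    show "{x. ?R t x} \<noteq> {}" using ab(2) that by blast
  qed
  have 2: "finite {t\<in>{a<..<b}. ?R t x}" for x
    by (rule finite_subset[OF _ finite_conv[OF \<sigma>, of x]]) blast
  obtain p f where p: "p \<in> {a<..<b}" "local_homeo f p" and f: "\<forall>t\<in>{a<..<b}. ?R t (f t)"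
    by (rule select_local_homeo[OF 0 ab(1) 1 2])
  have near: "ev (\<tau> p) {a<..<b}" if "\<tau> \<in> {Rgt, Lft}" for \<tau>
    using ev_near[of a p b] p(1) that by auto
  have nPt: "\<tau> p \<noteq> Pt x" if "\<tau> \<in> {Rgt, Lft}" for \<tau> x using that by auto
  have "tends (f p) y \<longleftrightarrow> tends p y" for y
  proof
    assume "tends (f p) y"
    then obtain \<tau> where \<tau>: "\<tau> \<in> {Rgt, Lft}" "conv (\<tau> (f p)) y" unfolding tends_def by blast
    obtain \<tau>' where \<tau>': "\<tau>' \<in> {Rgt, Lft}" "\<forall>U. ev (\<tau> (f p)) U \<longrightarrow> ev (\<tau>' p) {r. f r \<in> U}"
      using local_homeo_forward[OF p(2) \<tau>(1)] by blast
    have "conv (\<tau>' p) y"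
      unfolding conv_Bas
    proof (intro conjI allI impI)
      show "y \<in> X" using \<tau>(2) conv_ev_X by blast
      fix u assume u: "u \<in> Om \<and> y \<in> Bas u"
      then have "ev (\<tau> (f p)) (Bas u)" using \<tau>(2) unfolding conv_Bas by blast
      then have "ev (\<tau>' p) {r. f r \<in> Bas u}" using \<tau>'(2) by blast
      with near[OF \<tau>'(1)] have "ev (\<tau>' p) ({r. f r \<in> Bas u} \<inter> {a<..<b})" by (simp add: ev_Int_iff)
      then have "ev (\<tau>' p) {r. ev (\<sigma> r) (Bas u)}"
        by (rule ev_mono) (use f u in \<open>auto simp: conv_Bas\<close>)
      then show "ev (\<tau>' p) (Bas u)" by (rule ev_sides_imp) (use nPt[OF \<tau>'(1)] \<sigma> tame_Bas u in
        blast)+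
    qed
    then show "tends p y" using tendsI[OF \<tau>'(1)] by blast
  next
    assume "tends p y"
    then obtain \<tau> where \<tau>: "\<tau> \<in> {Rgt, Lft}" "conv (\<tau> p) y" unfolding tends_def by blast
    obtain \<tau>' where \<tau>': "\<tau>' \<in> {Rgt, Lft}" "\<forall>U. ev (\<tau>' (f p)) U \<longrightarrow> ev (\<tau> p) {r. f r \<in> U}"
      using local_homeo_backward[OF p(2) \<tau>(1)] by blast
    have "conv (\<tau>' (f p)) y"
      unfolding conv_Bas
    proof (intro conjI allI impI)
      show "y \<in> X" using \<tau>(2) conv_ev_X by blast
      fix u assume u: "u \<in> Om \<and> y \<in> Bas u"
      then obtain v where v: "v \<in> Om" "y \<in> Bas v" "cl (Bas v) \<subseteq> Bas u" using regular_Bas opn_Bas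
        by metis
      then have "ev (\<tau> p) (Bas v)" using \<tau>(2) unfolding conv_Bas by blast
      then have "ev (\<tau> p) {r. ev (\<sigma> r) (Bas v)}"
        by (rule ev_imp_sides) (use nPt[OF \<tau>(1)] \<sigma> in blast)+
      with near[OF \<tau>(1)] have "ev (\<tau> p) ({r. ev (\<sigma> r) (Bas v)} \<inter> {a<..<b})"
        by (simp add: ev_Int_iff)
      \<comment> \<open>The limit of a side contained in \<open>Bas v\<close> lies only in the
        closure of \<open>Bas v\<close>; this is why the closure has to fit into
        \<open>Bas u\<close>.\<close>
      then have *: "ev (\<tau> p) {r. f r \<in> Bas u}"
        by (rule ev_mono) (use f v(3) conv_cl in blast)
      show "ev (\<tau>' (f p)) (Bas u)"
      proof (rule ccontr)
        assume "\<not> ev (\<tau>' (f p)) (Bas u)"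
        then have "ev (\<tau>' (f p)) (- Bas u)" using not_ev tame_Bas u by blast
        then have "ev (\<tau> p) {r. f r \<in> - Bas u}" using \<tau>'(2) by blast
        then show False using * ev_meets by blast
      qed
    qed
    then show "tends (f p) y" using tendsI[OF \<tau>'(1)] by blast
  qed
  then show False using bspec[OF f p(1)] by blast
qed

text \<open>The finitely many obstructions to making \<open>tied\<close> an equivalence relation
  with open saturations of open intervals.\<close>

definition irregular_pts :: "'a set" where
  "irregular_pts = {p. \<exists>x. tends p x \<and> \<not> (\<forall>y. tends x y \<longleftrightarrow>
      tends p y)} \<union> {t. \<exists>a. torn t a} \<union> {t. t \<notin> X \<and> (\<exists>x. tends t x)}"

lemma finite_irregular: "finite irregular_pts"
proof -
  have "{p. \<exists>x. tends p x \<and> \<not> (\<forall>y. tends x y \<longleftrightarrow> tends p y)} =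
      {p. \<exists>x. conv (Rgt p) x \<and> \<not> (\<forall>y. tends x y \<longleftrightarrow> tends p y)} \<union>
      {p. \<exists>x. conv (Lft p) x \<and> \<not> (\<forall>y. tends x y \<longleftrightarrow> tends p y)}"
    unfolding tends_def by blast
  then have 1: "finite {p. \<exists>x. tends p x \<and> \<not> (\<forall>y. tends x y \<longleftrightarrow> tends p y)}"
    using finite_unbalanced[of Rgt] finite_unbalanced[of Lft] by simp
  have "finite {t. t \<notin> X \<and> (\<exists>x. tends t x)}"
  proof (rule ccontr)
    assume inf: "\<not> ?thesis"
    have "tame {t. t \<notin> X \<and> (\<exists>x. tends t x)}"
      by (rule tame_Collect) (intro defpred_rules defpred_tends defpred_tame[OF tame_X])
    then obtain a b where ab: "a < b" "{a<..<b} \<subseteq> {t. t \<notin> X \<and> (\<exists>x. tends t x)}"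
      using tame_infinite inf by blast
    obtain t where t: "a < t" "t < b" using dense[OF ab(1)] by blast
    then have "t \<in> {t. t \<notin> X \<and> (\<exists>x. tends t x)}" using ab(2) by auto
    then obtain \<sigma> x where \<sigma>: "\<sigma> \<in> {Rgt, Lft}" "conv (\<sigma> t) x" unfolding tends_def by blast
    have "ev (\<sigma> t) X" using conv_ev_X \<sigma>(2) by blast
    moreover have "ev (\<sigma> t) {a<..<b}" using ev_near[OF t] \<sigma>(1) by auto
    ultimately show False using ev_meets ab(2) by blast
  qed
  with 1 finite_torn show ?thesis by (simp add: irregular_pts_def)
qed

text \<open>Two rounds of closing off suffice to make the generic points invariant under \<open>tends\<close> in both
  directions, because \<open>tends\<close> is balanced off the irregular points.\<close>

definition special1 :: "'a set" where
  "special1 = irregular_pts \<union> (\<Union>t\<in>irregular_pts. {x. tends t x}) \<union> {x. conv PosInf x} \<union> {x. conv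
      NegInf x}"

definition special2 :: "'a set" where
  "special2 = special1 \<union> (\<Union>t\<in>special1. {x. tends t x})"

definition generic :: "'a set" where
  "generic = X - (special2 \<union> (\<Union>x\<in>special2. {p. tends p x}))"

lemma finite_special2: "finite special2"
  unfolding special2_def special1_def using finite_irregular finite_tends_tgt finite_conv_tgt
    by simp

lemma finite_X_minus_generic: "finite (X - generic)"
proof -
  have "X - generic \<subseteq> special2 \<union> (\<Union>x\<in>special2. {p. tends p x})" unfolding generic_def by blast
  moreover have "finite (special2 \<union> (\<Union>x\<in>special2. {p. tends p x}))"
    using finite_special2 finite_tends_src by simp
  ultimately show ?thesis using finite_subset by blast
qed

lemma generic_sub: "generic \<subseteq> X"
  unfolding generic_def by blast

lemma tame_generic: "tame generic"
proof -
  have "generic = X - (X - generic)" using generic_sub by blast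
  then show ?thesis using tame_Diff[OF tame_X tame_finite[OF finite_X_minus_generic]] by simp
qed

lemma generic_balanced:
  assumes "p \<in> generic" "tends p x"
  shows "tends x y \<longleftrightarrow> tends p y"
proof -
  have "p \<notin> irregular_pts" using assms(1) unfolding generic_def special2_def special1_def by blast
  then show ?thesis using assms(2) unfolding irregular_pts_def by blast
qed

lemma generic_forward:
  assumes p: "p \<in> generic" "tends p x"
  shows "x \<in> generic"
proof -
  have "x \<in> X" using p(2) conv_ev_X unfolding tends_def by blast
  moreover have "x \<notin> special2" using p unfolding generic_def by blast
  moreover have "y \<notin> special2" if "tends x y" for y
    using that generic_balanced[OF p] p unfolding generic_def by blast
  ultimately show ?thesis unfolding generic_def by blast
qed

text \<open>No irregular point tends to x, so t is balanced. If t were in \<open>special2\<close>,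
  it would be a limit of some q in \<open>special1\<close>, and balance at q would make x a limit of
  q as well.\<close>

lemma generic_backward:
  assumes x: "x \<in> generic" "tends t x"
  shows "t \<in> generic"
proof -
  have x2: "x \<notin> special2" using x(1) unfolding generic_def by blast
  then have x1: "x \<notin> special1" unfolding special2_def by blast
  have t0: "t \<notin> irregular_pts" using x1 x(2) unfolding special1_def by blast
  then have tX: "t \<in> X" using x(2) unfolding irregular_pts_def by blast
  have bal: "tends x y \<longleftrightarrow> tends t y" for y using t0 x(2) unfolding irregular_pts_def by blast
  have t1: "t \<notin> special1" using x2 x(2) unfolding special2_def by blast
  have "t \<notin> special2"
  proof
    assume "t \<in> special2"
    then obtain q where q: "q \<in> special1" "tends q t" using t1 unfolding special2_def by blast
    have "q \<notin> irregular_pts" using q(2) t1 unfolding special1_def by blast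
    then have "tends q x" using q(2) x(2) unfolding irregular_pts_def by blast
    then show False using x2 q(1) unfolding special2_def by blast
  qed
  moreover have "y \<notin> special2" if "tends t y" for y
    using x(1) bal that unfolding generic_def by blast
  ultimately show ?thesis using tX unfolding generic_def by blast
qed

lemma generic_not_infinity: "x \<in> generic \<Longrightarrow> \<not> conv PosInf x \<and> \<not> conv NegInf x"
  unfolding generic_def special2_def special1_def by blast

lemma generic_not_torn: "t \<in> generic \<Longrightarrow> \<not> torn t a"
  unfolding generic_def special2_def special1_def irregular_pts_def by blast

lemma tied_generic: "a \<in> generic \<Longrightarrow> tied q a \<Longrightarrow> q \<in> generic"
  unfolding tied_def using generic_forward generic_backward by blast

text \<open>Balance at p and q gives them the same limits as soon as they share one.\<close>

lemma tied_trans: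
  assumes "tied p q" "tied q r" "q \<in> generic"
  shows "tied p r"
proof (cases "p = q \<or> q = r")
  case False
  then obtain x y where xy: "tends p x" "tends q x" "tends q y" "tends r y" using assms
    unfolding tied_def by blast
  have "p \<in> generic" using tied_generic[OF assms(3,1)] .
  then have "tends p y" using generic_balanced[OF _ xy(1)] generic_balanced[OF assms(3) xy(2)] xy(3)
    by blast
  then show ?thesis using xy unfolding tied_def by blast
qed (use assms in auto)

text \<open>Saturation under \<open>tied\<close>. From here on the name hides satisfaction of
  formulas.\<close>

definition sat :: "'a set \<Rightarrow> 'a set" where
  "sat A = {q. \<exists>a. a \<in> A \<and> tied q a}"

lemma sat_generic: "A \<subseteq> generic \<Longrightarrow> sat A \<subseteq> generic"
  unfolding sat_def using tied_generic by blast

lemma sat_self: "A \<subseteq> sat A"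
  unfolding sat_def tied_def by blast

lemma sat_mono: "A \<subseteq> B \<Longrightarrow> sat A \<subseteq> sat B"
  unfolding sat_def by blast

lemma sat_disjoint: "A \<inter> sat B = {} \<Longrightarrow> B \<subseteq> generic \<Longrightarrow> sat A \<inter> sat B = {}"
  unfolding sat_def using tied_trans tied_sym tied_generic by blast

lemma sat_idem: "B \<subseteq> generic \<Longrightarrow> A \<subseteq> sat B \<Longrightarrow> sat A \<subseteq> sat B"
  unfolding sat_def using tied_trans tied_generic by blast

lemma tame_sat: "tame A \<Longrightarrow> tame (sat A)"
  unfolding sat_def by (rule tame_Collect) (intro defpred_rules defpred_tied defpred_tame)

lemma ev_generic: "ev g X \<Longrightarrow> (\<And>x. g \<noteq> Pt x) \<Longrightarrow> ev g generic"
  using ev_not_finite[OF finite_X_minus_generic, of g] ev_Int_iff[of g X "- (X - generic)"]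
  by (metis Diff_Diff_Int Diff_eq generic_sub inf.absorb_iff2)

text \<open>Openness is tested on the germs converging to a point x of the saturation. Genericity
  excludes the ends of the line. If a side of t converges to x, then t is tied to x and so to a
  point a of A; as t is not torn, this side lies in the saturation of an interval around a.\<close>

lemma opn_sat:
  assumes A: "tame A" "A \<subseteq> generic" and nbhd: "\<And>a. a \<in> A \<Longrightarrow> \<exists>l u. l < a \<and> a < u \<and> {l<..<u} \<subseteq> A"
  shows "opn (sat A)"
proof (rule opn_by_germs)
  show "tame (sat A)" using tame_sat[OF A(1)] .
  show "sat A \<subseteq> X" using sat_generic[OF A(2)] generic_sub by blast
  fix x g assume x: "x \<in> sat A" and g: "conv g x"
  have xG: "x \<in> generic" using x sat_generic[OF A(2)] by blast
  show "ev g (sat A)"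
  proof (cases "\<exists>\<sigma>\<in>{Rgt, Lft}. \<exists>t. g = \<sigma> t")
    case True
    then obtain \<sigma> t where \<sigma>: "\<sigma> \<in> {Rgt, Lft}" "g = \<sigma> t" by blast
    have "tends t x" using tendsI \<sigma> g by blast
    then have "t \<in> generic" using generic_backward xG by blast
    \<comment> \<open>Balance at t, applied to x as one of the limits of t.\<close>
    then have "tends x x" using generic_balanced \<open>tends t x\<close> by blast
    then have "tied t x" using \<open>tends t x\<close> unfolding tied_def by blast
    moreover obtain a where a: "a \<in> A" "tied x a" using x unfolding sat_def by blast
    ultimately have "tied t a" using tied_trans xG by blast
    obtain l u where lu: "l < a" "a < u" "{l<..<u} \<subseteq> A" using nbhd[OF a(1)] by blast
    have "ev g {q. \<exists>a'. (l < a' \<and> a' < u) \<and> tied q a'}"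
      using generic_not_torn[OF \<open>t \<in> generic\<close>, of a] \<open>tied t a\<close> lu \<sigma> unfolding torn_def by auto
    then show ?thesis by (rule ev_mono) (use lu(3) in \<open>auto simp: sat_def subset_iff\<close>)
  next
    case False
    then have "g = PosInf \<or> g = NegInf \<or> (\<exists>y. g = Pt y)" by (cases g) auto
    then show ?thesis using g generic_not_infinity[OF xG] x conv_Pt by auto
  qed
qed

end

section \<open>Ends\<close>

primrec isend :: "'a germ \<Rightarrow> bool" where
  "isend (Pt x) \<longleftrightarrow> False"
| "isend (Rgt t) \<longleftrightarrow> True"
| "isend (Lft t) \<longleftrightarrow> True"
| "isend PosInf \<longleftrightarrow> True"
| "isend NegInf \<longleftrightarrow> True"

lemma isend_not_Pt: "isend g \<Longrightarrow> g \<noteq> Pt x"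
  by auto

lemma not_isend: "\<not> isend g \<Longrightarrow> \<exists>x. g = Pt x"
  by (cases g) auto

text \<open>A definable linear order on the ends, meant to choose the least member of a finite
  class. It is not the geometric order: both infinities precede all sides.\<close>

fun prec :: "'a::linorder germ \<Rightarrow> 'a germ \<Rightarrow> bool" where
  "prec NegInf d \<longleftrightarrow> True"
| "prec PosInf NegInf \<longleftrightarrow> False"
| "prec PosInf d \<longleftrightarrow> True"
| "prec (Rgt t) (Rgt t') \<longleftrightarrow> t \<le> t'"
| "prec (Rgt t) (Lft t') \<longleftrightarrow> t \<le> t'"
| "prec (Lft t) (Rgt t') \<longleftrightarrow> t < t'"
| "prec (Lft t) (Lft t') \<longleftrightarrow> t \<le> t'"
| "prec g d \<longleftrightarrow> False"

lemma prec_total: "isend g \<Longrightarrow> isend d \<Longrightarrow> prec g d \<or> prec d g"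
  by (cases g; cases d) auto

lemma prec_antisym: "isend g \<Longrightarrow> isend d \<Longrightarrow> prec g d \<Longrightarrow> prec d g \<Longrightarrow> g = d"
  by (cases g; cases d) auto

lemma prec_trans: "isend g \<Longrightarrow> isend d \<Longrightarrow> isend h \<Longrightarrow> prec g d \<Longrightarrow> prec d h \<Longrightarrow> prec g h"
  by (cases g; cases d; cases h) auto

lemma prec_least:
  assumes "finite A" "A \<noteq> {}" "\<And>g. g \<in> A \<Longrightarrow> isend g"
  shows "\<exists>g\<in>A. \<forall>d\<in>A. prec g d"
  using assms
proof (induction A rule: finite_ne_induct)
  case (singleton g)
  then show ?case using prec_total[of g g] by auto
next
  case (insert g A)
  then obtain h where h: "h \<in> A" "\<forall>d\<in>A. prec h d" by auto
  have ends: "isend g" "isend h" "\<forall>d\<in>A. isend d" using insert.prems h(1) by auto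
  show ?case
  proof (cases "prec g h")
    case True
    have "prec g d" if "d \<in> A" for d
      using prec_trans[OF ends(1,2) _ True] h(2) ends(3) that by blast
    moreover have "prec g g" using prec_total ends(1) by blast
    ultimately show ?thesis by blast
  next
    case False
    then have "prec h g" using prec_total ends by blast
    then show ?thesis using h by blast
  qed
qed

context expansion_line
begin

lemma defpred_isend: "defgerm K \<Longrightarrow> defpred (\<lambda>e. isend (K e))"
  by (erule defgerm_cases) (auto intro: defpred_const)

lemma defpred_prec: "defgerm K \<Longrightarrow> defgerm H \<Longrightarrow> defpred (\<lambda>e. prec (K e) (H e))"
  by (erule defgerm_cases; erule defgerm_cases) (auto intro: defpred_const defpred_le defpred_less)

end

section \<open>Inseparable ends of a regular space\<close>

context regular_line
begin

definition free_end :: "'a germ \<Rightarrow> bool" where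
  "free_end g \<longleftrightarrow> isend g \<and> ev g X \<and> (\<forall>x. \<not> conv g x)"

text \<open>For ends of \<open>X\<close> this amounts to inseparability by open sets; it is spelt out in elementary
  terms to make its definability evident.\<close>

definition equiv_end :: "'a germ \<Rightarrow> 'a germ \<Rightarrow> bool" where
  "equiv_end g d \<longleftrightarrow> isend g \<and> isend d \<and> ev g X \<and> ev d X \<and>
    (\<forall>s. side g s \<and> (\<forall>r. r \<in> nbd g s \<longrightarrow> r \<in> generic) \<longrightarrow> ev d {q. \<exists>a. a \<in> nbd g s \<and> tied q a})"

lemma equiv_end_sat: "equiv_end g d \<longleftrightarrow> isend g \<and> isend d \<and> ev g X \<and> ev d X \<and>
    (\<forall>s. side g s \<and> nbd g s \<subseteq> generic \<longrightarrow> ev d (sat (nbd g s)))"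
  unfolding equiv_end_def sat_def subset_iff by simp

lemma eqgD: "equiv_end g d \<Longrightarrow> side g s \<Longrightarrow> nbd g s \<subseteq> generic \<Longrightarrow> ev d (sat (nbd g s))"
  unfolding equiv_end_sat by blast

lemma defpred_equiv_end: "defgerm K \<Longrightarrow> defgerm H \<Longrightarrow> defpred (\<lambda>e. equiv_end (K e) (H e))"
  unfolding equiv_end_def
  by (intro defpred_rules defpred_isend defpred_ev_tame[OF _ tame_X] defpred_side defpred_nbd
    defpred_ev defpred_tied defpred_tame[OF tame_generic]
      defgerm_ren[of K Suc] defgerm_ren[of H Suc] defgerm_ren[of K
        "\<lambda>i. Suc (Suc i)"] defgerm_ren[of K "\<lambda>i. Suc (Suc (Suc i))"])

lemma defpred_free_end: "defgerm K \<Longrightarrow> defpred (\<lambda>e. free_end (K e))"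
  unfolding free_end_def by (intro defpred_rules defpred_isend defpred_ev_tame[OF _ tame_X]
    defpred_conv defgerm_ren[of K Suc])

lemma nbd_in:
  assumes "isend g" "ev g X" "ev g A"
  obtains s where "side g s" "nbd g s \<subseteq> generic" "nbd g s \<subseteq> A"
proof -
  have "ev g (generic \<inter> A)" using ev_generic[OF assms(2) isend_not_Pt[OF assms(1)]] assms(3)
    by (simp add: ev_Int_iff)
  then show ?thesis unfolding ev_def using that by blast
qed

lemma tame_nbd: "tame (nbd g s)"
  unfolding tame_def by (intro defpred_nbd defgerm_const defterm_var defterm_const)

lemma opn_sat_nbd: "isend g \<Longrightarrow> nbd g s \<subseteq> generic \<Longrightarrow> opn (sat (nbd g s))"
  by (rule opn_sat[OF tame_nbd]) (assumption, rule nbd_open[OF isend_not_Pt])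

lemma equiv_end_refl: "isend g \<Longrightarrow> ev g X \<Longrightarrow> equiv_end g g"
  unfolding equiv_end_sat using ev_mono[OF ev_nbd sat_self] by blast

text \<open>If g avoided a saturated set around d, a small neighbourhood of g would have a
  saturation disjoint from it, although both saturations belong to d.\<close>

lemma equiv_end_sym:
  assumes "equiv_end g d"
  shows "equiv_end d g"
proof -
  have gd: "isend g" "isend d" "ev g X" "ev d X" using assms unfolding equiv_end_def by blast+
  have "ev g (sat (nbd d t))" if t: "side d t" "nbd d t \<subseteq> generic" for t
  proof (rule ccontr)
    assume "\<not> ?thesis"
    then have "ev g (- sat (nbd d t))" using not_ev[OF tame_sat[OF tame_nbd]] by blast
    then obtain s where s: "side g s" "nbd g s \<subseteq> generic" "nbd g s \<subseteq> - sat (nbd d t)"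
      by (rule nbd_in[OF gd(1,3)])
    have "ev d (sat (nbd g s))" using eqgD[OF assms s(1,2)] .
    moreover have "ev d (sat (nbd d t))" using ev_mono[OF ev_nbd[OF t(1)] sat_self] .
    ultimately have "sat (nbd g s) \<inter> sat (nbd d t) \<noteq> {}" by (rule ev_meets)
    moreover have "sat (nbd g s) \<inter> sat (nbd d t) = {}" by (rule sat_disjoint) (use s t in auto)
    ultimately show False by blast
  qed
  then show ?thesis using gd unfolding equiv_end_sat by blast
qed

lemma equiv_end_trans:
  assumes "equiv_end g d" "equiv_end d h"
  shows "equiv_end g h"
proof -
  have gd: "isend g" "isend d" "isend h" "ev g X" "ev d X" "ev h X" using assms
    unfolding equiv_end_def by blast+
  have "ev h (sat (nbd g s))" if s: "side g s" "nbd g s \<subseteq> generic" for s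
  proof -
    have "ev d (sat (nbd g s))" using eqgD[OF assms(1) s] .
    then obtain t where t: "side d t" "nbd d t \<subseteq> generic" "nbd d t \<subseteq> sat (nbd g s)"
      by (rule nbd_in[OF gd(2,5)])
    then have "sat (nbd d t) \<subseteq> sat (nbd g s)" using sat_idem s(2) by blast
    then show ?thesis using eqgD[OF assms(2) t(1,2)] ev_mono by blast
  qed
  then show ?thesis using gd unfolding equiv_end_sat by blast
qed

text \<open>A point q near e and outside U is tied to a point a near d, which lies in V, and shares
  a limit x with it. As x lies in the closure of V, hence in U, a side of q lies in U, although the
  points near q avoid U.\<close>

lemma equiv_end_closure:
  assumes de: "equiv_end d e" and V: "V \<subseteq> X" "ev d V" and U: "opn U" "tame U" "cl V \<subseteq> U"
  shows "ev e U"
proof (rule ccontr)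
  assume "\<not> ev e U"
  then have "ev e (- U)" using not_ev U(2) by blast
  have de': "isend d" "isend e" "ev d X" "ev e X" using de unfolding equiv_end_def by blast+
  obtain s where s: "side d s" "nbd d s \<subseteq> generic" "nbd d s \<subseteq> V" using nbd_in[OF de'(1,3) V(2)] .
  have "ev e (sat (nbd d s))" using eqgD[OF de s(1,2)] .
  then have "ev e (sat (nbd d s) \<inter> - U)" using \<open>ev e (- U)\<close> by (simp add: ev_Int_iff)
  then obtain t where t: "side e t" "nbd e t \<subseteq> sat (nbd d s) \<inter> - U" unfolding ev_def by blast
  obtain q where q: "q \<in> nbd e t" using nbd_nonempty[OF t(1)] by blast
  then obtain a where a: "a \<in> nbd d s" "tied q a" using t(2) unfolding sat_def by blast
  have "a \<in> U" using a(1) s(3) V(1) subset_cl U(3) by blast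
  then obtain x where x: "tends q x" "tends a x" using a(2) q t(2) unfolding tied_def by blast
  obtain \<sigma> where \<sigma>: "\<sigma> \<in> {Rgt, Lft}" "conv (\<sigma> a) x" using x(2) unfolding tends_def by blast
  obtain \<tau> where \<tau>: "\<tau> \<in> {Rgt, Lft}" "conv (\<tau> q) x" using x(1) unfolding tends_def by blast
  have "ev (\<sigma> a) (nbd d s)" using ev_nbd_sides[OF isend_not_Pt[OF de'(1)] a(1)] \<sigma>(1) by auto
  then have "ev (\<sigma> a) V" using s(3) ev_mono by blast
  then have "x \<in> U" using conv_cl[OF \<sigma>(2)] U(3) by blast
  then have "ev (\<tau> q) U" using \<tau>(2) U(1) unfolding conv_def by blast
  moreover have "ev (\<tau> q) (nbd e t)" using ev_nbd_sides[OF isend_not_Pt[OF de'(2)] q] \<tau>(1) by auto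
  then have "ev (\<tau> q) (- U)" using t(2) ev_mono by blast
  ultimately show False using ev_meets by blast
qed

text \<open>Follows from \<open>equiv_end_closure\<close> with nested basic neighbourhoods supplied
  by regularity. Hence either all ends of a class converge or none does.\<close>

lemma equiv_end_conv:
  assumes "equiv_end d e" "conv d y"
  shows "conv e y"
  unfolding conv_Bas
proof (intro conjI allI impI)
  show "y \<in> X" using conv_ev_X assms(2) by blast
  fix u assume u: "u \<in> Om \<and> y \<in> Bas u"
  then obtain v where v: "v \<in> Om" "y \<in> Bas v" "cl (Bas v) \<subseteq> Bas u" using regular_Bas opn_Bas
    by metis
  then have "ev d (Bas v)" using assms(2) unfolding conv_Bas by blast
  then show "ev e (Bas u)"
    using equiv_end_closure[OF assms(1), of "Bas v" "Bas u"] v u opn_Bas opn_sub tame_Bas by blast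
qed

lemma equiv_end_free_end: "equiv_end d e \<Longrightarrow> free_end d \<Longrightarrow> free_end e"
  using equiv_end_conv[OF equiv_end_sym] unfolding free_end_def equiv_end_def by blast

lemma free_end_equiv_end_refl: "free_end g \<Longrightarrow> equiv_end g g"
  unfolding free_end_def using equiv_end_refl by blast

lemma avoid_tied:
  assumes "isend e" "ev e X" "finite Y"
  obtains s where "side e s" "nbd e s \<subseteq> generic" "Y \<inter> sat (nbd e s) = {}"
proof -
  have "finite (\<Union>y\<in>Y. {a. tied y a})" using finite_tied assms(3) by blast
  then have "ev e (- (\<Union>y\<in>Y. {a. tied y a}))" using ev_not_finite isend_not_Pt[OF assms(1)] by blast
  then obtain s where s: "side e s" "nbd e s \<subseteq> generic" "nbd e s \<subseteq> - (\<Union>y\<in>Y. {a. tied y a})"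
    by (rule nbd_in[OF assms(1,2)])
  then have "Y \<inter> sat (nbd e s) = {}" unfolding sat_def by blast
  with s that show ?thesis by blast
qed

text \<open>A compactness property of the class of e: if no saturation fitted into V, the
  differences would be directed and contained in a germ d, which is an end equivalent to e but
  outside V.\<close>

lemma equiv_end_small:
  assumes e: "isend e" "ev e X" and V: "tame V" "\<And>d. equiv_end e d \<Longrightarrow> ev d V"
  obtains s where "side e s" "nbd e s \<subseteq> generic" "sat (nbd e s) \<subseteq> V"
proof (rule ccontr)
  assume no: "\<not> thesis"
  have neg: "sat (nbd e s) - V \<noteq> {}" if "side e s" "nbd e s \<subseteq> generic" for s
    using no that \<open>\<And>s. side e s \<Longrightarrow> nbd e s \<subseteq> generic \<Longrightarrow> sat (nbd e s) \<subseteq> V \<Longrightarrow> thesis\<close> by blast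
  define \<F> where "\<F> = (\<lambda>s. sat (nbd e s) - V) ` {s. side e s \<and> nbd e s \<subseteq> generic}"
  have "\<exists>d. \<forall>F\<in>\<F>. ev d F"
  proof (rule directed_germ)
    fix F assume "F \<in> \<F>"
    then show "tame F" "F \<noteq> {}" unfolding \<F>_def using tame_Diff[OF tame_sat[OF tame_nbd] V(1)] neg
      by auto
  next
    fix A B assume "A \<in> \<F>" "B \<in> \<F>"
    then obtain s t where st: "side e s" "nbd e s \<subseteq> generic" "A = sat (nbd e s) - V"
      "side e t" "nbd e t \<subseteq> generic" "B = sat (nbd e t) - V" unfolding \<F>_def by auto
    obtain r where r: "side e r" "nbd e r \<subseteq> nbd e s \<inter> nbd e t" using nbd_directed[OF st(1,4)] .
    then have "sat (nbd e r) - V \<in> \<F>" unfolding \<F>_def using st(2) by blast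
    moreover have "sat (nbd e r) - V \<subseteq> A \<inter> B"
      using sat_mono[of "nbd e r" "nbd e s"] sat_mono[of "nbd e r" "nbd e t"] r(2) st by blast
    ultimately show "\<exists>C\<in>\<F>. C \<subseteq> A \<inter> B" by blast
  next
    have "defpred (\<lambda>e'. \<exists>s. (side e s \<and> (\<forall>r. r \<in> nbd e s \<longrightarrow> r \<in> generic)) \<and>
        (\<forall>q. (\<exists>a. a \<in> nbd e s \<and> tied q a) \<and> \<not> q \<in> V \<longrightarrow> e' 0 \<le> q))"
      by (intro defpred_rules defpred_side defpred_nbd defgerm_const defpred_tied defpred_tame[OF
        tame_generic] defpred_tame[OF V(1)])
    moreover have "t \<in> {t. \<exists>F\<in>\<F>. F \<subseteq> {t..}} \<longleftrightarrow> (\<exists>s. (side e s \<and> (\<forall>r. r \<in> nbd e s \<longrightarrow> r \<in> generic)) \<and>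
        (\<forall>q. (\<exists>a. a \<in> nbd e s \<and> tied q a) \<and> \<not> q \<in> V \<longrightarrow> t \<le> q))" for t
      unfolding \<F>_def sat_def by (auto simp: subset_iff)
    ultimately show "tame {t. \<exists>F\<in>\<F>. F \<subseteq> {t..}}" unfolding tame_def by simp
  qed
  then obtain d where d: "\<And>s. side e s \<Longrightarrow> nbd e s \<subseteq> generic \<Longrightarrow> ev d (sat (nbd e s) - V)"
    unfolding \<F>_def by blast
  obtain s0 where s0: "side e s0" "nbd e s0 \<subseteq> generic" using nbd_in[OF e ev_UNIV] .
  have dX: "ev d X" using ev_mono[OF d[OF s0]] sat_generic[OF s0(2)] generic_sub by blast
  \<comment> \<open>By \<open>avoid_tied\<close> no single point lies in all the
    saturations.\<close>
  have "isend d"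
  proof (rule ccontr)
    assume "\<not> isend d"
    then obtain q where q: "d = Pt q" using not_isend by blast
    obtain s where "side e s" "nbd e s \<subseteq> generic" "{q} \<inter> sat (nbd e s) = {}"
      using avoid_tied[OF e, of "{q}"] by auto
    then show False using d q by auto
  qed
  then have "equiv_end e d" unfolding equiv_end_sat using e dX d ev_mono by blast
  then have "ev d V" by (rule V(2))
  then show False using d[OF s0] ev_meets[of d V "sat (nbd e s0) - V"] by blast
qed

text \<open>As in \<open>finite_conv\<close>, with the saturations around g in the role of
  neighbourhoods of x and \<open>avoid_tied\<close> in the role of the Hausdorff property. The
  family has the single parameter s, hence tuples of length 1.\<close>

lemma finite_equiv_end_side:
  assumes \<sigma>: "\<sigma> \<in> {Rgt, Lft}"
  shows "finite {t. equiv_end g (\<sigma> t)}"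
proof (rule ccontr)
  assume inf: "infinite {t. equiv_end g (\<sigma> t)}"
  have defgerm_\<sigma>: "defgerm (\<lambda>e. \<sigma> (e i))" for i using \<sigma> by (auto intro: defgerm_intros defterm_var)
  have "tame {t. equiv_end g (\<sigma> t)}" by (rule tame_Collect) (intro defpred_equiv_end defgerm_\<sigma>
    defgerm_const)
  then obtain a b where ab: "a < b" "{a<..<b} \<subseteq> {t. equiv_end g (\<sigma> t)}" using tame_infinite inf
    by blast
  obtain t0 where "t0 \<in> {a<..<b}" using dense[OF ab(1)] by auto
  then have g: "isend g" "ev g X" using ab(2) unfolding equiv_end_def by blast+
  define D where "D u y \<longleftrightarrow> (a < y \<and> y < b) \<and> (side g (u ! 0) \<and> (\<forall>r. r \<in> nbd g (u ! 0) \<longrightarrow>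
      r \<in> generic)) \<and>
      \<not> (\<exists>a. a \<in> nbd g (u ! 0) \<and> tied y a)" for u :: "'a list" and y
  have dpD: "defpred (\<lambda>e. D (L e) (f e))" if L: "deftuple 1 L" and f: "defterm f" for L f
  proof -
    have L0: "defterm (\<lambda>e. L e ! 0)" using L by (simp add: deftuple_def)
    show ?thesis
      unfolding D_def
      by (intro defpred_rules defpred_side defpred_nbd defgerm_const f defpred_tied defpred_tame[OF
        tame_generic] L0 defterm_ren[OF L0] defterm_ren[OF f])
  qed
  have D: "D u y \<longleftrightarrow> y \<in> {a<..<b} \<and> side g (u ! 0) \<and> nbd g (u ! 0) \<subseteq> generic \<and>
      y \<notin> sat (nbd g (u ! 0))" for u y
    unfolding D_def sat_def by auto
  have fin: "finite {y. D u y}" for u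
  proof (cases "side g (u ! 0) \<and> nbd g (u ! 0) \<subseteq> generic")
    case True
    have "finite ({a<..<b} - sat (nbd g (u ! 0)))"
    proof (rule ccontr)
      assume "infinite ({a<..<b} - sat (nbd g (u ! 0)))"
      then obtain c d where cd: "c < d" "{c<..<d} \<subseteq> {a<..<b} - sat (nbd g (u ! 0))"
        using tame_infinite[OF tame_Diff[OF tame_ioo tame_sat[OF tame_nbd]]] by metis
      obtain t where t: "c < t" "t < d" using dense[OF cd(1)] by blast
      then have "t \<in> {a<..<b}" using cd(2) by auto
      then have "equiv_end g (\<sigma> t)" using ab(2) by blast
      then have "ev (\<sigma> t) (sat (nbd g (u ! 0)))" using True eqgD by blast
      moreover have "ev (\<sigma> t) {c<..<d}" using ev_near[OF t] \<sigma> by auto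
      ultimately show False using ev_meets cd(2) by blast
    qed
    then show ?thesis by (rule rev_finite_subset) (auto simp: D)
  qed (simp add: D)
  obtain Y where Y: "finite Y" "Y \<subseteq> {a<..<b}" "\<And>u. length u = 1 \<Longrightarrow> \<exists>y\<in>Y. \<not> D u y"
    using no_finite_covering_family[of 1 D, OF dpD fin infinite_Ioo[OF ab(1)]] by blast
  obtain s where s: "side g s" "nbd g s \<subseteq> generic" "Y \<inter> sat (nbd g s) = {}"
    using avoid_tied[OF g Y(1)] .
  obtain y where "y \<in> Y" "\<not> D [s] y" using Y(3)[of "[s]"] by auto
  then show False using s Y(2) unfolding D by auto
qed

lemma finite_equiv_end: "finite {d. equiv_end g d}"
proof -
  have "d \<in> Rgt ` {t. equiv_end g (Rgt t)} \<union> Lft ` {t. equiv_end g (Lft t)} \<union> {PosInf, NegInf}" if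
    "equiv_end g d" for d
    using that by (cases d) (auto simp: equiv_end_def)
  then have "{d. equiv_end g d} \<subseteq> Rgt ` {t. equiv_end g (Rgt t)} \<union> Lft ` {t. equiv_end g (Lft t)} \<union>
      {PosInf, NegInf}" by blast
  moreover have "finite \<dots>" using finite_equiv_end_side by simp
  ultimately show ?thesis by (rule finite_subset)
qed

definition rep :: "'a germ \<Rightarrow> bool" where
  "rep g \<longleftrightarrow> free_end g \<and> (\<forall>d. equiv_end g d \<longrightarrow> prec g d)"

lemma rep_ex:
  assumes "free_end g"
  obtains h where "equiv_end g h" "rep h"
proof -
  have "\<exists>h\<in>{d. equiv_end g d}. \<forall>d\<in>{d. equiv_end g d}. prec h d"
  proof (rule prec_least[OF finite_equiv_end])
    show "{d. equiv_end g d} \<noteq> {}" using free_end_equiv_end_refl[OF assms] by blast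
    show "isend d" if "d \<in> {d. equiv_end g d}" for d using that unfolding equiv_end_def by blast
  qed
  then obtain h where h: "equiv_end g h" "\<And>d. equiv_end g d \<Longrightarrow> prec h d" by blast
  then have "rep h" unfolding rep_def using equiv_end_free_end assms equiv_end_trans by blast
  with h that show ?thesis by blast
qed

lemma rep_unique: "rep g \<Longrightarrow> rep h \<Longrightarrow> equiv_end g h \<Longrightarrow> g = h"
  using prec_antisym equiv_end_sym unfolding rep_def free_end_def by metis

text \<open>A point of the compactification is a point of \<open>X\<close> or the least member of a class of
  non-convergent ends.\<close>

primrec cpoint :: "'a germ \<Rightarrow> bool" where
  "cpoint (Pt x) \<longleftrightarrow> x \<in> X"
| "cpoint (Rgt t) \<longleftrightarrow> rep (Rgt t)"
| "cpoint (Lft t) \<longleftrightarrow> rep (Lft t)"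
| "cpoint PosInf \<longleftrightarrow> rep PosInf"
| "cpoint NegInf \<longleftrightarrow> rep NegInf"

lemma cpoint_isend: "isend g \<Longrightarrow> cpoint g \<longleftrightarrow> rep g"
  by (cases g) auto

text \<open>A point is equivalent to no end, so for it \<open>ev g V\<close> is the condition; an
  end needs its whole class to lie in V.\<close>

definition hat :: "'a set \<Rightarrow> 'a germ set" where
  "hat V = {g. cpoint g \<and> ev g V \<and> (\<forall>d. equiv_end g d \<longrightarrow> ev d V)}"

lemma defpred_rep: "defgerm K \<Longrightarrow> defpred (\<lambda>e. rep (K e))"
  unfolding rep_def
  by (intro defpred_rules defpred_free_end defpred_all_germ defpred_equiv_end defpred_prec
    defgerm_intros defgerm_ren[of K Suc])

lemma defpred_cpoint: "defgerm K \<Longrightarrow> defpred (\<lambda>e. cpoint (K e))"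
  by (erule defgerm_cases) (auto intro: defpred_tame[OF tame_X] defpred_rep defgerm_intros)

lemma defpred_hat:
  assumes "defgerm K" "defpred (\<lambda>e. Q (e 0) (\<lambda>i. e (Suc i)))"
  shows "defpred (\<lambda>e. K e \<in> hat {r. Q r e})"
proof -
  have "defpred (\<lambda>e. Q (e 0) (\<lambda>i. e (Suc (Suc i))))"
    using defpred_ren[OF assms(2), of "case_nat 0 (\<lambda>i. Suc (Suc i))"] by simp
  then show ?thesis
    unfolding hat_def mem_Collect_eq
    by (intro defpred_rules defpred_cpoint defpred_ev defpred_all_germ defpred_equiv_end
      defgerm_intros defgerm_ren[of K Suc] assms)
qed

lemma Pt_hat: "V \<subseteq> X \<Longrightarrow> Pt x \<in> hat V \<longleftrightarrow> x \<in> V"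
  unfolding hat_def equiv_end_def by auto

lemma hat_Int: "hat (U \<inter> V) = hat U \<inter> hat V"
  unfolding hat_def by (auto simp: ev_Int_iff)

lemma hat_mono: "U \<subseteq> V \<Longrightarrow> hat U \<subseteq> hat V"
  unfolding hat_def using ev_mono by blast

lemma hat_cpoint: "g \<in> hat V \<Longrightarrow> cpoint g"
  unfolding hat_def by blast

lemma hat_X: "cpoint g \<Longrightarrow> g \<in> hat X"
  unfolding hat_def by (cases g) (auto simp: equiv_end_def rep_def free_end_def)

lemma hat_disjoint: "U \<inter> V = {} \<Longrightarrow> hat U \<inter> hat V = {}"
  unfolding hat_def using ev_meets by blast

lemma rep_hat_sat:
  assumes g: "rep g" "side g s" "nbd g s \<subseteq> generic"
  shows "g \<in> hat (sat (nbd g s))"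
  using assms eqgD[of g _ s] ev_mono[OF ev_nbd[OF g(2)] sat_self] cpoint_isend
  unfolding hat_def rep_def free_end_def by blast

text \<open>Neighbourhoods of old points come from the given basis and those of new points from
  saturations, so that finitely many parameters describe a basis although V ranges over all
  definable open sets.\<close>

lemma hat_base:
  assumes "g \<in> hat V" "opn V" "tame V"
  shows "(\<exists>u\<in>Om. g \<in> hat (Bas u) \<and> Bas u \<subseteq> V) \<or>
    (isend g \<and> (\<exists>s. side g s \<and> nbd g s \<subseteq> generic \<and> g \<in> hat (sat (nbd g s)) \<and> sat (nbd g s) \<subseteq> V))"
proof (cases "isend g")
  case True
  then have r: "rep g" using hat_cpoint[OF assms(1)] cpoint_isend by blast
  then have "ev g X" unfolding rep_def free_end_def by blast
  then obtain s where "side g s" "nbd g s \<subseteq> generic" "sat (nbd g s) \<subseteq> V"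
    using equiv_end_small[OF True _ assms(3)] assms(1) unfolding hat_def by blast
  then show ?thesis using True rep_hat_sat[OF r] by blast
next
  case False
  then obtain x where x: "g = Pt x" using not_isend by blast
  then have "x \<in> V" using assms(1) unfolding hat_def by simp
  then obtain u where "u \<in> Om" "x \<in> Bas u" "Bas u \<subseteq> V" using Bas_ex[OF assms(2)] by blast
  then show ?thesis using x Pt_hat opn_Bas opn_sub by metis
qed

lemma hat_separate:
  assumes "cpoint g" "cpoint h" "g \<noteq> h"
  shows "\<exists>U V. opn U \<and> tame U \<and> opn V \<and> tame V \<and> g \<in> hat U \<and> h \<in> hat V \<and> U \<inter> V = {}"
proof -
  have mixed: "\<exists>U V. opn U \<and> tame U \<and> opn V \<and> tame V \<and> Pt x \<in> hat U \<and> e \<in> hat V \<and> U \<inter> V = {}"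
    if x: "x \<in> X" and e: "rep e" for x e
  proof -
    have "free_end e" using e unfolding rep_def by blast
    then have e': "isend e" "ev e X" "\<not> conv e x" unfolding free_end_def by blast+
    then obtain u where u: "u \<in> Om" "x \<in> Bas u" "\<not> ev e (Bas u)" unfolding conv_Bas using x by blast
    \<comment> \<open>Regularity is used twice. The closure of \<open>Bas v\<close> inside
      \<open>Bas u\<close> carries the exclusion of e over to all equivalent ends; the closure of
      \<open>Bas w\<close> inside \<open>Bas v\<close> then has an open complement that contains
      them.\<close>
    obtain v where v: "v \<in> Om" "x \<in> Bas v" "cl (Bas v) \<subseteq> Bas u"
      using regular_Bas[OF opn_Bas[OF u(1)] u(2)] .
    obtain w where w: "w \<in> Om" "x \<in> Bas w" "cl (Bas w) \<subseteq> Bas v"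
      using regular_Bas[OF opn_Bas[OF v(1)] v(2)] .
    have no: "\<not> ev d (Bas v)" if "equiv_end e d" for d
      using equiv_end_closure[OF equiv_end_sym[OF that], of "Bas v"
        "Bas u"] u v opn_Bas opn_sub tame_Bas by blast
    have tmcl: "tame (cl (Bas w))"
    proof -
      have "defpred (\<lambda>e. e 0 \<in> X \<and> (\<forall>u. length u = k \<longrightarrow> (u \<in> Om \<and> e 0 \<in> Bas u \<longrightarrow> (\<exists>z. (u \<in> Om \<and>
          z \<in> Bas u) \<and> z \<in> Bas w))))"
        by (intro defpred_rules defpred_all_list defpred_Bas deftuple_vars deftuple_ren
          defpred_tame[OF tame_X] defpred_tame[OF tame_Bas[OF w(1)]])
      moreover have "y \<in> cl (Bas w) \<longleftrightarrow> y \<in> X \<and> (\<forall>u. length u = k \<longrightarrow> (u \<in> Om \<and> y \<in> Bas u \<longrightarrow>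
          (\<exists>z. (u \<in> Om \<and> z \<in> Bas u) \<and> z \<in> Bas w)))" for y
        unfolding cl_Bas using Om_length by auto
      ultimately show ?thesis unfolding tame_def by simp
    qed
    have "ev d (X - cl (Bas w))" if d: "equiv_end e d" for d
    proof -
      have "ev d X" using d unfolding equiv_end_def by blast
      moreover have "ev d (- Bas v)" using no[OF d] not_ev[OF tame_Bas[OF v(1)]] by blast
      ultimately have "ev d (X \<inter> - Bas v)" by (simp add: ev_Int_iff)
      then show ?thesis by (rule ev_mono) (use w(3) in blast)
    qed
    then have "e \<in> hat (X - cl (Bas w))"
      unfolding hat_def using free_end_equiv_end_refl[OF \<open>free_end e\<close>] cpoint_isend[OF e'(1)] e
        by blast
    moreover have "Pt x \<in> hat (Bas w)" using Pt_hat[OF opn_sub[OF opn_Bas[OF w(1)]]] w(2) by blast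
    moreover have "Bas w \<inter> (X - cl (Bas w)) = {}" using subset_cl[OF opn_sub[OF opn_Bas[OF w(1)]]]
      by blast
    ultimately show ?thesis
      using opn_Bas[OF w(1)] tame_Bas[OF w(1)] opn_compl_cl tame_Diff[OF tame_X tmcl] by blast
  qed
  consider x y where "g = Pt x" "h = Pt y" | x where "g = Pt x" "isend h" | y where "isend g"
    "h = Pt y"
    | "isend g" "isend h" using not_isend[of g] not_isend[of h] by blast
  then show ?thesis
  proof cases
    case (1 x y)
    then have "x \<in> X" "y \<in> X" "x \<noteq> y" using assms by auto
    then obtain U V where UV: "opn U" "opn V" "x \<in> U" "y \<in> V" "U \<inter> V = {}" using separate by blast
    obtain u where u: "u \<in> Om" "x \<in> Bas u" "Bas u \<subseteq> U" using Bas_ex UV(1,3) by blast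
    obtain v where v: "v \<in> Om" "y \<in> Bas v" "Bas v \<subseteq> V" using Bas_ex UV(2,4) by blast
    have "Pt x \<in> hat (Bas u)" using Pt_hat[OF opn_sub[OF opn_Bas[OF u(1)]]] u(2) by simp
    moreover have "Pt y \<in> hat (Bas v)" using Pt_hat[OF opn_sub[OF opn_Bas[OF v(1)]]] v(2) by simp
    moreover have "Bas u \<inter> Bas v = {}" using u v UV by blast
    ultimately show ?thesis using 1 opn_Bas tame_Bas u(1) v(1) by blast
  next
    case (2 x)
    then show ?thesis using mixed[of x h] assms cpoint_isend by auto
  next
    case (3 y)
    then obtain U V where "opn U" "tame U" "opn V" "tame V" "Pt y \<in> hat U" "g \<in> hat V" "U \<inter> V = {}"
      using mixed[of y g] assms cpoint_isend by auto
    then show ?thesis using 3 by blast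
  next
    case 4
    then have r: "rep g" "rep h" using assms cpoint_isend by blast+
    then have X: "ev g X" "ev h X" unfolding rep_def free_end_def by blast+
    have "\<not> equiv_end g h" using rep_unique r assms(3) by blast
    then obtain s where s: "side g s" "nbd g s \<subseteq> generic" "\<not> ev h (sat (nbd g s))"
      unfolding equiv_end_sat using 4 X by blast
    then have "ev h (- sat (nbd g s))" using not_ev[OF tame_sat[OF tame_nbd]] by blast
    then obtain t where t: "side h t" "nbd h t \<subseteq> generic" "nbd h t \<subseteq> - sat (nbd g s)"
      by (rule nbd_in[OF 4(2) X(2)])
    have "sat (nbd h t) \<inter> sat (nbd g s) = {}" by (rule sat_disjoint) (use s t in auto)
    then have "sat (nbd g s) \<inter> sat (nbd h t) = {}" by blast
    then show ?thesis
      using rep_hat_sat[OF r(1) s(1,2)] rep_hat_sat[OF r(2) t(1,2)] opn_sat_nbd[OF 4(1) s(2)]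
        opn_sat_nbd[OF 4(2) t(2)] tame_sat[OF tame_nbd] by blast
  qed
qed

text \<open>The curve pushes e forward to a germ h of X. The limit is that of h if there is one, and
  otherwise the representative of the class of h.\<close>

lemma germ_limit_points:
  assumes e: "isend e" and x: "deffun x" and X: "ev e {t. x t \<in> X}"
  shows "\<exists>g. cpoint g \<and> (\<forall>V. opn V \<and> tame V \<and> g \<in> hat V \<longrightarrow> ev e {t. Pt (x t) \<in> hat V})"
proof -
  obtain h where h: "\<And>U. tame U \<Longrightarrow> ev h U \<longleftrightarrow> ev e {t. x t \<in> U}" using push_germ[OF x, of e] by blast
  have hX: "ev h X" using h[OF tame_X] X by blast
  have lift: "ev e {t. Pt (x t) \<in> hat V}" if "ev h V" "opn V" "tame V" for V
    using h[OF that(3)] that(1) Pt_hat[OF opn_sub[OF that(2)]] by simp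
  show ?thesis
  proof (cases "\<exists>y. conv h y")
    case True
    then obtain y where y: "conv h y" by blast
    have "ev h V" if "opn V" "Pt y \<in> hat V" for V
      using y that Pt_hat[OF opn_sub[OF that(1)]] unfolding conv_def by blast
    moreover have "cpoint (Pt y)" using conv_ev_X(2)[OF y] by simp
    ultimately show ?thesis using lift by blast
  next
    case False
    then have "isend h" using not_isend hX conv_Pt by force
    then have "free_end h" using False hX unfolding free_end_def by blast
    then obtain r where r: "equiv_end h r" "rep r" by (rule rep_ex)
    then have "cpoint r" using cpoint_isend unfolding rep_def free_end_def by blast
    moreover have "ev h V" if "r \<in> hat V" for V using that equiv_end_sym[OF r(1)] unfolding hat_def
      by blast
    ultimately show ?thesis using lift by blast
  qed
qed

text \<open>Here the curve runs through new points, of which there may be infinitely many. Let h be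
  the germ of the base point x t: if h is a point, the curve is constant near e; otherwise the sides
  of the points near h inherit the neighbourhoods of h.\<close>

lemma germ_limit_ends:
  assumes e: "isend e" and x: "deffun x" and \<sigma>: "\<sigma> \<in> {Rgt, Lft}" and rep: "ev e {t. rep (\<sigma> (x t))}"
  shows "\<exists>g. cpoint g \<and> (\<forall>V. opn V \<and> tame V \<and> g \<in> hat V \<longrightarrow> ev e {t. \<sigma> (x t) \<in> hat V})"
proof -
  obtain h where h: "\<And>U. tame U \<Longrightarrow> ev h U \<longleftrightarrow> ev e {t. x t \<in> U}" using push_germ[OF x, of e] by blast
  have defgerm_\<sigma>: "defgerm (\<lambda>e. \<sigma> (e i))" for i using \<sigma> by (auto intro: defgerm_intros defterm_var)
  have tms: "tame {r. ev (\<sigma> r) U}" if "tame U" for U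
    by (rule tame_Collect) (intro defpred_ev_tame defgerm_\<sigma> that)
  show ?thesis
  proof (cases "isend h")
    case False
    then obtain p where p: "h = Pt p" using not_isend by blast
    then have ep: "ev e {t. x t \<in> {p}}" using h[OF tame_singleton, of p] by simp
    then obtain t where "rep (\<sigma> (x t))" "x t = p"
      using ev_meets[OF rep ep] by blast
    then have "cpoint (\<sigma> p)" using cpoint_isend \<sigma> by auto
    moreover have "ev e {t. \<sigma> (x t) \<in> hat V}" if "\<sigma> p \<in> hat V" for V
      by (rule ev_mono[OF ep]) (use that in auto)
    ultimately show ?thesis by blast
  next
    case True
    \<comment> \<open>If X were absent from h, it would be absent from the sides of the points near
      h, but each \<open>\<sigma> (x t)\<close> close to e is an end of X.\<close>
    have hX: "ev h X"
    proof (rule ccontr)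
      assume "\<not> ev h X"
      then have "ev h (- X)" using not_ev tame_X by blast
      then have "ev h {r. ev (\<sigma> r) (- X)}" by (rule ev_imp_sides) (use isend_not_Pt[OF True] \<sigma> in
        blast)+
      then have "ev e {t. x t \<in> {r. ev (\<sigma> r) (- X)}}" using h[OF tms[OF tame_compl[OF tame_X]]]
        by blast
      then obtain t where "rep (\<sigma> (x t))" "ev (\<sigma> (x t)) (- X)" using ev_meets[OF rep] by blast
      then show False unfolding rep_def free_end_def using ev_meets by blast
    qed
    show ?thesis
    proof (cases "\<exists>y. conv h y")
      case c: True
      then obtain y where y: "conv h y" by blast
      have "ev e {t. \<sigma> (x t) \<in> hat V}" if V: "opn V" "tame V" "Pt y \<in> hat V" for V
      proof -
        have "y \<in> V" using V Pt_hat[OF opn_sub] by blast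
        \<comment> \<open>The smaller neighbourhood is needed because membership in
          \<open>hat V\<close> concerns all ends equivalent to
          \<open>\<sigma> (x t)\<close>.\<close>
        then obtain v where v: "v \<in> Om" "y \<in> Bas v" "cl (Bas v) \<subseteq> V" using regular_Bas[OF V(1)]
          by blast
        then have "ev h (Bas v)" using y unfolding conv_Bas by blast
        then have "ev h {r. ev (\<sigma> r) (Bas v)}"
          by (rule ev_imp_sides) (use isend_not_Pt[OF True] \<sigma> in blast)+
        then have "ev e {t. x t \<in> {r. ev (\<sigma> r) (Bas v)}}" using h[OF tms[OF tame_Bas[OF v(1)]]]
          by blast
        with rep have "ev e ({t. rep (\<sigma> (x t))} \<inter> {t. x t \<in> {r. ev (\<sigma> r) (Bas v)}})"
          by (simp add: ev_Int_iff)
        then show ?thesis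
        proof (rule ev_mono, intro subsetI)
          fix t assume "t \<in> {t. rep (\<sigma> (x t))} \<inter> {t. x t \<in> {r. ev (\<sigma> r) (Bas v)}}"
          then have t: "rep (\<sigma> (x t))" "ev (\<sigma> (x t)) (Bas v)" by auto
          have "ev d V" if "equiv_end (\<sigma> (x t)) d" for d
            using equiv_end_closure[OF that _ t(2) V(1,2) v(3)] opn_sub[OF opn_Bas[OF v(1)]]
              by blast
          moreover have "equiv_end (\<sigma> (x t)) (\<sigma> (x t))" using t(1) free_end_equiv_end_refl
            unfolding rep_def by blast
          moreover have "cpoint (\<sigma> (x t))" using t(1) cpoint_isend \<sigma> by auto
          ultimately show "t \<in> {t. \<sigma> (x t) \<in> hat V}" unfolding hat_def by blast
        qed
      qed
      moreover have "cpoint (Pt y)" using conv_ev_X(2)[OF y] by simp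
      ultimately show ?thesis by blast
    next
      case False
      then have "free_end h" using True hX unfolding free_end_def by blast
      then obtain r where r: "equiv_end h r" "rep r" by (rule rep_ex)
      have "ev e {t. \<sigma> (x t) \<in> hat V}" if V: "tame V" "r \<in> hat V" for V
      proof -
        have "ev d V" if "equiv_end h d" for d
          using V(2) equiv_end_trans[OF equiv_end_sym[OF r(1)] that] unfolding hat_def by blast
        then obtain s where s: "side h s" "nbd h s \<subseteq> generic" "sat (nbd h s) \<subseteq> V"
          using equiv_end_small[OF True hX V(1)] by blast
        have "ev e {t. x t \<in> nbd h s}" using h[OF tame_nbd] ev_nbd[OF s(1)] by blast
        with rep have "ev e ({t. rep (\<sigma> (x t))} \<inter> {t. x t \<in> nbd h s})" by (simp add: ev_Int_iff)
        then show ?thesis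
        proof (rule ev_mono, intro subsetI)
          fix t assume "t \<in> {t. rep (\<sigma> (x t))} \<inter> {t. x t \<in> nbd h s}"
          then have t: "rep (\<sigma> (x t))" "x t \<in> nbd h s" by auto
          then have UEt: "free_end (\<sigma> (x t))" unfolding rep_def by blast
          then have endt: "isend (\<sigma> (x t))" "ev (\<sigma> (x t)) X" unfolding free_end_def by blast+
          have "ev (\<sigma> (x t)) (nbd h s)" using ev_nbd_sides[OF isend_not_Pt[OF True] t(2)] \<sigma> by auto
          then obtain s' where s': "side (\<sigma> (x t)) s'" "nbd (\<sigma> (x t)) s' \<subseteq> generic"
            "nbd (\<sigma> (x t)) s' \<subseteq> nbd h s"
            by (rule nbd_in[OF endt])
          \<comment> \<open>An end equivalent to \<open>\<sigma> (x t)\<close> lies in the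
            saturation of a set inside \<open>nbd h s\<close>, hence in V.\<close>
          have "ev d V" if "equiv_end (\<sigma> (x t)) d" for d
            using ev_mono[OF eqgD[OF that s'(1,2)]] sat_mono[OF s'(3)] s(3) by blast
          then show "t \<in> {t. \<sigma> (x t) \<in> hat V}"
            unfolding hat_def using free_end_equiv_end_refl[OF UEt] t(1) cpoint_isend[OF endt(1)]
              by blast
        qed
      qed
      moreover have "cpoint r" using r(2) cpoint_isend unfolding rep_def free_end_def by blast
      ultimately show ?thesis by blast
    qed
  qed
qed

end

section \<open>The compactification\<close>

text \<open>Labels have to be elements of the line, none of which is distinguished, so an injection
  of the naturals is chosen; five of its values are used.\<close>

definition lab :: "nat \<Rightarrow> 'a::unbounded_dense_linorder" where
  "lab = (SOME c. inj c)"

lemma inj_lab: "inj (lab :: nat \<Rightarrow> 'a::unbounded_dense_linorder)"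
proof -
  obtain a b :: 'a where "a < b" using gt_ex by blast
  then have "infinite {a<..<b}" by (rule infinite_Ioo)
  then have "\<exists>c :: nat \<Rightarrow> 'a. inj c" using infinite_countable_subset by blast
  then show ?thesis unfolding lab_def by (rule someI_ex)
qed

lemma lab_eq [simp]: "lab i = (lab j :: 'a::unbounded_dense_linorder) \<longleftrightarrow> i = j"
  using inj_lab by (rule inj_eq)

text \<open>One labelled copy of the line for points and one for each kind of side, with single
  entries for the two ends of the line. The finite range of second coordinates later bounds the
  dimension.\<close>

primrec code :: "'a::unbounded_dense_linorder germ \<Rightarrow> 'a list" where
  "code (Pt x) = [x, lab 0]"
| "code (Rgt t) = [t, lab 1]"
| "code (Lft t) = [t, lab 2]"
| "code PosInf = [lab 0, lab 3]"
| "code NegInf = [lab 0, lab 4]"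

lemma code_inject [simp]: "code g = code h \<longleftrightarrow> g = h"
  by (cases g; cases h) auto

lemma code_image [simp]: "code g \<in> code ` A \<longleftrightarrow> g \<in> A"
  by auto

lemma code_length: "length (code g) = 2"
  by (cases g) auto

text \<open>Decodes a label and a base point; the default \<open>NegInf\<close> makes the result an
  end for every label.\<close>

definition end_of :: "'a::unbounded_dense_linorder \<Rightarrow> 'a \<Rightarrow> 'a germ" where
  "end_of l t = (if l = lab 1 then Rgt t else if l = lab 2 then Lft t else if l =
      lab 3 then PosInf else NegInf)"

lemma end_of_ex: "isend g \<Longrightarrow> \<exists>l t. l \<noteq> lab 0 \<and> g = end_of l t"
proof (cases g)
  case (Rgt t)
  then show ?thesis by (intro exI[of _ "lab 1"] exI[of _ t]) (simp add: end_of_def)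
next
  case (Lft t)
  then show ?thesis by (intro exI[of _ "lab 2"] exI[of _ t]) (simp add: end_of_def)
next
  case PosInf
  then show ?thesis by (intro exI[of _ "lab 3"]) (simp add: end_of_def)
next
  case NegInf
  then show ?thesis by (intro exI[of _ "lab 4"]) (simp add: end_of_def)
qed auto

lemma isend_end_of: "isend (end_of l t)"
  by (simp add: end_of_def)

context expansion_line
begin

lemma defpred_code:
  assumes fh: "defterm f" "defterm h" and P: "\<And>K. defgerm K \<Longrightarrow> defpred (\<lambda>e. P (K e) e)"
  shows "defpred (\<lambda>e. [f e, h e] \<in> code ` {g. P g e})"
proof -
  have "defpred (\<lambda>e. (h e = lab 0 \<and> P (Pt (f e)) e) \<or> (h e = lab 1 \<and> P (Rgt (f e)) e) \<or>
      (h e = lab 2 \<and> P (Lft (f e)) e) \<or> (f e = lab 0 \<and> h e = lab 3 \<and> P PosInf e) \<or>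
      (f e = lab 0 \<and> h e = lab 4 \<and> P NegInf e))"
    by (intro defpred_rules P defgerm_intros fh)
  moreover have "[x, l] \<in> code ` {g. P g e} \<longleftrightarrow> (l = lab 0 \<and> P (Pt x) e) \<or> (l = lab 1 \<and> P (Rgt x) e) \<or>
      (l = lab 2 \<and> P (Lft x) e) \<or> (x = lab 0 \<and> l = lab 3 \<and> P PosInf e) \<or>
      (x = lab 0 \<and> l = lab 4 \<and> P NegInf e)" for x l e
  proof
    assume "[x, l] \<in> code ` {g. P g e}"
    then obtain g where "[x, l] = code g" "P g e" by blast
    then show "(l = lab 0 \<and> P (Pt x) e) \<or> (l = lab 1 \<and> P (Rgt x) e) \<or>
      (l = lab 2 \<and> P (Lft x) e) \<or> (x = lab 0 \<and> l = lab 3 \<and> P PosInf e) \<or>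
      (x = lab 0 \<and> l = lab 4 \<and> P NegInf e)" by (cases g) auto
  next
    have c: "code g \<in> code ` {g. P g e}" if "P g e" for g using that by simp
    assume "(l = lab 0 \<and> P (Pt x) e) \<or> (l = lab 1 \<and> P (Rgt x) e) \<or>
      (l = lab 2 \<and> P (Lft x) e) \<or> (x = lab 0 \<and> l = lab 3 \<and> P PosInf e) \<or>
      (x = lab 0 \<and> l = lab 4 \<and> P NegInf e)"
    then show "[x, l] \<in> code ` {g. P g e}"
      using c[of "Pt x"] c[of "Rgt x"] c[of "Lft x"] c[of PosInf] c[of NegInf] by auto
  qed
  ultimately show ?thesis by simp
qed

text \<open>The constructor of \<open>end_of\<close> varies with the label, so it is no family in
  the sense of \<open>defgerm\<close>; splitting on the label reduces it to such families.\<close>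

lemma defpred_end_of:
  assumes "defterm l" "defterm t" "\<And>K. defgerm K \<Longrightarrow> defpred (\<lambda>e. P (K e) e)"
  shows "defpred (\<lambda>e. P (end_of (l e) (t e)) e)"
proof -
  have "defpred (\<lambda>e. (l e = lab 1 \<and> P (Rgt (t e)) e) \<or> (\<not> l e = lab 1 \<and> l e = lab 2 \<and>
      P (Lft (t e)) e) \<or>
      (\<not> l e = lab 1 \<and> \<not> l e = lab 2 \<and> l e = lab 3 \<and> P PosInf e) \<or>
      (\<not> l e = lab 1 \<and> \<not> l e = lab 2 \<and> \<not> l e = lab 3 \<and> P NegInf e))"
    by (intro defpred_rules assms defgerm_intros)
  moreover have "P (end_of (l e) (t e)) e \<longleftrightarrow> (l e = lab 1 \<and> P (Rgt (t e)) e) \<or> (\<not> l e = lab 1 \<and> l e =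
      lab 2 \<and> P (Lft (t e)) e) \<or>
      (\<not> l e = lab 1 \<and> \<not> l e = lab 2 \<and> l e = lab 3 \<and> P PosInf e) \<or>
      (\<not> l e = lab 1 \<and> \<not> l e = lab 2 \<and> \<not> l e = lab 3 \<and> P NegInf e)" for e
    unfolding end_of_def by auto
  ultimately show ?thesis by simp
qed

lemma deftuple_nth: "deftuple n L \<Longrightarrow> i < n \<Longrightarrow> defterm (\<lambda>e. L e ! i)"
  by (simp add: deftuple_def)

lemma deftuple_take: "deftuple n L \<Longrightarrow> m \<le> n \<Longrightarrow> deftuple m (\<lambda>e. take m (L e))"
  by (simp add: deftuple_def)

end

section \<open>The dimension bound, and convergence of curves in terms of germs\<close>

lemma ointerval_contains:
  fixes a b :: "'a::unbounded_dense_linorder extended"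
  assumes "a < b"
  shows "\<exists>l u. l < u \<and> {l<..<u} \<subseteq> ointerval a b"
proof -
  obtain l u where "l < u" "a \<le> Fin l" "Fin u \<le> b"
  proof (cases a; cases b)
    fix x y assume "a = Fin x" "b = Fin y"
    then show ?thesis using assms that[of x y] by auto
  next
    fix x assume *: "a = Fin x" "b = Pinf"
    obtain y where "x < y" using gt_ex by blast
    then show ?thesis using * that[of x y] by auto
  next
    fix y assume *: "a = Minf" "b = Fin y"
    obtain x where "x < y" using lt_ex by blast
    then show ?thesis using * that[of x y] by auto
  next
    assume *: "a = Minf" "b = Pinf"
    obtain x y :: 'a where "x < y" using gt_ex by blast
    then show ?thesis using * that[of x y] by auto
  qed (use assms in auto)
  moreover from this have "{l<..<u} \<subseteq> ointerval a b"
    unfolding ointerval_def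
    by (auto intro: le_less_trans[of a "Fin l"] less_le_trans[of _ "Fin u" b])
  ultimately show ?thesis by blast
qed

lemma infinite_ointerval: "a < b \<Longrightarrow> infinite (ointerval a (b :: 'a::unbounded_dense_linorder
    extended))"
  using ointerval_contains[of a b] infinite_Ioo finite_subset by metis

lemma cell_basic:
  assumes "cell M ds (C :: 'a::unbounded_dense_linorder list set)"
  shows "C \<noteq> {} \<and> (\<forall>x\<in>C. length x = length ds) \<and> set ds \<subseteq> {0, 1}"
  using assms
proof induction
  case (band ds C f g)
  then have "C \<noteq> {}" by simp
  then obtain x where "x \<in> C" by auto
  then have "f x < g x" using band by simp
  then have "infinite (ointerval (f x) (g x))" by (rule infinite_ointerval)
  then obtain t where "t \<in> ointerval (f x) (g x)" using infinite_imp_nonempty by blast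
  with \<open>x \<in> C\<close> band show ?case by auto
qed auto

text \<open>A two-dimensional cell would contain a vertical interval, which is infinite, whereas
  second coordinates range over the finite set F.\<close>

lemma odim_le_1:
  fixes S :: "'a::unbounded_dense_linorder list set"
  assumes "\<And>x. x \<in> S \<Longrightarrow> \<exists>t l. x = [t, l] \<and> l \<in> F" "finite F"
  shows "odim M S \<le> 1"
  unfolding odim_def
proof (rule Sup_least)
  fix r assume "r \<in> {ereal (real (sum_list ds)) |ds C. cell M ds C \<and> C \<subseteq> S}"
  then obtain ds C where r: "r = ereal (real (sum_list ds))" and C: "cell M ds C" "C \<subseteq> S" by blast
  have "C \<noteq> {}" using cell_basic[OF C(1)] by simp
  then obtain x where x: "x \<in> C" by auto
  then obtain t l where "x = [t, l]" using assms(1)[of x] C(2) by blast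
  then have "length ds = 2" using cell_basic[OF C(1)] x by force
  from C(1) have "sum_list ds \<le> 1"
  proof cases
    case (graph ds' C' h)
    then obtain d where "ds' = [d]" using \<open>length ds = 2\<close> by (auto simp: length_Suc_conv)
    then show ?thesis using graph cell_basic[OF C(1)] by auto
  next
    case (band ds' C' f g)
    then have "C' \<noteq> {}" using cell_basic[of M ds' C'] by simp
    then obtain y where y: "y \<in> C'" by auto
    have "ointerval (f y) (g y) \<subseteq> F"
    proof
      fix t assume "t \<in> ointerval (f y) (g y)"
      then have "y @ [t] \<in> S" using band y C(2) by blast
      then show "t \<in> F" using assms(1) by (metis append1_eq_conv append_Cons append_Nil)
    qed
    then show ?thesis using infinite_ointerval[OF band(6)[OF y]] assms(2) finite_subset by blast
  qed (use \<open>length ds = 2\<close> in simp)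
  then show "r \<le> 1" using r by simp
qed

text \<open>The germ approached at a left bound. Such a bound is never \<open>Pinf\<close> in a
  nonempty interval; the default there keeps \<open>isend_boundary\<close> unconditional, and
  likewise for \<open>Minf\<close> in \<open>right_germ\<close>.\<close>

primrec left_germ :: "'a extended \<Rightarrow> 'a germ" where
  "left_germ (Fin t) = Rgt t" | "left_germ Minf = NegInf" | "left_germ Pinf = PosInf"

primrec right_germ :: "'a extended \<Rightarrow> 'a germ" where
  "right_germ (Fin t) = Lft t" | "right_germ Minf = NegInf" | "right_germ Pinf = PosInf"

lemma isend_boundary: "isend (left_germ a)" "isend (right_germ a)"
  by (cases a; simp)+

lemma ointerval_left:
  fixes a b :: "'a::unbounded_dense_linorder extended"
  assumes "a < b"
  shows "ev (left_germ a) A \<longleftrightarrow> (\<exists>s\<in>ointerval a b. ointerval a (Fin s) \<subseteq> A)"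
proof -
  obtain l u where lu: "l < u" "{l<..<u} \<subseteq> ointerval a b" using ointerval_contains[OF assms]
    by blast
  obtain m where "l < m" "m < u" using dense[OF lu(1)] by blast
  then have m: "a < Fin m" "Fin m < b" using lu(2) by (auto simp: ointerval_def)
  show ?thesis
  proof
    assume "ev (left_germ a) A"
    then obtain s where s: "side (left_germ a) s" "nbd (left_germ a) s \<subseteq> A" unfolding ev_def
      by blast
    have "a < Fin (min s m)" using s(1) m by (cases a) auto
    moreover have "Fin (min s m) < b" using m(2) by (cases b) (auto simp: min_less_iff_disj)
    moreover have "ointerval a (Fin (min s m)) \<subseteq> A" using s(2) m
      by (cases a) (auto simp: ointerval_def)
    ultimately show "\<exists>s\<in>ointerval a b. ointerval a (Fin s) \<subseteq> A" by (intro bexI[of _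
      "min s m"]) (auto simp: ointerval_def)
  next
    assume "\<exists>s\<in>ointerval a b. ointerval a (Fin s) \<subseteq> A"
    then obtain s where "a < Fin s" "ointerval a (Fin s) \<subseteq> A" by (auto simp: ointerval_def)
    then show "ev (left_germ a) A" unfolding ev_def
      by (cases a) (auto simp: ointerval_def intro!: exI[of _ s])
  qed
qed

lemma ointerval_right:
  fixes a b :: "'a::unbounded_dense_linorder extended"
  assumes "a < b"
  shows "ev (right_germ b) A \<longleftrightarrow> (\<exists>s\<in>ointerval a b. ointerval (Fin s) b \<subseteq> A)"
proof -
  obtain l u where lu: "l < u" "{l<..<u} \<subseteq> ointerval a b" using ointerval_contains[OF assms]
    by blast
  obtain m where "l < m" "m < u" using dense[OF lu(1)] by blast
  then have m: "a < Fin m" "Fin m < b" using lu(2) by (auto simp: ointerval_def)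
  show ?thesis
  proof
    assume "ev (right_germ b) A"
    then obtain s where s: "side (right_germ b) s" "nbd (right_germ b) s \<subseteq> A" unfolding ev_def
      by blast
    have "Fin (max s m) < b" using s(1) m by (cases b) auto
    moreover have "a < Fin (max s m)" using m(1) by (cases a) (auto simp: less_max_iff_disj)
    moreover have "ointerval (Fin (max s m)) b \<subseteq> A" using s(2) m
      by (cases b) (auto simp: ointerval_def)
    ultimately show "\<exists>s\<in>ointerval a b. ointerval (Fin s) b \<subseteq> A" by (intro bexI[of _
      "max s m"]) (auto simp: ointerval_def)
  next
    assume "\<exists>s\<in>ointerval a b. ointerval (Fin s) b \<subseteq> A"
    then obtain s where "Fin s < b" "ointerval (Fin s) b \<subseteq> A" by (auto simp: ointerval_def)
    then show "ev (right_germ b) A" unfolding ev_def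
      by (cases b) (auto simp: ointerval_def intro!: exI[of _ s])
  qed
qed

lemma converges_left_iff:
  fixes a b :: "'a::unbounded_dense_linorder extended"
  shows "a < b \<Longrightarrow> converges_left T a b \<gamma> x \<longleftrightarrow> (\<forall>U. openin T U \<and> x \<in> U \<longrightarrow>
      ev (left_germ a) {t. \<gamma> t \<in> U})"
  unfolding converges_left_def by (simp add: ointerval_left subset_iff Ball_def)

lemma converges_right_iff:
  fixes a b :: "'a::unbounded_dense_linorder extended"
  shows "a < b \<Longrightarrow> converges_right T a b \<gamma> x \<longleftrightarrow> (\<forall>U. openin T U \<and> x \<in> U \<longrightarrow>
      ev (right_germ b) {t. \<gamma> t \<in> U})"
  unfolding converges_right_def by (simp add: ointerval_right subset_iff Ball_def)

section \<open>The topology on the enlarged space and its definable compactness\<close>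

context regular_line
begin

text \<open>Generated by the hats of definable open sets; definability of V keeps the decidedness of
  germs available for these neighbourhoods.\<close>

definition ctop :: "'a list topology" where
  "ctop = topology (\<lambda>U. U \<subseteq> code ` {g. cpoint g} \<and>
    (\<forall>g. code g \<in> U \<longrightarrow> (\<exists>V. opn V \<and> tame V \<and> g \<in> hat V \<and> code ` hat V \<subseteq> U)))"

lemma openin_ctop: "openin ctop U \<longleftrightarrow> U \<subseteq> code ` {g. cpoint g} \<and>
    (\<forall>g. code g \<in> U \<longrightarrow> (\<exists>V. opn V \<and> tame V \<and> g \<in> hat V \<and> code ` hat V \<subseteq> U))"
proof -
  let ?P = "\<lambda>U. U \<subseteq> code ` {g. cpoint g} \<and>
    (\<forall>g. code g \<in> U \<longrightarrow> (\<exists>V. opn V \<and> tame V \<and> g \<in> hat V \<and> code ` hat V \<subseteq> U))"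
  have "istopology ?P"
    unfolding istopology_def
  proof (intro conjI allI impI)
    fix S T g assume S: "?P S" and T: "?P T" and g: "code g \<in> S \<inter> T"
    then obtain V W where "opn V" "tame V" "g \<in> hat V" "code ` hat V \<subseteq> S"
      "opn W" "tame W" "g \<in> hat W" "code ` hat W \<subseteq> T" by (meson IntD1 IntD2)
    then show "\<exists>V. opn V \<and> tame V \<and> g \<in> hat V \<and> code ` hat V \<subseteq> S \<inter> T"
      using opn_Int tame_Int hat_Int by (intro exI[of _ "V \<inter> W"]) auto
  next
    fix \<K> g assume K: "\<forall>K\<in>\<K>. ?P K" and "code g \<in> \<Union>\<K>"
    then obtain K where KK: "K \<in> \<K>" "code g \<in> K" by blast
    then obtain V where "opn V" "tame V" "g \<in> hat V" "code ` hat V \<subseteq> K" using bspec[OF K KK(1)]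
      by blast
    moreover have "K \<subseteq> \<Union>\<K>" using KK(1) by blast
    ultimately show "\<exists>V. opn V \<and> tame V \<and> g \<in> hat V \<and> code ` hat V \<subseteq> \<Union>\<K>"
      by (intro exI[of _ V]) simp
  qed (blast, simp add: Union_least)
  then show ?thesis unfolding ctop_def by (simp only: topology_inverse')
qed

lemma openin_hat: "opn V \<Longrightarrow> tame V \<Longrightarrow> openin ctop (code ` hat V)"
  unfolding openin_ctop using hat_cpoint by auto

lemma topspace_ctop: "topspace ctop = code ` {g. cpoint g}"
proof
  show "topspace ctop \<subseteq> code ` {g. cpoint g}" using openin_ctop[of "topspace ctop"] by simp
  have "code ` {g. cpoint g} \<subseteq> code ` hat X" using hat_X by blast
  then show "code ` {g. cpoint g} \<subseteq> topspace ctop"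
    using openin_subset[OF openin_hat[OF opn_X tame_X]] by blast
qed

lemma Hausdorff_ctop: "Hausdorff_space ctop"
  unfolding Hausdorff_space_def topspace_ctop
proof (intro allI impI)
  fix x y assume "x \<in> code ` {g. cpoint g} \<and> y \<in> code ` {g. cpoint g} \<and> x \<noteq> y"
  then obtain g h where gh: "x = code g" "y = code h" "cpoint g" "cpoint h" "g \<noteq> h" by blast
  then obtain U V where UV: "opn U" "tame U" "opn V" "tame V" "g \<in> hat U" "h \<in> hat V" "U \<inter> V = {}"
    using hat_separate by blast
  have "code ` hat U \<inter> code ` hat V = {}" using hat_disjoint[OF UV(7)] by auto
  then show "\<exists>U V. openin ctop U \<and> openin ctop V \<and> x \<in> U \<and> y \<in> V \<and> disjnt U V"
    unfolding disjnt_def using UV gh openin_hat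
    by (intro exI[of _ "code ` hat U"] exI[of _ "code ` hat V"]) auto
qed

lemma odim_ctop: "odim M (topspace ctop) \<le> 1"
proof (rule odim_le_1[where F = "{lab 0, lab 1, lab 2, lab 3, lab 4}"])
  fix x assume "x \<in> topspace ctop"
  then obtain g where "x = code g" unfolding topspace_ctop by blast
  then show "\<exists>t l. x = [t, l] \<and> l \<in> {lab 0, lab 1, lab 2, lab 3, lab 4}" by (cases g) auto
qed simp

text \<open>A basic open set is named by \<open>u @ [l, t, s]\<close>: the label \<open>l\<close> selects between the given basis
  (parameter \<open>u\<close>) and the saturation of a one-sided interval at the end \<open>end_of l t\<close>.\<close>

definition par_ok :: "'a list \<Rightarrow> bool" where
  "par_ok w \<longleftrightarrow> w ! k = lab 0 \<and> take k w \<in> Om \<or>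
    \<not> w ! k = lab 0 \<and> side (end_of (w ! k) (w ! (k + 1))) (w ! (k + 2)) \<and>
    (\<forall>r. r \<in> nbd (end_of (w ! k) (w ! (k + 1))) (w ! (k + 2)) \<longrightarrow> r \<in> generic)"

definition par_mem :: "'a list \<Rightarrow> 'a \<Rightarrow> bool" where
  "par_mem w r \<longleftrightarrow> w ! k = lab 0 \<and> (take k w \<in> Om \<and> r \<in> Bas (take k w)) \<or>
    \<not> w ! k = lab 0 \<and> (\<exists>a. a \<in> nbd (end_of (w ! k) (w ! (k + 1))) (w ! (k + 2)) \<and> tied r a)"

lemma defpred_par_ok:
  assumes L: "deftuple (k + 3) L"
  shows "defpred (\<lambda>e. par_ok (L e))"
proof -
  have n: "defterm (\<lambda>e. L e ! k)" "defterm (\<lambda>e. L e ! (k + 1))" "defterm (\<lambda>e. L e ! (k + 2))"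
    using deftuple_nth[OF L] by auto
  have 1: "defpred (\<lambda>e. side (K e) (L e ! (k + 2)) \<and> (\<forall>r. r \<in> nbd (K e) (L e ! (k + 2)) \<longrightarrow>
      r \<in> generic))" if "defgerm K" for K
    by (intro defpred_rules defpred_side defpred_nbd that defgerm_ren[OF that] n defterm_ren[OF
      n(3)] defpred_tame[OF tame_generic])
  show ?thesis
    unfolding par_ok_def
    by (intro defpred_rules n defpred_Om deftuple_take[OF L] defpred_end_of[OF n(1,2) 1]) simp
qed

lemma defpred_par_mem:
  assumes L: "deftuple (k + 3) L" and f: "defterm f"
  shows "defpred (\<lambda>e. par_mem (L e) (f e))"
proof -
  have n: "defterm (\<lambda>e. L e ! k)" "defterm (\<lambda>e. L e ! (k + 1))" "defterm (\<lambda>e. L e ! (k + 2))"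
    using deftuple_nth[OF L] by auto
  have 1: "defpred (\<lambda>e. \<exists>a. a \<in> nbd (K e) (L e ! (k + 2)) \<and> tied (f e) a)" if "defgerm K" for K
    by (intro defpred_rules defpred_nbd defgerm_ren[OF that] defterm_ren[OF n(3)] defpred_tied
      defterm_ren[OF f])
  show ?thesis
    unfolding par_mem_def
    by (intro defpred_rules n defpred_Bas f deftuple_take[OF L] defpred_end_of[OF n(1,2), of
      "\<lambda>g e. \<exists>a. a \<in> nbd g (L e ! (k + 2)) \<and> tied (f e) a", OF 1]) simp
qed

lemma par_Bas: "u \<in> Om \<Longrightarrow> par_ok (u @ [lab 0, t, s]) \<and> {r. par_mem (u @ [lab 0, t, s]) r} = Bas u"
  using Om_length[of u] by (auto simp: par_ok_def par_mem_def)

lemma par_sat: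
  "length u = k \<Longrightarrow> l \<noteq> lab 0 \<Longrightarrow>
    (par_ok (u @ [l, t, s]) \<longleftrightarrow> side (end_of l t) s \<and> nbd (end_of l t) s \<subseteq> generic) \<and>
    {r. par_mem (u @ [l, t, s]) r} = sat (nbd (end_of l t) s)"
  by (auto simp: par_ok_def par_mem_def nth_append sat_def)

lemma par_opn:
  assumes "par_ok w"
  shows "opn {r. par_mem w r} \<and> tame {r. par_mem w r}"
proof (cases "w ! k = lab 0")
  case True
  then have "{r. par_mem w r} = Bas (take k w)" "take k w \<in> Om"
    using assms by (auto simp: par_ok_def par_mem_def)
  then show ?thesis using opn_Bas tame_Bas by simp
next
  case False
  then have "{r. par_mem w r} = sat (nbd (end_of (w ! k) (w ! (k + 1))) (w ! (k + 2)))"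
    "nbd (end_of (w ! k) (w ! (k + 1))) (w ! (k + 2)) \<subseteq> generic"
    using assms by (auto simp: par_ok_def par_mem_def sat_def)
  then show ?thesis using opn_sat_nbd[OF isend_end_of] tame_sat[OF tame_nbd] by simp
qed

lemma definable_ctop: "definable_top_space M 2 ctop"
  unfolding definable_top_space_def
proof (intro conjI)
  have "defpred (\<lambda>e. [e 0, e 1] \<in> code ` {g. cpoint g})"
    by (rule defpred_code[where P = "\<lambda>g e. cpoint g"]) (intro defterm_var defpred_cpoint)+
  from definable_of_defpred[OF this, of 2 "\<lambda>_. undefined"]
  show "definable M 2 (topspace ctop)"
  proof (rule back_subst[where P = "definable M 2"])
    have *: "length xs = 2 \<Longrightarrow> [xs ! 0, xs ! 1] = xs" for xs :: "'a list"
      by (auto simp: length_Suc_conv numeral_2_eq_2)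
    show "{xs. length xs = 2 \<and> [if (0::nat) < 2 then xs ! 0 else undefined,
        if (1::nat) < 2 then xs ! 1 else undefined] \<in> code ` {g. cpoint g}} = topspace ctop"
      unfolding topspace_ctop using * code_length by auto
  qed
  define \<Omega> where "\<Omega> = {w. length w = k + 3 \<and> par_ok w}"
  define B where "B w = code ` hat {r. par_mem w r}" for w
  have "definable_family M 2 (B ` \<Omega>)"
    unfolding definable_family_def
  proof (intro exI conjI)
    have take_map: "map (\<lambda>i. if i < n then xs ! i else d i) [0..<m] = take m xs"
      if "length xs = n" "m \<le> n" for xs :: "'a list" and n m d
      using that by (intro nth_equalityI) auto
    have "defpred (\<lambda>e. par_ok (map e [0..<k + 3]))" by (intro defpred_par_ok deftuple_vars)
    from definable_of_defpred[OF this, of "k + 3" "\<lambda>_. undefined"]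
    show "definable M (k + 3) \<Omega>"
      by (rule back_subst[where P = "definable M (k + 3)"]) (auto simp: \<Omega>_def take_map simp del:
        upt_Suc)
    show "\<forall>u\<in>\<Omega>. \<forall>x\<in>B u. length x = 2" unfolding B_def using code_length by auto
    have L: "deftuple (k + 3) (\<lambda>e. map (\<lambda>i. e (\<rho> i)) [0..<k + 3])" for \<rho> by (rule deftuple_ren)
    have "defpred (\<lambda>e. [e (k + 3), e (k + 4)] \<in> code ` {g. g \<in> hat {r. par_mem (map e [0..<k + 3])
        r}})"
      by (rule defpred_code[where P = "\<lambda>g e. g \<in> hat {r. par_mem (map e [0..<k + 3]) r}"])
        (intro defterm_var defpred_hat defpred_par_mem L; assumption)+
    then have "defpred (\<lambda>e. par_ok (map e [0..<k + 3]) \<and>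
        [e (k + 3), e (k + 4)] \<in> code ` hat {r. par_mem (map e [0..<k + 3]) r})"
      by (intro defpred_conj defpred_par_ok deftuple_vars) simp
    from definable_of_defpred[OF this, of "k + 3 + 2" "\<lambda>_. undefined"]
    show "definable M (k + 3 + 2) {u @ x |u x. u \<in> \<Omega> \<and> x \<in> B u}"
    proof (rule back_subst[where P = "definable M (k + 3 + 2)"])
      let ?E = "\<lambda>xs i. if i < k + 3 + 2 then xs ! i else undefined"
      show "{xs. length xs = k + 3 + 2 \<and> par_ok (map (?E xs) [0..<k + 3]) \<and>
          [?E xs (k + 3), ?E xs (k + 4)] \<in> code ` hat {r. par_mem (map (?E xs) [0..<k + 3]) r}} =
          {u @ x |u x. u \<in> \<Omega> \<and> x \<in> B u}" (is "?L = ?R")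
      proof (intro set_eqI iffI)
        fix xs assume "xs \<in> ?L"
        then have xs: "length xs = k + 3 + 2" "par_ok (take (k + 3) xs)"
          "[xs ! (k + 3), xs ! (k + 4)] \<in> B (take (k + 3) xs)"
          using take_map[of xs "k + 3 + 2" "k + 3"] by (auto simp: B_def)
        have "xs = take (k + 3) xs @ [xs ! (k + 3), xs ! (k + 4)]"
        proof -
          have "xs = take (k + 3) xs @ drop (k + 3) xs" by simp
          moreover have "drop (k + 3) xs = [xs ! (k + 3), xs ! (k + 4)]"
            using xs(1) Cons_nth_drop_Suc[of "k + 3" xs] Cons_nth_drop_Suc[of "k + 4" xs]
            by (simp add: numeral_eq_Suc)
          ultimately show ?thesis by simp
        qed
        moreover have "take (k + 3) xs \<in> \<Omega>" using xs by (simp add: \<Omega>_def)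
        ultimately show "xs \<in> ?R" using xs(3) by blast
      next
        fix xs assume "xs \<in> ?R"
        then obtain u x where ux: "xs = u @ x" "u \<in> \<Omega>" "x \<in> B u" by blast
        then have len: "length u = k + 3" "length x = 2" using code_length
          by (auto simp: \<Omega>_def B_def)
        then obtain a b where x: "x = [a, b]" by (auto simp: length_Suc_conv numeral_2_eq_2)
        have "take (k + 3) xs = u" "xs ! (k + 3) = a" "xs ! (k + 4) = b" "length xs = k + 3 + 2"
          using ux(1) len x by (auto simp: nth_append)
        then show "xs \<in> ?L"
          using ux x take_map[of xs "k + 3 + 2" "k + 3"]
            by (auto simp: B_def \<Omega>_def simp del: upt_Suc)
      qed
    qed
  qed (rule refl)
  moreover have "openin ctop V" if "V \<in> B ` \<Omega>" for V
    using that par_opn openin_hat unfolding B_def \<Omega>_def by blast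
  moreover have "\<exists>V\<in>B ` \<Omega>. x \<in> V \<and> V \<subseteq> U" if U: "openin ctop U" "x \<in> U" for U x
  proof -
    obtain g where g: "x = code g" using U unfolding openin_ctop by blast
    then obtain V where V: "opn V" "tame V" "g \<in> hat V" "code ` hat V \<subseteq> U"
      using U unfolding openin_ctop by blast
    from hat_base[OF V(3,1,2)] obtain w where w: "length w = k + 3" "par_ok w"
      "g \<in> hat {r. par_mem w r}" "{r. par_mem w r} \<subseteq> V"
    proof (elim disjE bexE conjE exE)
      fix u assume u: "u \<in> Om" "g \<in> hat (Bas u)" "Bas u \<subseteq> V"
      then show ?thesis
        using par_Bas[OF u(1), of undefined undefined] Om_length[OF u(1)]
        by (intro that[of "u @ [lab 0, undefined, undefined]"]) auto
    next
      fix s assume e: "isend g" and s: "side g s" "nbd g s \<subseteq> generic" "g \<in> hat (sat (nbd g s))"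
        "sat (nbd g s) \<subseteq> V"
      obtain l t where lt: "l \<noteq> lab 0" "g = end_of l t" using end_of_ex[OF e] by blast
      \<comment> \<open>The label l selects the saturations, so the first k entries are filled with
        a dummy tuple.\<close>
      show ?thesis
        using par_sat[of "replicate k undefined" l t s] s lt
        by (intro that[of "replicate k undefined @ [l, t, s]"]) auto
    qed
    then have "x \<in> B w" "B w \<subseteq> U" "w \<in> \<Omega>"
      using g V(4) hat_mono[OF w(4)] by (auto simp: B_def \<Omega>_def)
    then show ?thesis by blast
  qed
  ultimately show "\<exists>\<B>. definable_family M 2 \<B> \<and> (\<forall>V\<in>\<B>. openin ctop V) \<and>
      (\<forall>U x. openin ctop U \<and> x \<in> U \<longrightarrow> (\<exists>V\<in>\<B>. x \<in> V \<and> V \<subseteq> U))"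
    by (intro exI[of _ "B ` \<Omega>"]) simp
qed

text \<open>The label is a definable function with finitely many values near e, hence constant
  there. The curve thus stays among the points of X, among the sides of one kind, or at a single
  infinity.\<close>

lemma curve_limit:
  assumes e: "isend e" and x: "deffun x" and l: "deffun l"
    and \<gamma>: "ev e {t. [x t, l t] \<in> code ` {g. cpoint g}}"
  shows "\<exists>g. cpoint g \<and> (\<forall>U. openin ctop U \<and> code g \<in> U \<longrightarrow> ev e {t. [x t, l t] \<in> U})"
proof -
  have lift: "\<exists>g. cpoint g \<and> (\<forall>U. openin ctop U \<and> code g \<in> U \<longrightarrow> ev e {t. [x t, l t] \<in> U})"
    if g: "cpoint g" "\<And>V. opn V \<Longrightarrow> tame V \<Longrightarrow> g \<in> hat V \<Longrightarrow> ev e {t. h t \<in> hat V}"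
      and h: "ev e {t. [x t, l t] = code (h t)}" for g h
  proof (intro exI conjI allI impI)
    fix U assume U: "openin ctop U \<and> code g \<in> U"
    then obtain V where V: "opn V" "tame V" "g \<in> hat V" "code ` hat V \<subseteq> U" unfolding openin_ctop
      by blast
    have "ev e ({t. h t \<in> hat V} \<inter> {t. [x t, l t] = code (h t)})"
      using g(2)[OF V(1-3)] h by (simp add: ev_Int_iff)
    then show "ev e {t. [x t, l t] \<in> U}" by (rule ev_mono) (use V(4) in auto)
  qed (rule g(1))
  have tml: "tame {t. l t = lab j}" for j
    by (rule tame_Collect) (intro defpred_rules defterm_app[OF l])
  have lab: "\<exists>j\<in>{0,1,2,3,4}. ev e {t. l t = lab j}"
  proof (rule ccontr)
    assume "\<not> ?thesis"
    then have no: "ev e (- {t. l t = lab j})" if "j \<in> {0,1,2,3,4}" for j using not_ev[OF tml] that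
      by blast
    have "ev e (- {t. l t = lab 0} \<inter> - {t. l t = lab 1} \<inter> - {t. l t = lab 2} \<inter> - {t. l t =
        lab 3} \<inter> - {t. l t = lab 4})"
      using no[of 0] no[of 1] no[of 2] no[of 3] no[of 4] by (simp only: ev_Int_iff) simp
    from ev_meets[OF \<gamma> this] obtain t g where "[x t, l t] = code g"
      "l t \<noteq> lab 0" "l t \<noteq> lab 1" "l t \<noteq> lab 2" "l t \<noteq> lab 3" "l t \<noteq> lab 4" by blast
    then show False by (cases g) auto
  qed
  then obtain j where j: "j \<in> {0,1,2,3,4}" "ev e {t. l t = lab j}" by blast
  have both: "ev e ({t. [x t, l t] \<in> code ` {g. cpoint g}} \<inter> {t. l t = lab j})"
    using \<gamma> j(2) by (simp add: ev_Int_iff)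
  have conv: "ev e {t. P t}" if "\<And>t g. [x t, lab j] = code g \<Longrightarrow> cpoint g \<Longrightarrow> P t" for P
    by (rule ev_mono[OF both]) (use that in auto)
  show ?thesis
  proof (cases "j = 0")
    case True
    have "ev e {t. x t \<in> X}"
    proof (rule conv)
      fix t g assume "[x t, lab j] = code g" "cpoint g"
      then show "x t \<in> X" using True by (cases g) auto
    qed
    from germ_limit_points[OF e x this] obtain g where
      "cpoint g" "\<And>V. opn V \<Longrightarrow> tame V \<Longrightarrow> g \<in> hat V \<Longrightarrow> ev e {t. Pt (x t) \<in> hat V}" by blast
    moreover have "ev e {t. [x t, l t] = code (Pt (x t))}"
      by (rule ev_mono[OF j(2)]) (use True in auto)
    ultimately show ?thesis by (rule lift)
  next
    case False
    show ?thesis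
    proof (cases "j = 1 \<or> j = 2")
      case True
      have "\<exists>\<sigma>\<in>{Rgt, Lft}. \<forall>t :: 'a. code (\<sigma> t) = [t, lab j]" using True by auto
      then obtain \<sigma> where \<sigma>: "\<sigma> \<in> {Rgt, Lft}" "\<And>t :: 'a. code (\<sigma> t) = [t, lab j]" by blast
      have "ev e {t. rep (\<sigma> (x t))}"
      proof (rule conv)
        fix t g assume "[x t, lab j] = code g" "cpoint g"
        then have "g = \<sigma> (x t)" using \<sigma>(2) by (metis code_inject)
        then show "rep (\<sigma> (x t))" using \<open>cpoint g\<close> \<sigma>(1) by auto
      qed
      from germ_limit_ends[OF e x \<sigma>(1) this] obtain g where
        "cpoint g" "\<And>V. opn V \<Longrightarrow> tame V \<Longrightarrow> g \<in> hat V \<Longrightarrow> ev e {t. \<sigma> (x t) \<in> hat V}" by blast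
      moreover have "ev e {t. [x t, l t] = code (\<sigma> (x t))}"
        by (rule ev_mono[OF j(2)]) (use \<sigma>(2) in auto)
      ultimately show ?thesis by (rule lift)
    next
      case False
      then have "j = 3 \<or> j = 4" using \<open>j \<noteq> 0\<close> j(1) by auto
      then have "\<exists>g :: 'a germ. g \<in> {PosInf, NegInf} \<and> code g = [lab 0, lab j]" by force
      then obtain g :: "'a germ" where g: "g \<in> {PosInf, NegInf}" "code g = [lab 0, lab j]" by blast
      have eq: "g' = g \<and> x t = lab 0" if "[x t, lab j] = code g'" for t g'
        using that g False \<open>j \<noteq> 0\<close> by (cases g') auto
      obtain t g' where "[x t, lab j] = code g'" "cpoint g'" using ev_ex[OF both] by auto
      then have "cpoint g" using eq by blast
      moreover have "ev e {t. g \<in> hat V}" if "g \<in> hat V" for V using that by (simp add: ev_UNIV)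
      moreover have "ev e {t. [x t, l t] = code g}"
      proof -
        have "ev e {t. x t = lab 0}" by (rule conv) (use eq in blast)
        then have "ev e ({t. x t = lab 0} \<inter> {t. l t = lab j})" using j(2) by (simp add: ev_Int_iff)
        then show ?thesis by (rule ev_mono) (use g(2) in auto)
      qed
      ultimately show ?thesis by (intro lift)
    qed
  qed
qed

lemma definably_compact_ctop: "definably_compact M 2 ctop"
  unfolding definably_compact_def
proof (intro allI impI)
  fix a b \<gamma> assume "definable_curve M 2 (topspace ctop) a b \<gamma>"
  then have ab: "a < b" and \<gamma>: "\<gamma> ` ointerval a b \<subseteq> code ` {g. cpoint g}"
    and gr: "definable M (Suc 2) ((\<lambda>t. t # \<gamma> t) ` ointerval a b)"
    unfolding definable_curve_def topspace_ctop by blast+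
  \<comment> \<open>The coordinates are continued by the identity outside the interval, as
    \<open>deffun\<close> concerns total functions.\<close>
  define x where "x t = (if t \<in> ointerval a b then \<gamma> t ! 0 else t)" for t
  define l where "l t = (if t \<in> ointerval a b then \<gamma> t ! 1 else t)" for t
  have eq: "\<gamma> t = [x t, l t]" if "t \<in> ointerval a b" for t
  proof -
    have "\<gamma> t \<in> code ` {g. cpoint g}" using \<gamma> that by blast
    then have "length (\<gamma> t) = 2" using code_length by auto
    then show ?thesis using that by (auto simp: x_def l_def length_Suc_conv numeral_2_eq_2)
  qed
  let ?Gr = "(\<lambda>t. t # \<gamma> t) ` ointerval a b"
  have Gr: "[t, y, y'] \<in> ?Gr \<longleftrightarrow> t \<in> ointerval a b \<and> y = x t \<and> y' = l t" for t y y'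
    using eq by auto
  have dpGr: "defpred (\<lambda>e. [f e, g e, h e] \<in> ?Gr)" if "defterm f" "defterm g" "defterm h" for f g h
    using defpred_definable[OF gr, of "\<lambda>e. [f e, g e,
        h e]"] deftuple_Cons[OF that(1) deftuple_Cons[OF that(2) deftuple_Cons[OF that(3)
        deftuple_Nil]]]
    by (simp add: numeral_2_eq_2)
  have "defpred (\<lambda>e. (\<exists>z. [e 1, e 0, z] \<in> ?Gr) \<or> \<not> (\<exists>y z. [e 1, y, z] \<in> ?Gr) \<and> e 0 = e 1)"
    by (intro defpred_rules dpGr)
  moreover have "y = x t \<longleftrightarrow> (\<exists>z. [t, y, z] \<in> ?Gr) \<or> \<not> (\<exists>y z. [t, y, z] \<in> ?Gr) \<and> y = t" for y t
    unfolding Gr by (auto simp: x_def)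
  ultimately have dx: "deffun x" unfolding deffun_def by simp
  have "defpred (\<lambda>e. (\<exists>z. [e 1, z, e 0] \<in> ?Gr) \<or> \<not> (\<exists>y z. [e 1, y, z] \<in> ?Gr) \<and> e 0 = e 1)"
    by (intro defpred_rules dpGr)
  moreover have "y = l t \<longleftrightarrow> (\<exists>z. [t, z, y] \<in> ?Gr) \<or> \<not> (\<exists>y z. [t, y, z] \<in> ?Gr) \<and> y = t" for y t
    unfolding Gr by (auto simp: l_def)
  ultimately have dl: "deffun l" unfolding deffun_def by simp
  have lim: "\<exists>z\<in>topspace ctop. \<forall>U. openin ctop U \<and> z \<in> U \<longrightarrow> ev e {t. \<gamma> t \<in> U}"
    if e: "isend e" "ev e (ointerval a b)" for e
  proof -
    have "ev e {t. [x t, l t] \<in> code ` {g. cpoint g}}"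
      by (rule ev_mono[OF e(2)]) (use eq \<gamma> in force)
    from curve_limit[OF e(1) dx dl this] obtain g where g: "cpoint g"
      "\<And>U. openin ctop U \<Longrightarrow> code g \<in> U \<Longrightarrow> ev e {t. [x t, l t] \<in> U}" by blast
    have "ev e {t. \<gamma> t \<in> U}" if "openin ctop U" "code g \<in> U" for U
    proof -
      have "ev e ({t. [x t, l t] \<in> U} \<inter> ointerval a b)" using g(2)[OF that] e(2)
        by (simp add: ev_Int_iff)
      then show ?thesis by (rule ev_mono) (use eq in auto)
    qed
    then show ?thesis unfolding topspace_ctop using g(1) by blast
  qed
  obtain t where t: "t \<in> ointerval a b"
    using infinite_imp_nonempty[OF infinite_ointerval[OF ab]] by blast
  have "ev (left_germ a) (ointerval a b)" unfolding ointerval_left[OF ab]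
    using t by (intro bexI[of _ t]) (auto simp: ointerval_def intro: less_trans[of _
      "Fin t" b] less_trans[of a "Fin t"])
  moreover have "ev (right_germ b) (ointerval a b)" unfolding ointerval_right[OF ab]
    using t by (intro bexI[of _ t]) (auto simp: ointerval_def intro: less_trans[of _
      "Fin t" b] less_trans[of a "Fin t"])
  ultimately show "(\<exists>z\<in>topspace ctop. converges_left ctop a b \<gamma> z) \<and>
      (\<exists>z\<in>topspace ctop. converges_right ctop a b \<gamma> z)"
    unfolding converges_left_iff[OF ab] converges_right_iff[OF ab] using lim isend_boundary by blast
qed

end

section \<open>Regularity of a space that embeds in a definably compact one\<close>

context hausdorff_line
begin

text \<open>Realises an end as a boundary of an interval, so that definable compactness can be
  applied along it.\<close>

lemma definable_curve_at:
  assumes g: "isend g" "ev g A"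
  obtains a b where "a < b" "ointerval a b \<subseteq> A" "g = left_germ a \<or> g = right_germ b"
proof -
  obtain s where s: "side g s" "nbd g s \<subseteq> A" using g(2) unfolding ev_def by blast
  show ?thesis
  proof (cases g)
    case (Rgt t)
    then show ?thesis using s by (intro that[of "Fin t" "Fin s"]) (auto simp: ointerval_def)
  next
    case (Lft t)
    then show ?thesis using s by (intro that[of "Fin s" "Fin t"]) (auto simp: ointerval_def)
  next
    case PosInf
    then show ?thesis using s by (intro that[of "Fin s" Pinf]) (auto simp: ointerval_def)
  next
    case NegInf
    then show ?thesis using s by (intro that[of Minf "Fin s"]) (auto simp: ointerval_def)
  qed (use g in auto)
qed

text \<open>\<open>cont\<close> and \<open>emb\<close> are the two halves of F being an embedding,
  stated on the line: open sets pull back, and open sets of X are traces.\<close>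

lemma regular_of_compactification:
  assumes haus: "Hausdorff_space S" and compact: "definably_compact M m S"
    and F: "F ` X \<subseteq> topspace S" and graph: "definable M (Suc m) ((\<lambda>t. t # F t) ` X)"
    and cont: "\<And>W. openin S W \<Longrightarrow> opn {t\<in>X. F t \<in> W}"
    and emb: "\<And>U. opn U \<Longrightarrow> \<exists>W. openin S W \<and> (\<forall>t\<in>X. F t \<in> W \<longleftrightarrow> t \<in> U)"
    and U: "opn U" "x \<in> U"
  shows "\<exists>V. opn V \<and> x \<in> V \<and> cl V \<subseteq> U"
proof (rule ccontr)
  assume neg: "\<not> ?thesis"
  have xX: "x \<in> X" using U opn_sub by blast
  \<comment> \<open>U may fail to be definable, so a basic neighbourhood inside it is removed
    instead.\<close>
  obtain u0 where u0: "u0 \<in> Om" "x \<in> Bas u0" "Bas u0 \<subseteq> U" using Bas_ex[OF U] by blast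
  let ?C = "\<lambda>u. {y. y \<in> X \<and> (\<forall>v. length v = k \<longrightarrow> (v \<in> Om \<and> y \<in> Bas v \<longrightarrow>
    (\<exists>z. (v \<in> Om \<and> z \<in> Bas v) \<and> (u \<in> Om \<and> z \<in> Bas u)))) \<and> \<not> y \<in> Bas u0}"
  have C: "?C u = cl (Bas u) - Bas u0" if u: "u \<in> Om" for u
  proof (rule set_eqI)
    fix y
    have "(\<forall>v. length v = k \<longrightarrow> (v \<in> Om \<and> y \<in> Bas v \<longrightarrow> (\<exists>z. (v \<in> Om \<and> z \<in> Bas v) \<and> (u \<in> Om \<and>
        z \<in> Bas u)))) \<longleftrightarrow>
        (\<forall>v. v \<in> Om \<and> y \<in> Bas v \<longrightarrow> (\<exists>z. z \<in> Bas v \<and> z \<in> Bas u))"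
      using u Om_length by blast
    then show "y \<in> ?C u \<longleftrightarrow> y \<in> cl (Bas u) - Bas u0" by (simp add: cl_Bas)
  qed
  have dpC: "defpred (\<lambda>e. f e \<in> ?C (L e))" if L: "deftuple k L" and f: "defterm f" for L f
    unfolding mem_Collect_eq
    by (intro defpred_rules defpred_tame[OF tame_X] f defpred_all_list defpred_Bas deftuple_vars
      deftuple_ren deftuple_ren'[OF L, of "\<lambda>i. Suc i + k"]
        deftuple_ren'[OF deftuple_ren'[OF L]] defterm_ren[OF f] defpred_tame[OF tame_Bas[OF u0(1)]])
  define \<F> where "\<F> = (\<lambda>u. cl (Bas u) - Bas u0) ` {u\<in>Om. x \<in> Bas u}"
  have "\<exists>g. \<forall>A\<in>\<F>. ev g A"
  proof (rule directed_germ)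
    fix A assume "A \<in> \<F>"
    then obtain u where u: "u \<in> Om" "x \<in> Bas u" "A = cl (Bas u) - Bas u0" unfolding \<F>_def by blast
    show "tame A"
      unfolding tame_def u(3) C[OF u(1), symmetric]
        by (intro dpC deftuple_const Om_length u defterm_var)
    have "\<not> cl (Bas u) \<subseteq> U" using neg opn_Bas[OF u(1)] u(2) by blast
    then show "A \<noteq> {}" using u0(3) u(3) by blast
  next
    fix A B assume "A \<in> \<F>" "B \<in> \<F>"
    then obtain u v where uv: "u \<in> Om" "x \<in> Bas u" "A = cl (Bas u) - Bas u0"
      "v \<in> Om" "x \<in> Bas v" "B = cl (Bas v) - Bas u0" unfolding \<F>_def by blast
    obtain w where w: "w \<in> Om" "x \<in> Bas w" "Bas w \<subseteq> Bas u \<inter> Bas v"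
      using Bas_ex[OF opn_Int[OF opn_Bas[OF uv(1)] opn_Bas[OF uv(4)]], of x] uv(2,5) by auto
    then have "cl (Bas w) - Bas u0 \<in> \<F>" unfolding \<F>_def by blast
    moreover have "cl (Bas w) - Bas u0 \<subseteq> A \<inter> B" using w(3) uv(3,6) unfolding cl_def by blast
    ultimately show "\<exists>C\<in>\<F>. C \<subseteq> A \<inter> B" by blast
  next
    have "defpred (\<lambda>e. \<exists>u. length u = k \<and> ((u \<in> Om \<and> x \<in> Bas u) \<and> (\<forall>y. y \<in> ?C u \<longrightarrow> e 0 \<le> y)))"
      by (intro defpred_rules defpred_ex_list defpred_Bas dpC deftuple_vars deftuple_ren)
    moreover have "s \<in> {s. \<exists>A\<in>\<F>. A \<subseteq> {s..}} \<longleftrightarrow>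
        (\<exists>u. length u = k \<and> ((u \<in> Om \<and> x \<in> Bas u) \<and> (\<forall>y. y \<in> ?C u \<longrightarrow> s \<le> y)))" for s
    proof -
      have "(\<forall>y. y \<in> ?C u \<longrightarrow> s \<le> y) \<longleftrightarrow> cl (Bas u) - Bas u0 \<subseteq> {s..}" if "u \<in> Om" for u
        unfolding C[OF that] by auto
      then have "(\<exists>u. length u = k \<and> ((u \<in> Om \<and> x \<in> Bas u) \<and> (\<forall>y. y \<in> ?C u \<longrightarrow> s \<le> y))) \<longleftrightarrow>
          (\<exists>u. (u \<in> Om \<and> x \<in> Bas u) \<and> cl (Bas u) - Bas u0 \<subseteq> {s..})"
        using Om_length by blast
      then show ?thesis unfolding \<F>_def by blast
    qed
    ultimately show "tame {s. \<exists>A\<in>\<F>. A \<subseteq> {s..}}" unfolding tame_def by simp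
  qed
  then obtain g where g: "\<And>u. u \<in> Om \<Longrightarrow> x \<in> Bas u \<Longrightarrow> ev g (cl (Bas u) - Bas u0)" unfolding \<F>_def
    by blast
  have gX: "ev g (X - Bas u0)" by (rule ev_mono[OF g[OF u0(1,2)]]) (auto simp: cl_def)
  \<comment> \<open>A point lying in all these sets would differ from x and be in the closure of
    every neighbourhood of x, against the Hausdorff property of X.\<close>
  have "isend g"
  proof (rule ccontr)
    assume "\<not> isend g"
    then obtain y where y: "g = Pt y" using not_isend by blast
    then have "y \<in> X" "y \<noteq> x" using gX u0(2) by auto
    then obtain V W where VW: "opn V" "opn W" "x \<in> V" "y \<in> W" "V \<inter> W = {}" using separate xX
      by blast
    then obtain u where u: "u \<in> Om" "x \<in> Bas u" "Bas u \<subseteq> V" using Bas_ex by blast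
    then have "y \<in> cl (Bas u)" using g y by simp
    then show False using VW u(3) unfolding cl_def by blast
  qed
  have "ev g X" by (rule ev_mono[OF gX]) blast
  then obtain a b where ab: "a < b" "ointerval a b \<subseteq> X" "g = left_germ a \<or> g = right_germ b"
    by (rule definable_curve_at[OF \<open>isend g\<close>])
  have "definable_curve M m (topspace S) a b F"
    unfolding definable_curve_def
  proof (intro conjI)
    show "a < b" by fact
    show "F ` ointerval a b \<subseteq> topspace S" using F ab(2) by blast
    have "tame (ointerval a b)"
    proof -
      have "defpred (\<lambda>e. a < Fin (e 0))" by (cases a) (auto intro: defpred_rules)
      moreover have "defpred (\<lambda>e. Fin (e 0) < b)" by (cases b) (auto intro: defpred_rules)
      ultimately show ?thesis unfolding tame_def ointerval_def mem_Collect_eq by (rule defpred_conj)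
    qed
    then have "defpred (\<lambda>e. map e [0..<Suc m] \<in> (\<lambda>t. t # F t) ` X \<and> e 0 \<in> ointerval a b)"
      by (intro defpred_conj defpred_definable[OF graph] deftuple_vars defpred_tame defterm_var)
    from definable_of_defpred[OF this, of "Suc m" "\<lambda>_. undefined"]
    show "definable M (Suc m) ((\<lambda>t. t # F t) ` ointerval a b)"
    proof (rule back_subst[where P = "definable M (Suc m)"])
      let ?E = "\<lambda>xs i. if i < Suc m then xs ! i else undefined"
      have map: "map (?E xs) [0..<Suc m] = xs" if "length xs = Suc m" for xs :: "'a list"
        using that by (intro nth_equalityI) (auto simp del: upt_Suc)
      have len: "length (t # F t) = Suc m" if "t \<in> X" for t
        using graph that unfolding definable_def by blast
      show "{xs. length xs = Suc m \<and> map (?E xs) [0..<Suc m] \<in> (\<lambda>t. t # F t) ` X \<and>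
          ?E xs 0 \<in> ointerval a b}
          = (\<lambda>t. t # F t) ` ointerval a b" (is "?L = ?R")
      proof (intro set_eqI iffI)
        fix xs assume "xs \<in> ?L"
        then have "length xs = Suc m" "xs \<in> (\<lambda>t. t # F t) ` X" "xs ! 0 \<in> ointerval a b"
          using map[of xs] by auto
        then show "xs \<in> ?R" by auto
      next
        fix xs assume "xs \<in> ?R"
        then obtain t where t: "t \<in> ointerval a b" "xs = t # F t" by blast
        then have "length xs = Suc m" "xs \<in> (\<lambda>t. t # F t) ` X" "xs ! 0 \<in> ointerval a b"
          using ab(2) len by auto
        then show "xs \<in> ?L" using map[of xs] by simp
      qed
    qed
  qed
  then have "(\<exists>z\<in>topspace S. converges_left S a b F z) \<and> (\<exists>z\<in>topspace S. converges_right S a b F z)"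
    using compact unfolding definably_compact_def by blast
  then have "\<exists>z\<in>topspace S. \<forall>W. openin S W \<and> z \<in> W \<longrightarrow> ev g {t. F t \<in> W}"
    unfolding converges_left_iff[OF ab(1)] converges_right_iff[OF ab(1)] using ab(3)
      by (elim disjE) simp_all
  then obtain z where z: "z \<in> topspace S" "\<And>W. openin S W \<Longrightarrow> z \<in> W \<Longrightarrow> ev g {t. F t \<in> W}"
    by blast
  show False
  proof (cases "z = F x")
    case True
    \<comment> \<open>If the limit is the image of x, the germ g has to enter \<open>Bas u0\<close>,
      which it avoids.\<close>
    obtain W where W: "openin S W" "\<forall>t\<in>X. F t \<in> W \<longleftrightarrow> t \<in> Bas u0" using emb[OF opn_Bas[OF u0(1)]]
      by blast
    then have "ev g {t. F t \<in> W}" using z(2) True u0(2) xX by blast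
    from ev_meets[OF this gX] show False using W(2) by blast
  next
    case False
    moreover have "F x \<in> topspace S" using F xX by blast
    ultimately have "\<exists>W W'. openin S W \<and> openin S W' \<and> z \<in> W \<and> F x \<in> W' \<and> disjnt W W'"
      using haus z(1) unfolding Hausdorff_space_def by simp
    then obtain W W' where W: "openin S W" "openin S W'" "z \<in> W" "F x \<in> W'" "W \<inter> W' = {}"
      unfolding disjnt_def by (elim exE conjE) (rule that)
    obtain u where u: "u \<in> Om" "x \<in> Bas u" "Bas u \<subseteq> {t\<in>X. F t \<in> W'}"
      using Bas_ex[OF cont[OF W(2)], of x] xX W(4) by blast
    \<comment> \<open>A point y of the closure of \<open>Bas u\<close> is mapped into W, so the open
      preimage of W meets \<open>Bas u\<close>, whose image lies in \<open>W'\<close>.\<close>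
    from ev_meets[OF z(2)[OF W(1,3)] g[OF u(1,2)]]
    obtain y where y: "F y \<in> W" "y \<in> cl (Bas u)" by blast
    then have "{t\<in>X. F t \<in> W} \<inter> Bas u \<noteq> {}" using cont[OF W(1)] unfolding cl_def by blast
    then show False using u(3) W(5) by blast
  qed
qed

end

section \<open>Transfer between lists of length one and the line, and the two implications\<close>

theorem theorem8p6:
  fixes M :: "('f, 'r, 'a::unbounded_dense_linorder) expansion"
    and T :: "'a list topology"
  assumes "o_minimal M"
    and "definable_top_space M 1 T"
    and "Hausdorff_space T"
  shows "regular_space T \<longleftrightarrow>
    (\<exists>m Tc f. definable_top_space M m Tc \<and> definably_compact M m Tc \<and> Hausdorff_space Tc \<and>
       odim M (topspace Tc) \<le> 1 \<and> definable_embedding M 1 m T Tc f)"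
proof -
  let ?h = "\<lambda>t :: 'a. [t]"
  define X where "X = {t. [t] \<in> topspace T}"
  define opn where "opn U \<longleftrightarrow> openin T (?h ` U)" for U
  have len: "length x = 1" if "x \<in> topspace T" for x
    using assms(2) that unfolding definable_top_space_def definable_def by blast
  have single: "\<exists>t\<in>X. x = [t]" if "x \<in> topspace T" for x
    using len[OF that] that by (auto simp: X_def length_Suc_conv)
  have hX: "?h ` X = topspace T" using single by (auto simp: X_def)
  have pull: "?h ` {t\<in>X. [t] \<in> U} = U" if "openin T U" for U
    using openin_subset[OF that] single by (force simp: X_def)
  obtain \<B> where \<B>: "definable_family M 1 \<B>" "\<forall>V\<in>\<B>. openin T V"
    "\<forall>U x. openin T U \<and> x \<in> U \<longrightarrow> (\<exists>V\<in>\<B>. x \<in> V \<and> V \<subseteq> U)"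
    using assms(2) unfolding definable_top_space_def by blast
  from \<B>(1) obtain k \<Omega> B where \<B>_eq: "\<B> = B ` \<Omega>" and \<Omega>: "definable M k \<Omega>" and B:
    "\<forall>u\<in>\<Omega>. \<forall>x\<in>B u. length x = 1"
    and fam: "definable M (k + 1) {u @ x |u x. u \<in> \<Omega> \<and> x \<in> B u}"
    unfolding definable_family_def by (elim exE conjE) (rule that)
  note Bo = \<B>(2)[unfolded \<B>_eq] and Bb = \<B>(3)[unfolded \<B>_eq]
  define Bas where "Bas u = {t. [t] \<in> B u}" for u
  have hBas: "?h ` Bas u = B u" if "u \<in> \<Omega>" for u
    using B that by (force simp: Bas_def length_Suc_conv)
  interpret omin_line M by unfold_locales (rule assms(1))
  have line: "hausdorff_line M X opn k \<Omega> Bas"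
  proof
    show "tame X" unfolding tame_iff_definable hX using assms(2)
      by (simp add: definable_top_space_def)
    show "opn X" by (simp add: opn_def hX)
    show "U \<subseteq> X" if "opn U" for U using openin_subset[OF that[unfolded opn_def]]
      by (auto simp: X_def)
    show "opn (U \<inter> V)" if "opn U" "opn V" for U V
    proof -
      have "?h ` (U \<inter> V) = ?h ` U \<inter> ?h ` V" by auto
      then show ?thesis using that unfolding opn_def by (simp add: openin_Int)
    qed
    show "opn U" if loc: "\<And>x. x \<in> U \<Longrightarrow> \<exists>V. opn V \<and> x \<in> V \<and> V \<subseteq> U" for U
      unfolding opn_def
    proof (subst openin_subopen, intro ballI)
      fix y assume "y \<in> ?h ` U"
      then obtain x where x: "x \<in> U" "y = [x]" by blast
      then obtain V where "opn V" "x \<in> V" "V \<subseteq> U" using loc by blast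
      then show "\<exists>W. openin T W \<and> y \<in> W \<and> W \<subseteq> ?h ` U"
        unfolding opn_def using x by (intro exI[of _ "?h ` V"]) auto
    qed
    show "opn (Bas u)" if "u \<in> \<Omega>" for u using Bo that by (simp add: opn_def hBas)
    show "\<exists>u\<in>\<Omega>. x \<in> Bas u \<and> Bas u \<subseteq> U" if "opn U" "x \<in> U" for U x
    proof -
      obtain u where "u \<in> \<Omega>" "[x] \<in> B u" "B u \<subseteq> ?h ` U" using Bb \<open>opn U\<close> \<open>x \<in> U\<close> unfolding opn_def
        by blast
      then show ?thesis by (intro bexI[of _ u]) (auto simp: Bas_def)
    qed
    show lenO: "length u = k" if "u \<in> \<Omega>" for u using \<Omega> that unfolding definable_def by blast
    show "defpred (\<lambda>e. L e \<in> \<Omega>)" if "deftuple k L" for L using defpred_definable[OF \<Omega> that] .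
    show "defpred (\<lambda>e. L e \<in> \<Omega> \<and> f e \<in> Bas (L e))" if L: "deftuple k L" "defterm f" for L f
    proof -
      have "defpred (\<lambda>e. L e @ [f e] \<in> {u @ x |u x. u \<in> \<Omega> \<and> x \<in> B u})"
        by (rule defpred_definable[OF fam]) (use deftuple_append[OF L(1) deftuple_Cons[OF L(2)
          deftuple_Nil]] in simp)
      moreover have "L e @ [f e] \<in> {u @ x |u x. u \<in> \<Omega> \<and> x \<in> B u} \<longleftrightarrow> L e \<in> \<Omega> \<and> f e \<in> Bas (L e)" for e
      proof
        assume "L e @ [f e] \<in> {u @ x |u x. u \<in> \<Omega> \<and> x \<in> B u}"
        then obtain u x where ux: "L e @ [f e] = u @ x" "u \<in> \<Omega>" "x \<in> B u" by blast
        then have "length x = length [f e]" using B by simp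
        then have "L e = u" "[f e] = x" using ux(1) append_eq_append_conv[of x "[f e]" u "L e"]
          by auto
        then show "L e \<in> \<Omega> \<and> f e \<in> Bas (L e)" using ux by (simp add: Bas_def)
      qed (auto simp: Bas_def)
      ultimately show ?thesis by simp
    qed
    show "\<exists>U V. opn U \<and> opn V \<and> x \<in> U \<and> y \<in> V \<and> U \<inter> V = {}" if "x \<in> X" "y \<in> X" "x \<noteq> y" for x y
    proof -
      obtain U V where UV: "openin T U" "openin T V" "[x] \<in> U" "[y] \<in> V" "disjnt U V"
      proof -
        have "[x] \<in> topspace T \<and> [y] \<in> topspace T \<and> [x] \<noteq> [y]"
          using \<open>x \<in> X\<close> \<open>y \<in> X\<close> \<open>x \<noteq> y\<close> by (simp add: X_def)
        then have "\<exists>U V. openin T U \<and> openin T V \<and> [x] \<in> U \<and> [y] \<in> V \<and> disjnt U V"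
          using assms(3) unfolding Hausdorff_space_def by (elim allE impE)
        then show ?thesis by (elim exE conjE) (rule that)
      qed
      then show ?thesis
        using pull[OF UV(1)] pull[OF UV(2)] that
        by (intro exI[of _ "{t\<in>X. [t] \<in> U}"] exI[of _
          "{t\<in>X. [t] \<in> V}"]) (auto simp: opn_def disjnt_def)
    qed
  qed
  then interpret hausdorff_line M X opn k \<Omega> Bas .
  show ?thesis
  proof
    assume reg: "regular_space T"
    interpret regular_line M X opn k \<Omega> Bas
    proof
      fix U x assume U: "opn U" "x \<in> U"
      then have "closedin T (topspace T - ?h ` U)" "[x] \<in> topspace T - (topspace T - ?h ` U)"
        using openin_subset[of T "?h ` U"] by (auto simp: opn_def)
      then have "\<exists>V W. openin T V \<and> openin T W \<and> [x] \<in> V \<and> topspace T - ?h ` U \<subseteq> W \<and> disjnt V W"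
        using reg unfolding regular_space_def by simp
      then obtain V W where VW: "openin T V" "openin T W" "[x] \<in> V" "topspace T - ?h ` U \<subseteq> W"
        "disjnt V W"
        by (elim exE conjE) (rule that)
      let ?V = "{t\<in>X. [t] \<in> V}" and ?W = "{t\<in>X. [t] \<in> W}"
      have o: "opn ?V" "opn ?W" using pull VW by (auto simp: opn_def)
      have "cl ?V \<subseteq> U"
      proof
        fix y assume y: "y \<in> cl ?V"
        have "y \<in> X" using y by (simp add: cl_def)
        show "y \<in> U"
        proof (rule ccontr)
          assume "y \<notin> U"
          then have "y \<in> ?W" using VW(4) \<open>y \<in> X\<close> by (auto simp: X_def)
          then have "?W \<inter> ?V \<noteq> {}" using y o(2) unfolding cl_def by blast
          then show False using VW(5) by (auto simp: disjnt_def)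
        qed
      qed
      moreover have "x \<in> ?V" using VW(3) U opn_sub by blast
      ultimately show "\<exists>V. opn V \<and> x \<in> V \<and> cl V \<subseteq> U" using o(1) by blast
    qed
    \<comment> \<open>Appending \<open>lab 0\<close> is \<open>code\<close> composed with
      \<open>Pt\<close>: the embedding lands in the copy of the line reserved for points.\<close>
    let ?f = "\<lambda>xs. xs @ [lab 0]"
    have f_top: "?f ` topspace T \<subseteq> topspace ctop"
      unfolding topspace_ctop hX[symmetric] by (auto intro!: image_eqI[where x = "Pt _"])
    have f_mem: "?f [t] \<in> code ` hat V \<longleftrightarrow> t \<in> V" if "opn V" for t V
      using code_image[of "Pt t" "hat V"] Pt_hat[OF opn_sub[OF that]] by simp
    have "definable_map M 1 2 (topspace T) (topspace ctop) ?f"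
      unfolding definable_map_def
    proof (intro conjI)
      have "defpred (\<lambda>e. e 0 \<in> X \<and> e 1 = e 0 \<and> e 2 = lab 0)"
        by (intro defpred_rules defpred_tame[OF tame_X])
      from definable_of_defpred[OF this, of 3 "\<lambda>_. undefined"]
      have "definable M 3 {xs. length xs = 3 \<and> xs ! 0 \<in> X \<and> xs ! 1 = xs ! 0 \<and> xs ! 2 = lab 0}"
        by simp
      moreover have "(\<lambda>x. x @ ?f x) ` topspace T = {xs. length xs = 3 \<and> xs ! 0 \<in> X \<and> xs ! 1 =
          xs ! 0 \<and> xs ! 2 = lab 0}"
        unfolding hX[symmetric] by (auto simp: length_Suc_conv numeral_3_eq_3 numeral_2_eq_2
          image_iff)
      moreover have "(1 + 2 :: nat) = 3" by simp
      ultimately show "definable M (1 + 2) ((\<lambda>x. x @ ?f x) ` topspace T)" by (simp only:)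
    qed (rule f_top)
    moreover have "embedding_map T ctop ?f"
      unfolding embedding_map_def
    proof (rule bijective_open_imp_homeomorphic_map)
      show "continuous_map T (subtopology ctop (?f ` topspace T)) ?f"
        unfolding continuous_map_in_subtopology
      proof (intro conjI)
        show "continuous_map T ctop ?f"
          unfolding continuous_map_def
        proof (intro conjI allI impI)
          fix U assume U: "openin ctop U"
          show "openin T {x \<in> topspace T. ?f x \<in> U}"
          proof (subst openin_subopen, intro ballI)
            fix x assume "x \<in> {x \<in> topspace T. ?f x \<in> U}"
            then have x: "x \<in> topspace T" "?f x \<in> U" by auto
            obtain t where "x = [t]" using single[OF x(1)] by blast
            with x(2) have t: "x = [t]" "code (Pt t) \<in> U" by simp_all
            have "\<exists>V. opn V \<and> tame V \<and> Pt t \<in> hat V \<and> code ` hat V \<subseteq> U"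
              using U t(2) unfolding openin_ctop by blast
            then obtain V where V: "opn V" "Pt t \<in> hat V" "code ` hat V \<subseteq> U" by blast
            have "?h ` V \<subseteq> {x \<in> topspace T. ?f x \<in> U}"
            proof
              fix y assume "y \<in> ?h ` V"
              then obtain r where r: "r \<in> V" "y = [r]" by blast
              then have "?f [r] \<in> U" using f_mem[OF V(1)] V(3) by blast
              moreover have "y \<in> topspace T" using r opn_sub[OF V(1)] hX by blast
              ultimately show "y \<in> {x \<in> topspace T. ?f x \<in> U}" using r by simp
            qed
            moreover have "x \<in> ?h ` V" using t V(2) Pt_hat[OF opn_sub[OF V(1)]] by simp
            ultimately show "\<exists>W. openin T W \<and> x \<in> W \<and> W \<subseteq> {x \<in> topspace T. ?f x \<in> U}"
              using V(1) unfolding opn_def by blast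
          qed
        qed (use f_top in auto)
      qed auto
      show "open_map T (subtopology ctop (?f ` topspace T)) ?f"
        unfolding open_map_def
      proof (intro allI impI)
        fix U assume U: "openin T U"
        show "openin (subtopology ctop (?f ` topspace T)) (?f ` U)"
        proof (subst openin_subopen, intro ballI)
          fix y assume "y \<in> ?f ` U"
          then obtain x where x: "x \<in> U" "y = ?f x" by blast
          then obtain u where u: "u \<in> \<Omega>" "x \<in> B u" "B u \<subseteq> U" using Bb U by blast
          then obtain t where t: "x = [t]" "t \<in> Bas u" using hBas by blast
          \<comment> \<open>A hat contains no old points beyond those of the original set, so its
            trace on the image is the image of that set; this makes the map open onto its
            image.\<close>
          have "?f ` topspace T \<inter> code ` hat (Bas u) = ?f ` B u"
            unfolding hX[symmetric] hBas[OF u(1), symmetric]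
          proof (intro set_eqI iffI)
            fix z assume "z \<in> ?f ` ?h ` X \<inter> code ` hat (Bas u)"
            then obtain t where "z = ?f [t]" "?f [t] \<in> code ` hat (Bas u)" by auto
            then show "z \<in> ?f ` ?h ` Bas u" using f_mem[OF opn_Bas[OF u(1)]] by blast
          next
            fix z assume "z \<in> ?f ` ?h ` Bas u"
            then obtain t where t: "z = ?f [t]" "t \<in> Bas u" by auto
            then show "z \<in> ?f ` ?h ` X \<inter> code ` hat (Bas u)"
              using f_mem[OF opn_Bas[OF u(1)]] opn_sub[OF opn_Bas[OF u(1)]] by blast
          qed
          then have "openin (subtopology ctop (?f ` topspace T)) (?f ` B u)"
            using openin_subtopology_Int2[OF openin_hat[OF opn_Bas[OF u(1)] tame_Bas[OF u(1)]]]
              by metis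
          then show "\<exists>W. openin (subtopology ctop (?f ` topspace T)) W \<and> y \<in> W \<and> W \<subseteq> ?f ` U"
            using u x by blast
        qed
      qed
      show "?f ` topspace T = topspace (subtopology ctop (?f ` topspace T))"
        using f_top by auto
      show "inj_on ?f (topspace T)" by (rule inj_onI) simp
    qed
    ultimately have "definable_embedding M 1 2 T ctop ?f" unfolding definable_embedding_def by blast
    then show "\<exists>m Tc f. definable_top_space M m Tc \<and> definably_compact M m Tc \<and> Hausdorff_space Tc \<and>
       odim M (topspace Tc) \<le> 1 \<and> definable_embedding M 1 m T Tc f"
      using definable_ctop definably_compact_ctop Hausdorff_ctop odim_ctop by blast
  next
    assume "\<exists>m Tc f. definable_top_space M m Tc \<and> definably_compact M m Tc \<and> Hausdorff_space Tc \<and>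
       odim M (topspace Tc) \<le> 1 \<and> definable_embedding M 1 m T Tc f"
    then obtain m Tc f where Tc: "definably_compact M m Tc" "Hausdorff_space Tc"
      and map: "definable_map M 1 m (topspace T) (topspace Tc) f" and emb: "embedding_map T Tc f"
      unfolding definable_embedding_def by blast
    have homeo: "homeomorphic_map T (subtopology Tc (f ` topspace T)) f"
      using emb by (simp add: embedding_map_def)
    have contf: "continuous_map T Tc f"
      using homeomorphic_imp_continuous_map[OF homeo] continuous_map_in_subtopology by blast
    have inj: "inj_on f (topspace T)" using homeomorphic_imp_injective_map[OF homeo] .
    let ?F = "\<lambda>t. f [t]"
    have reg: "\<exists>V. opn V \<and> x \<in> V \<and> cl V \<subseteq> U" if U: "opn U" "x \<in> U" for U x
    proof (rule regular_of_compactification[OF Tc(2,1) _ _ _ _ U, of ?F])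
      show "?F ` X \<subseteq> topspace Tc" using map unfolding definable_map_def by (auto simp: X_def)
      have "(\<lambda>t. t # f [t]) ` X = (\<lambda>x. x @ f x) ` topspace T"
        unfolding hX[symmetric] by (simp add: image_image)
      then show "definable M (Suc m) ((\<lambda>t. t # f [t]) ` X)" using map unfolding definable_map_def
        by simp
      show "opn {t \<in> X. f [t] \<in> W}" if "openin Tc W" for W
      proof -
        have o: "openin T {x \<in> topspace T. f x \<in> W}"
          using openin_continuous_map_preimage[OF contf that] .
        have "?h ` {t \<in> X. f [t] \<in> W} = {x \<in> topspace T. f x \<in> W}" unfolding hX[symmetric] by auto
        then show ?thesis using o by (simp add: opn_def)
      qed
      show "\<exists>W. openin Tc W \<and> (\<forall>t\<in>X. f [t] \<in> W \<longleftrightarrow> t \<in> U)" if U: "opn U" for U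
      proof -
        have "openin (subtopology Tc (f ` topspace T)) (f ` ?h ` U)"
          using homeomorphic_imp_open_map[OF homeo] U unfolding open_map_def opn_def by blast
        then obtain W where W: "openin Tc W" "f ` ?h ` U = W \<inter> f ` topspace T"
          unfolding openin_subtopology by blast
        \<comment> \<open>Injectivity of f recovers membership in U from membership in W.\<close>
        have "f [t] \<in> W \<longleftrightarrow> t \<in> U" if "t \<in> X" for t
        proof
          have tT: "[t] \<in> topspace T" using that by (simp add: X_def)
          assume "f [t] \<in> W"
          then have "f [t] \<in> f ` ?h ` U" using W(2) tT by blast
          then obtain r where r: "r \<in> U" "f [t] = f [r]" by blast
          then have "[r] \<in> topspace T" using opn_sub[OF U] by (auto simp: X_def)
          then show "t \<in> U" using inj_onD[OF inj r(2) tT] r(1) by simp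
        qed (use W(2) in blast)
        then show ?thesis using W(1) by blast
      qed
    qed
    show "regular_space T"
      unfolding regular_space_def
    proof (intro allI impI)
      fix C a assume C: "closedin T C \<and> a \<in> topspace T - C"
      then obtain x where x: "x \<in> X" "a = [x]" using single by blast
      let ?U = "{t\<in>X. [t] \<in> topspace T - C}"
      have oU: "openin T (topspace T - C)" using C by (simp add: openin_diff)
      have "opn ?U" using pull[OF oU] oU by (simp add: opn_def)
      moreover have "x \<in> ?U" using x C by simp
      ultimately obtain V where V: "opn V" "x \<in> V" "cl V \<subseteq> ?U" using reg by blast
      let ?W = "X - cl V"
      have "C \<subseteq> ?h ` ?W"
      proof
        fix y assume "y \<in> C"
        then have "y \<in> topspace T" using C closedin_subset by blast
        then obtain t where t: "t \<in> X" "y = [t]" using single by blast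
        then have "t \<notin> cl V" using V(3) \<open>y \<in> C\<close> by blast
        then show "y \<in> ?h ` ?W" using t by blast
      qed
      moreover have "disjnt (?h ` V) (?h ` ?W)" using subset_cl[OF opn_sub[OF V(1)]]
        by (auto simp: disjnt_def)
      moreover have "openin T (?h ` ?W)" using opn_compl_cl[of V] by (simp add: opn_def)
      ultimately show "\<exists>U V. openin T U \<and> openin T V \<and> a \<in> U \<and> C \<subseteq> V \<and> disjnt U V"
        using V(1,2) x(2) unfolding opn_def by blast
    qed
  qed
qed

end
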